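(* Consider the discounted MDP, the parametrized policies $\{\pi_\theta\}_{\theta\in\mathbb R^d}$ and the algorithm N-HARPG described in the context. Assume: (i) for all $(s,a)$, $\theta\mapsto\pi_\theta(a|s)$ is positive and twice continuously differentiable, and there are $M_g,M_h>0$ with $\|\nabla\log\pi_\theta(a|s)\|\le M_g$ and $\|\nabla^2\log\pi_\theta(a|s)\|\le M_h$ for all $\theta,s,a$; (ii) there is $\mu_F>0$ with $F_\rho(\theta)\succcurlyeq\mu_F I_d$ for all $\theta\in\mathbb R^d$; (iii) there is $\varepsilon_{\rm bias}\ge0$ such that for all $\theta\in\mathbb R^d$, $\mathbb E_{s\sim d_\rho^{\pi^*},\,a\sim\pi^*(\cdot|s)}\big[(A^{\pi_\theta}(s,a)-(1-\gamma)\,w^*(\theta)^\top\nabla\log\pi_\theta(a|s))^2\big]\le\varepsilon_{\rm bias}$, where $w^*(\theta)=F_\rho(\theta)^\dagger\nabla J(\theta)$. Set $\gamma_t=\frac{6M_g}{\mu_F(t+2)}$, $\eta_t=\frac{2}{t+2}$ and $H=(1-\gamma)^{-1}\log(T+1)$. Then for every integer $T\ge1$ the output $\theta_T$ of N-HARPG satisfies $$J^*-\mathbb E[J(\theta_T)]\le\mathcal O\left(\frac{\sigma_g+L_g+\sigma_h}{(T+1)^{1/2}}\right)+\frac{\sqrt{\varepsilon_{\rm bias}}}{1-\gamma}.$$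
   Context: **MDP.** $(\mathcal S,\mathcal A,\mathcal P,r,\rho,\gamma)$: (possibly continuous) state and action spaces, transition density $\mathcal P(s'|s,a)$, reward $r:\mathcal S\times\mathcal A\to[-r_{\max},r_{\max}]$ with $r_{\max}>0$, initial distribution $\rho$, discount $\gamma\in(0,1)$. For $\theta\in\mathbb R^d$, $\pi_\theta(\cdot|s)$ is a probability density on $\mathcal A$. For a policy $\pi$, $J(\pi)=\mathbb E_{\rho,\pi}[\sum_{t\ge0}\gamma^tr(s_t,a_t)]$, with $s_0\sim\rho$, $a_t\sim\pi(\cdot|s_t)$, $s_{t+1}\sim\mathcal P(\cdot|s_t,a_t)$; $J(\theta)=J(\pi_\theta)$. $\pi^*$ is an optimal policy (maximizing the expected return), $J^*$ the optimal expected return. Derivatives are in $\theta$; norms are Euclidean/operator norms. **Other objects.** $d_\rho^\pi(\cdot)=(1-\gamma)\sum_{t\ge0}\gamma^t\,\mathbb P_{\rho,\pi}(s_t\in\cdot)$; $F_\rho(\theta)=\mathbb E_{s\sim d_\rho^{\pi_\theta},a\sim\pi_\theta(\cdot|s)}[\nabla\log\pi_\theta(a|s)\nabla\log\pi_\theta(a|s)^\top]$ with pseudo-inverse $F_\rho(\theta)^\dagger$; $Q^\pi(s,a)=\mathbb E_\pi[\sum_t\gamma^tr(s_t,a_t)|s_0=s,a_0=a]$, $V^\pi(s)=\mathbb E_{a\sim\pi(\cdot|s)}[Q^\pi(s,a)]$, $A^\pi=Q^\pi-V^\pi$. **Trajectories and estimators.** $\tau=(s_0,a_0,\dots,s_{H-1},a_{H-1})\sim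 p(\cdot|\pi_\theta)$ is a trajectory of length $H$ under $\rho,\pi_\theta$ (rounding of $H$ to an integer is left implicit), with density $p(\tau|\pi_\theta)=\rho(s_0)\pi_\theta(a_0|s_0)\prod_{t=1}^{H-1}\mathcal P(s_t|s_{t-1},a_{t-1})\pi_\theta(a_t|s_t)$. Let $\Phi(\tau,\theta)=\sum_{t=0}^{H-1}\big(\sum_{h=t}^{H-1}\gamma^hr(s_h,a_h)\big)\log\pi_\theta(a_t|s_t)$, $g(\tau,\theta)=\nabla\Phi(\tau,\theta)$, and $B(\tau,\theta)=\nabla\Phi(\tau,\theta)\,\nabla\log p(\tau|\pi_\theta)^\top+\nabla^2\Phi(\tau,\theta)$. **Algorithm N-HARPG.** Inputs: $\theta_0,\theta_1,d_0\in\mathbb R^d$, $T$, momentum parameters $\{\eta_t\}_{t\ge0}$, step-sizes $\{\gamma_t\}_{t\ge0}$. For $t=1,\dots,T-1$: draw $q_t\sim\mathcal U([0,1])$; $\hat\theta_t=q_t\theta_t+(1-q_t)\theta_{t-1}$; sample $\tau_t\sim p(\cdot|\pi_{\theta_t})$ and $\hat\tau_t\sim p(\cdot|\pi_{\hat\theta_t})$; $v_t=B(\hat\tau_t,\hat\theta_t)(\theta_t-\theta_{t-1})$; $d_t=(1-\eta_t)(d_{t-1}+v_t)+\eta_tg(\tau_t,\theta_t)$; $\theta_{t+1}=\theta_t+\gamma_td_t/\|d_t\|$ (with $\theta_{t+1}=\theta_t$ if $d_t=0$). Output $\theta_T$. (The step-sizes $\gamma_t$ are distinct from the discount factor $\gamma$.)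 **Constants.** $L_g=\frac{r_{\max}(M_g^2+M_h)}{(1-\gamma)^2}$, $\sigma_g^2=\frac{r_{\max}^2M_g^2}{(1-\gamma)^3}$, $\sigma_h^2=\frac{r_{\max}^2(H^2M_g^4+M_h^2)}{(1-\gamma)^4}$. **Notation.** By convention, unless otherwise specified, $\mathcal O(\cdot)$ hides only absolute constants which do not depend on any problem parameter. *)

theory Defs
  imports "HOL-Probability.Probability"
begin

definition grad :: "(real^'n \<Rightarrow> real) \<Rightarrow> real^'n \<Rightarrow> real^'n" where
  "grad f x = (THE D. GDERIV f x :> D)"

definition hessian :: "(real^'n \<Rightarrow> real) \<Rightarrow> real^'n \<Rightarrow> real^'n^'n" where
  "hessian f x = jacobian (grad f) (at x)"

definition twice_cont_diff :: "(real^'n \<Rightarrow> real) \<Rightarrow> bool" where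
  "twice_cont_diff f \<longleftrightarrow>
     (\<forall>x. f differentiable (at x)) \<and> (\<forall>x. grad f differentiable (at x)) \<and>
     continuous_on UNIV (hessian f)"

definition outer :: "real^'n \<Rightarrow> real^'n \<Rightarrow> real^'n^'n" where
  "outer u v = (\<chi> i j. u $ i * v $ j)"

definition op_norm :: "real^'n^'n \<Rightarrow> real" where
  "op_norm A = onorm (\<lambda>x. A *v x)"

definition psd :: "real^'n^'n \<Rightarrow> bool" where
  "psd A \<longleftrightarrow> transpose A = A \<and> (\<forall>x. 0 \<le> x \<bullet> (A *v x))"

definition loewner_le :: "real^'n^'n \<Rightarrow> real^'n^'n \<Rightarrow> bool" where
  "loewner_le A B \<longleftrightarrow> psd (B - A)"

text \<open>The Moore--Penrose inverse, characterised by the four Penrose equations.\<close>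

definition pseudo_inverse :: "real^'n^'n \<Rightarrow> real^'n^'n" where
  "pseudo_inverse A = (THE G. A ** G ** A = A \<and> G ** A ** G = G \<and>
     transpose (A ** G) = A ** G \<and> transpose (G ** A) = G ** A)"

text \<open>The measures \<open>state_space M\<close> and \<open>action_space M\<close> carry the sigma-algebras and are
  also the reference measures for all densities: Lebesgue measure or counting measure, for
  instance.\<close>

record ('s, 'a) mdp_data =
  state_space :: "'s measure"
  action_space :: "'a measure"
  transition :: "'s \<times> 'a \<Rightarrow> 's \<Rightarrow> real"
  reward :: "'s \<times> 'a \<Rightarrow> real"
  init :: "'s \<Rightarrow> real"
  discount :: real

abbreviation sa_space :: "('s, 'a) mdp_data \<Rightarrow> ('s \<times> 'a) measure" where
  "sa_space M \<equiv> state_space M \<Otimes>\<^sub>M action_space M"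

locale mdp =
  fixes M :: "('s, 'a) mdp_data" and r_max :: real
  assumes sigma_finite_states: "sigma_finite_measure (state_space M)"
    and sigma_finite_actions: "sigma_finite_measure (action_space M)"
    and transition_measurable:
      "(\<lambda>(x, s'). transition M x s') \<in> borel_measurable (sa_space M \<Otimes>\<^sub>M state_space M)"
    and transition_nonneg:
      "\<And>x s'. x \<in> space (sa_space M) \<Longrightarrow> s' \<in> space (state_space M) \<Longrightarrow> 0 \<le> transition M x s'"
    and transition_prob:
      "\<And>x. x \<in> space (sa_space M) \<Longrightarrow> (\<integral>\<^sup>+ s'. ennreal (transition M x s') \<partial>state_space M) = 1"
    and r_max_pos: "0 < r_max"
    and reward_measurable: "reward M \<in> borel_measurable (sa_space M)"
    and reward_bounded: "\<And>x. x \<in> space (sa_space M) \<Longrightarrow> reward M x \<in> {- r_max .. r_max}"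
    and init_measurable: "init M \<in> borel_measurable (state_space M)"
    and init_nonneg: "\<And>s. s \<in> space (state_space M) \<Longrightarrow> 0 \<le> init M s"
    and init_prob: "(\<integral>\<^sup>+ s. ennreal (init M s) \<partial>state_space M) = 1"
    and discount: "0 < discount M" "discount M < 1"

definition init_dist :: "('s, 'a) mdp_data \<Rightarrow> 's measure" where
  "init_dist M = density (state_space M) (\<lambda>s. ennreal (init M s))"

definition transition_kernel :: "('s, 'a) mdp_data \<Rightarrow> 's \<times> 'a \<Rightarrow> 's measure" where
  "transition_kernel M x = density (state_space M) (\<lambda>s'. ennreal (transition M x s'))"

text \<open>A policy is an arbitrary Markov kernel, so that deterministic policies are included even
  when the action space is continuous.\<close>

definition policies :: "('s, 'a) mdp_data \<Rightarrow> ('s \<Rightarrow> 'a measure) set" where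
  "policies M = measurable (state_space M) (prob_algebra (action_space M))"

definition with_action ::
  "('s, 'a) mdp_data \<Rightarrow> ('s \<Rightarrow> 'a measure) \<Rightarrow> 's measure \<Rightarrow> ('s \<times> 'a) measure" where
  "with_action M \<pi> \<nu> = \<nu> \<bind> (\<lambda>s. \<pi> s \<bind> (\<lambda>a. return (sa_space M) (s, a)))"

text \<open>\<open>trajectory M \<pi> \<mu>\<close> is the law of the infinite sequence \<open>(s\<^sub>t, a\<^sub>t)\<close> when
  \<open>(s\<^sub>0, a\<^sub>0)\<close> has law \<open>\<mu>\<close>, given by the Ionescu-Tulcea theorem.\<close>

definition chain_kernel ::
  "('s, 'a) mdp_data \<Rightarrow> ('s \<Rightarrow> 'a measure) \<Rightarrow> ('s \<times> 'a) measure \<Rightarrow>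
   nat \<Rightarrow> (nat \<Rightarrow> 's \<times> 'a) \<Rightarrow> ('s \<times> 'a) measure" where
  "chain_kernel M \<pi> \<mu> t \<omega> =
     (case t of 0 \<Rightarrow> \<mu> | Suc k \<Rightarrow> with_action M \<pi> (transition_kernel M (\<omega> k)))"

definition trajectory ::
  "('s, 'a) mdp_data \<Rightarrow> ('s \<Rightarrow> 'a measure) \<Rightarrow> ('s \<times> 'a) measure \<Rightarrow>
   (nat \<Rightarrow> 's \<times> 'a) measure" where
  "trajectory M \<pi> \<mu> = projective_family.lim UNIV
     (Ionescu_Tulcea.CI (chain_kernel M \<pi> \<mu>) (\<lambda>_. sa_space M)) (\<lambda>_. sa_space M)"

definition discounted_return :: "('s, 'a) mdp_data \<Rightarrow> (nat \<Rightarrow> 's \<times> 'a) \<Rightarrow> real" where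
  "discounted_return M \<omega> = (\<Sum>t. discount M ^ t * reward M (\<omega> t))"

definition expected_return :: "('s, 'a) mdp_data \<Rightarrow> ('s \<Rightarrow> 'a measure) \<Rightarrow> real" where
  "expected_return M \<pi> =
     (\<integral>\<omega>. discounted_return M \<omega> \<partial>trajectory M \<pi> (with_action M \<pi> (init_dist M)))"

definition optimal_policy :: "('s, 'a) mdp_data \<Rightarrow> ('s \<Rightarrow> 'a measure) \<Rightarrow> bool" where
  "optimal_policy M \<pi> \<longleftrightarrow>
     \<pi> \<in> policies M \<and> (\<forall>\<pi>'\<in>policies M. expected_return M \<pi>' \<le> expected_return M \<pi>)"

definition optimal_return :: "('s, 'a) mdp_data \<Rightarrow> real" where
  "optimal_return M = (SUP \<pi>\<in>policies M. expected_return M \<pi>)"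

definition Q_fun :: "('s, 'a) mdp_data \<Rightarrow> ('s \<Rightarrow> 'a measure) \<Rightarrow> 's \<times> 'a \<Rightarrow> real" where
  "Q_fun M \<pi> x = (\<integral>\<omega>. discounted_return M \<omega> \<partial>trajectory M \<pi> (return (sa_space M) x))"

definition V_fun :: "('s, 'a) mdp_data \<Rightarrow> ('s \<Rightarrow> 'a measure) \<Rightarrow> 's \<Rightarrow> real" where
  "V_fun M \<pi> s = (\<integral>a. Q_fun M \<pi> (s, a) \<partial>\<pi> s)"

definition advantage :: "('s, 'a) mdp_data \<Rightarrow> ('s \<Rightarrow> 'a measure) \<Rightarrow> 's \<times> 'a \<Rightarrow> real" where
  "advantage M \<pi> x = Q_fun M \<pi> x - V_fun M \<pi> (fst x)"

definition visitation :: "('s, 'a) mdp_data \<Rightarrow> ('s \<Rightarrow> 'a measure) \<Rightarrow> 's measure" where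
  "visitation M \<pi> = measure_of (space (state_space M)) (sets (state_space M))
     (\<lambda>B. let P = trajectory M \<pi> (with_action M \<pi> (init_dist M)) in
        ennreal ((1 - discount M) *
          (\<Sum>t. discount M ^ t * measure P {\<omega> \<in> space P. fst (\<omega> t) \<in> B})))"

locale policy_family =
  fixes M :: "('s, 'a) mdp_data" and pol :: "real^'n \<Rightarrow> 's \<Rightarrow> 'a \<Rightarrow> real"
  assumes pol_measurable: "\<And>\<theta>. (\<lambda>(s, a). pol \<theta> s a) \<in> borel_measurable (sa_space M)"
    and pol_nonneg:
      "\<And>\<theta> s a. s \<in> space (state_space M) \<Longrightarrow> a \<in> space (action_space M) \<Longrightarrow> 0 \<le> pol \<theta> s a"
    and pol_prob:
      "\<And>\<theta> s. s \<in> space (state_space M) \<Longrightarrow> (\<integral>\<^sup>+ a. ennreal (pol \<theta> s a) \<partial>action_space M) = 1"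

definition policy_of ::
  "('s, 'a) mdp_data \<Rightarrow> (real^'n \<Rightarrow> 's \<Rightarrow> 'a \<Rightarrow> real) \<Rightarrow> real^'n \<Rightarrow> 's \<Rightarrow> 'a measure" where
  "policy_of M pol \<theta> s = density (action_space M) (\<lambda>a. ennreal (pol \<theta> s a))"

definition J_par :: "('s, 'a) mdp_data \<Rightarrow> (real^'n \<Rightarrow> 's \<Rightarrow> 'a \<Rightarrow> real) \<Rightarrow> real^'n \<Rightarrow> real" where
  "J_par M pol \<theta> = expected_return M (policy_of M pol \<theta>)"

definition score :: "(real^'n \<Rightarrow> 's \<Rightarrow> 'a \<Rightarrow> real) \<Rightarrow> real^'n \<Rightarrow> 's \<times> 'a \<Rightarrow> real^'n" where
  "score pol \<theta> x = grad (\<lambda>\<theta>'. ln (pol \<theta>' (fst x) (snd x))) \<theta>"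

definition score_hessian ::
  "(real^'n \<Rightarrow> 's \<Rightarrow> 'a \<Rightarrow> real) \<Rightarrow> real^'n \<Rightarrow> 's \<times> 'a \<Rightarrow> real^'n^'n" where
  "score_hessian pol \<theta> x = hessian (\<lambda>\<theta>'. ln (pol \<theta>' (fst x) (snd x))) \<theta>"

definition fisher ::
  "('s, 'a) mdp_data \<Rightarrow> (real^'n \<Rightarrow> 's \<Rightarrow> 'a \<Rightarrow> real) \<Rightarrow> real^'n \<Rightarrow> real^'n^'n" where
  "fisher M pol \<theta> = (let \<pi> = policy_of M pol \<theta> in
     \<integral>x. outer (score pol \<theta> x) (score pol \<theta> x) \<partial>with_action M \<pi> (visitation M \<pi>))"

definition w_star ::
  "('s, 'a) mdp_data \<Rightarrow> (real^'n \<Rightarrow> 's \<Rightarrow> 'a \<Rightarrow> real) \<Rightarrow> real^'n \<Rightarrow> real^'n" where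
  "w_star M pol \<theta> = pseudo_inverse (fisher M pol \<theta>) *v grad (J_par M pol) \<theta>"

definition transfer_error ::
  "('s, 'a) mdp_data \<Rightarrow> (real^'n \<Rightarrow> 's \<Rightarrow> 'a \<Rightarrow> real) \<Rightarrow> ('s \<Rightarrow> 'a measure) \<Rightarrow> real^'n \<Rightarrow> real" where
  "transfer_error M pol \<pi>' \<theta> =
     (\<integral>x. (advantage M (policy_of M pol \<theta>) x
            - (1 - discount M) * (w_star M pol \<theta> \<bullet> score pol \<theta> x))\<^sup>2
        \<partial>with_action M \<pi>' (visitation M \<pi>'))"

text \<open>A trajectory of length \<open>H\<close> is a function on \<open>{..<H}\<close>; its density below assumes
  \<open>1 \<le> H\<close>.\<close>

definition traj_density ::
  "('s, 'a) mdp_data \<Rightarrow> (real^'n \<Rightarrow> 's \<Rightarrow> 'a \<Rightarrow> real) \<Rightarrow> nat \<Rightarrow> (nat \<Rightarrow> 's \<times> 'a) \<Rightarrow> real^'n \<Rightarrow> real"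
  where
  "traj_density M pol H \<tau> \<theta> = init M (fst (\<tau> 0)) * pol \<theta> (fst (\<tau> 0)) (snd (\<tau> 0)) *
     (\<Prod>t = 1..<H. transition M (\<tau> (t - 1)) (fst (\<tau> t)) * pol \<theta> (fst (\<tau> t)) (snd (\<tau> t)))"

definition traj_dist ::
  "('s, 'a) mdp_data \<Rightarrow> (real^'n \<Rightarrow> 's \<Rightarrow> 'a \<Rightarrow> real) \<Rightarrow> nat \<Rightarrow> real^'n \<Rightarrow> (nat \<Rightarrow> 's \<times> 'a) measure"
  where
  "traj_dist M pol H \<theta> =
     density (PiM {..<H} (\<lambda>_. sa_space M)) (\<lambda>\<tau>. ennreal (traj_density M pol H \<tau> \<theta>))"

definition Phi ::
  "('s, 'a) mdp_data \<Rightarrow> (real^'n \<Rightarrow> 's \<Rightarrow> 'a \<Rightarrow> real) \<Rightarrow> nat \<Rightarrow> (nat \<Rightarrow> 's \<times> 'a) \<Rightarrow> real^'n \<Rightarrow> real"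
  where
  "Phi M pol H \<tau> \<theta> = (\<Sum>t<H. (\<Sum>h = t..<H. discount M ^ h * reward M (\<tau> h)) *
     ln (pol \<theta> (fst (\<tau> t)) (snd (\<tau> t))))"

definition g_est ::
  "('s, 'a) mdp_data \<Rightarrow> (real^'n \<Rightarrow> 's \<Rightarrow> 'a \<Rightarrow> real) \<Rightarrow> nat \<Rightarrow> (nat \<Rightarrow> 's \<times> 'a) \<Rightarrow> real^'n \<Rightarrow> real^'n"
  where
  "g_est M pol H \<tau> \<theta> = grad (Phi M pol H \<tau>) \<theta>"

definition B_est ::
  "('s, 'a) mdp_data \<Rightarrow> (real^'n \<Rightarrow> 's \<Rightarrow> 'a \<Rightarrow> real) \<Rightarrow> nat \<Rightarrow> (nat \<Rightarrow> 's \<times> 'a) \<Rightarrow> real^'n \<Rightarrow> real^'n^'n"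
  where
  "B_est M pol H \<tau> \<theta> =
     outer (grad (Phi M pol H \<tau>) \<theta>) (grad (\<lambda>\<theta>'. ln (traj_density M pol H \<tau> \<theta>')) \<theta>)
     + hessian (Phi M pol H \<tau>) \<theta>"

text \<open>The state of the algorithm at the beginning of iteration \<open>t\<close> is the triple
  \<open>(\<theta>\<^bsub>t-1\<^esub>, \<theta>\<^sub>t, d\<^bsub>t-1\<^esub>)\<close>, and the algorithm is given by the law of this triple.
  Note that \<open>sgn d = d /\<^sub>R norm d\<close> with \<open>sgn 0 = 0\<close>.\<close>

definition nharpg_update ::
  "('s, 'a) mdp_data \<Rightarrow> (real^'n \<Rightarrow> 's \<Rightarrow> 'a \<Rightarrow> real) \<Rightarrow> nat \<Rightarrow> real \<Rightarrow> real \<Rightarrow>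
   (nat \<Rightarrow> 's \<times> 'a) \<Rightarrow> (nat \<Rightarrow> 's \<times> 'a) \<Rightarrow> real^'n \<Rightarrow>
   (real^'n) \<times> (real^'n) \<times> (real^'n) \<Rightarrow> (real^'n) \<times> (real^'n) \<times> (real^'n)" where
  "nharpg_update M pol H \<eta> \<alpha> \<tau> \<tau>' \<theta>' = (\<lambda>(\<theta>\<^sub>p, \<theta>, d\<^sub>p).
     let v = B_est M pol H \<tau>' \<theta>' *v (\<theta> - \<theta>\<^sub>p);
         d = (1 - \<eta>) *\<^sub>R (d\<^sub>p + v) + \<eta> *\<^sub>R g_est M pol H \<tau> \<theta>
     in (\<theta>, \<theta> + \<alpha> *\<^sub>R sgn d, d))"

definition nharpg_step ::
  "('s, 'a) mdp_data \<Rightarrow> (real^'n \<Rightarrow> 's \<Rightarrow> 'a \<Rightarrow> real) \<Rightarrow> nat \<Rightarrow> real \<Rightarrow> real \<Rightarrow>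
   (real^'n) \<times> (real^'n) \<times> (real^'n) \<Rightarrow> ((real^'n) \<times> (real^'n) \<times> (real^'n)) measure" where
  "nharpg_step M pol H \<eta> \<alpha> = (\<lambda>(\<theta>\<^sub>p, \<theta>, d\<^sub>p).
     uniform_measure lborel {0..1} \<bind> (\<lambda>q.
       let \<theta>' = q *\<^sub>R \<theta> + (1 - q) *\<^sub>R \<theta>\<^sub>p in
       traj_dist M pol H \<theta> \<bind> (\<lambda>\<tau>.
       traj_dist M pol H \<theta>' \<bind> (\<lambda>\<tau>'.
       return borel (nharpg_update M pol H \<eta> \<alpha> \<tau> \<tau>' \<theta>' (\<theta>\<^sub>p, \<theta>, d\<^sub>p))))))"

text \<open>\<open>nharpg_law \<dots> k\<close> is the law of the state after the iterations \<open>t = 1, \<dots>, k\<close>.\<close>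

primrec nharpg_law ::
  "('s, 'a) mdp_data \<Rightarrow> (real^'n \<Rightarrow> 's \<Rightarrow> 'a \<Rightarrow> real) \<Rightarrow> nat \<Rightarrow> (nat \<Rightarrow> real) \<Rightarrow> (nat \<Rightarrow> real) \<Rightarrow>
   real^'n \<Rightarrow> real^'n \<Rightarrow> real^'n \<Rightarrow> nat \<Rightarrow> ((real^'n) \<times> (real^'n) \<times> (real^'n)) measure" where
  "nharpg_law M pol H \<eta> \<alpha> \<theta>\<^sub>0 \<theta>\<^sub>1 d\<^sub>0 0 = return borel (\<theta>\<^sub>0, \<theta>\<^sub>1, d\<^sub>0)"
| "nharpg_law M pol H \<eta> \<alpha> \<theta>\<^sub>0 \<theta>\<^sub>1 d\<^sub>0 (Suc k) =
     nharpg_law M pol H \<eta> \<alpha> \<theta>\<^sub>0 \<theta>\<^sub>1 d\<^sub>0 k \<bind> nharpg_step M pol H (\<eta> (Suc k)) (\<alpha> (Suc k))"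

definition nharpg_output ::
  "('s, 'a) mdp_data \<Rightarrow> (real^'n \<Rightarrow> 's \<Rightarrow> 'a \<Rightarrow> real) \<Rightarrow> nat \<Rightarrow> (nat \<Rightarrow> real) \<Rightarrow> (nat \<Rightarrow> real) \<Rightarrow>
   real^'n \<Rightarrow> real^'n \<Rightarrow> real^'n \<Rightarrow> nat \<Rightarrow> (real^'n) measure" where
  "nharpg_output M pol H \<eta> \<alpha> \<theta>\<^sub>0 \<theta>\<^sub>1 d\<^sub>0 T =
     distr (nharpg_law M pol H \<eta> \<alpha> \<theta>\<^sub>0 \<theta>\<^sub>1 d\<^sub>0 (T - 1)) borel (\<lambda>(\<theta>\<^sub>p, \<theta>, d\<^sub>p). \<theta>)"

text \<open>Rounding up keeps the horizon positive for \<open>1 \<le> T\<close>.\<close>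

definition horizon :: "real \<Rightarrow> nat \<Rightarrow> nat" where
  "horizon \<gamma> T = nat \<lceil>ln (real T + 1) / (1 - \<gamma>)\<rceil>"

definition L_g :: "real \<Rightarrow> real \<Rightarrow> real \<Rightarrow> real \<Rightarrow> real" where
  "L_g \<gamma> r_max M\<^sub>g M\<^sub>h = r_max * (M\<^sub>g\<^sup>2 + M\<^sub>h) / (1 - \<gamma>)\<^sup>2"

definition sigma_g :: "real \<Rightarrow> real \<Rightarrow> real \<Rightarrow> real" where
  "sigma_g \<gamma> r_max M\<^sub>g = sqrt (r_max\<^sup>2 * M\<^sub>g\<^sup>2 / (1 - \<gamma>) ^ 3)"

definition sigma_h :: "real \<Rightarrow> real \<Rightarrow> real \<Rightarrow> real \<Rightarrow> nat \<Rightarrow> real" where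
  "sigma_h \<gamma> r_max M\<^sub>g M\<^sub>h H =
     sqrt (r_max\<^sup>2 * ((real H)\<^sup>2 * M\<^sub>g ^ 4 + M\<^sub>h\<^sup>2) / (1 - \<gamma>) ^ 4)"

text \<open>The absolute constant behind \<open>\<O>(\<cdot>)\<close>. It is a closed numeral because an
  existentially quantified constant in a theorem with type variables could still depend on these,
  that is, on the dimension of the parameter and on the state and action spaces. The particular
  value has no significance.\<close>

definition abs_const :: real where
  "abs_const = 100"

end

theory Submission
  imports Defs
begin

text \<open>The bound holds for every parameter, so nothing about the recursion of the algorithm enters beyond
  the fact that its output has a law. By the performance difference lemma, the bounds on the Fisher
  matrix and on the transfer error give the gradient domination inequality
  \<open>J\<^sup>* - J \<theta> \<le> sqrt \<epsilon> / (1 - \<gamma>) + (M\<^sub>g / \<mu>\<^sub>F) * norm (\<nabla>J \<theta>)\<close> at every \<open>\<theta>\<close>. Since \<open>J\<close> is bounded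
  and differentiable on the whole space, below every level \<open>J \<theta>\<close> there are points with arbitrarily
  small gradient, and gradient domination at these points yields
  \<open>J\<^sup>* - J \<theta> \<le> sqrt \<epsilon> / (1 - \<gamma>)\<close>.

  The performance difference lemma also gives the differentiability of \<open>J\<close>. It expresses
  \<open>J (\<theta> + h) - J \<theta>\<close> through the change of the policy alone, which is expanded to second order by means of
  the score bounds; replacing the state distribution of \<open>\<theta> + h\<close> by that of \<open>\<theta>\<close> costs
  another \<open>O((norm h)\<^sup>2)\<close>, by the same lemma applied to the linear term as a reward.\<close>

section \<open>Markov kernels and the chain of a policy\<close>

text \<open>Expected return, \<open>Q_fun\<close>, \<open>V_fun\<close> and
  \<open>visitation\<close> live on the infinite product built by Ionescu-Tulcea, but each of them
  depends only on the laws of single state-action pairs. Once these laws are identified with the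
  iterated kernel \<open>chain_law\<close>, every value becomes a geometric series, and the rest of
  the analysis is about such series. The factor \<open>M\<^sub>g / \<mu>\<^sub>F\<close> has two
  sources: inverting the Fisher matrix costs \<open>1 / \<mu>\<^sub>F\<close> in the norm of
  \<open>w_star\<close>, and pairing the result with the score costs \<open>M\<^sub>g\<close>. A
  bound valid at every parameter passes to the expectation because the output law is a probability
  measure. This law is a nested \<open>bind\<close>, so gradients and Hessians must be measurable
  jointly in the parameter and the trajectory, although they are given only as derivatives along
  each fixed trajectory. They are recovered as pointwise limits of difference quotients.\<close>

lemma prob_algebraD:
  assumes "m \<in> space (prob_algebra N)"
  shows "sets m = sets N" "space m = space N" "prob_space m"
  using assms sets_eq_imp_space_eq by (auto simp: space_prob_algebra)

section \<open>Integration against probability kernels\<close>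

lemma kernel_space:
  "K \<in> N \<rightarrow>\<^sub>M prob_algebra L \<Longrightarrow> x \<in> space N \<Longrightarrow> K x \<in> space (prob_algebra L)"
  by (rule measurable_space)

lemma integrable_bounded_prob:
  fixes f :: "'a \<Rightarrow> 'b::{banach, second_countable_topology}"
  assumes m: "m \<in> space (prob_algebra N)" and f: "f \<in> borel_measurable N"
    and B: "\<And>x. x \<in> space N \<Longrightarrow> norm (f x) \<le> B"
  shows "integrable m f"
proof -
  note p = prob_algebraD[OF m]
  interpret prob_space m by (fact p)
  show ?thesis
    using f B by (intro integrable_const_bound[where B = B] AE_I2)
      (auto simp: p cong: measurable_cong_sets)
qed

lemma norm_integral_bounded_prob:
  fixes f :: "'a \<Rightarrow> 'b::{banach, second_countable_topology}"
  assumes m: "m \<in> space (prob_algebra N)" and f: "f \<in> borel_measurable N"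
    and B: "\<And>x. x \<in> space N \<Longrightarrow> norm (f x) \<le> B"
  shows "norm (integral\<^sup>L m f) \<le> B"
proof -
  note p = prob_algebraD[OF m]
  interpret prob_space m by (fact p)
  have i: "integrable m f" by (rule integrable_bounded_prob[OF assms])
  have "norm (integral\<^sup>L m f) \<le> (\<integral>x. norm (f x) \<partial>m)" by simp
  also have "\<dots> \<le> (\<integral>x. B \<partial>m)"
    using i B by (intro integral_mono) (auto simp: p)
  finally show ?thesis by (simp add: prob_space)
qed

lemma measurable_integral_kernel:
  fixes f :: "'b \<Rightarrow> 'c::{banach, second_countable_topology}"
  assumes "K \<in> N \<rightarrow>\<^sub>M prob_algebra L" "f \<in> borel_measurable L"
  shows "(\<lambda>x. integral\<^sup>L (K x) f) \<in> borel_measurable N"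
  using measurable_compose[OF measurable_prob_algebraD[OF assms(1)]
      integral_measurable_subprob_algebra[OF assms(2)]] .

lemma integral_bind_prob:
  fixes f :: "'b \<Rightarrow> real"
  assumes m: "m \<in> space (prob_algebra N)" and K: "K \<in> N \<rightarrow>\<^sub>M prob_algebra L"
    and f: "f \<in> borel_measurable L" and B: "\<And>x. x \<in> space L \<Longrightarrow> \<bar>f x\<bar> \<le> B"
  shows "integral\<^sup>L (m \<bind> K) f = (\<integral>x. integral\<^sup>L (K x) f \<partial>m)"
proof (rule integral_bind[where B = B and B' = 1])
  note p = prob_algebraD[OF m]
  show "K \<in> m \<rightarrow>\<^sub>M subprob_algebra L"
    using measurable_prob_algebraD[OF K] by (simp cong: measurable_cong_sets add: p)
  show "finite_measure m"
    using p by (simp add: prob_space.finite_measure)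
  show "AE x in m. emeasure (K x) (space (K x)) \<le> ennreal 1"
    using kernel_space[OF K, THEN prob_algebraD(3)]
    by (intro AE_I2) (simp add: p prob_space.emeasure_space_1)
qed (use f B in auto)

lemma bind_in_prob_algebra:
  "m \<in> space (prob_algebra N) \<Longrightarrow> K \<in> N \<rightarrow>\<^sub>M prob_algebra L \<Longrightarrow> m \<bind> K \<in> space (prob_algebra L)"
  by (simp add: space_prob_algebra[of L] prob_space_bind' sets_bind')

lemma return_prob: "x \<in> space N \<Longrightarrow> return N x \<in> space (prob_algebra N)"
  by (simp add: space_prob_algebra prob_space_return)

lemma bind_assoc_prob:
  assumes m: "m \<in> space (prob_algebra N)" and "f \<in> N \<rightarrow>\<^sub>M prob_algebra L" "g \<in> L \<rightarrow>\<^sub>M prob_algebra R"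
  shows "(m \<bind> f) \<bind> g = m \<bind> (\<lambda>x. f x \<bind> g)"
  using assms by (intro bind_assoc[where N = L and R = R])
    (auto dest: measurable_prob_algebraD simp: prob_algebraD cong: measurable_cong_sets)

text \<open>Measurability in \<open>x\<close> of the mass of a fixed set is Tonelli's theorem, hence
  the sigma-finite reference measure. Transition kernel, policies and trajectory laws are all given
  by densities and become kernels through this lemma.\<close>

lemma measurable_density_prob_algebra:
  assumes N: "sigma_finite_measure N"
    and f[measurable]: "(\<lambda>(x, y). f x y) \<in> borel_measurable (L \<Otimes>\<^sub>M N)"
    and p: "\<And>x. x \<in> space L \<Longrightarrow> (\<integral>\<^sup>+y. f x y \<partial>N) = 1"
  shows "(\<lambda>x. density N (f x)) \<in> L \<rightarrow>\<^sub>M prob_algebra N"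
proof (rule measurable_prob_algebraI)
  interpret sigma_finite_measure N by fact
  have fx[measurable]: "f x \<in> borel_measurable N" if "x \<in> space L" for x
    using measurable_compose[OF measurable_Pair1'[OF that, of N] f] by simp
  show P: "prob_space (density N (f x))" if "x \<in> space L" for x
    using that p[OF that] by (intro prob_spaceI) (simp add: emeasure_density cong: nn_integral_cong)
  show "(\<lambda>x. density N (f x)) \<in> L \<rightarrow>\<^sub>M subprob_algebra N"
  proof (rule measurable_subprob_algebra)
    fix A assume [measurable]: "A \<in> sets N"
    have "(\<lambda>x. \<integral>\<^sup>+y. f x y * indicator A y \<partial>N) \<in> borel_measurable L"
      by measurable
    then show "(\<lambda>x. emeasure (density N (f x)) A) \<in> borel_measurable L"
      by (subst measurable_cong) (auto simp: emeasure_density)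
  qed (auto intro: prob_space_imp_subprob_space P)
qed

text \<open>The law of the pair at time \<open>t\<close> when the first pair has law \<mu>. It
  stands in for the infinite product, of which it is the one-time marginal by
  \<open>trajectory_marginal\<close>.\<close>

primrec chain_law ::
  "('s, 'a) mdp_data \<Rightarrow> ('s \<Rightarrow> 'a measure) \<Rightarrow> ('s \<times> 'a) measure \<Rightarrow> nat \<Rightarrow> ('s \<times> 'a) measure" where
  "chain_law M \<pi> \<mu> 0 = \<mu>"
| "chain_law M \<pi> \<mu> (Suc t) =
     chain_law M \<pi> \<mu> t \<bind> (\<lambda>x. with_action M \<pi> (transition_kernel M x))"

section \<open>The kernels of the decision process and the marginals of its trajectories\<close>

context mdp
begin

abbreviation "S \<equiv> state_space M"
abbreviation "SA \<equiv> sa_space M"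

lemma init_dist_prob: "init_dist M \<in> space (prob_algebra S)"
  using init_prob init_measurable
  by (auto simp: space_prob_algebra init_dist_def emeasure_density intro!: prob_spaceI cong: nn_integral_cong)

lemma transition_kernel_measurable: "transition_kernel M \<in> SA \<rightarrow>\<^sub>M prob_algebra S"
  unfolding transition_kernel_def[abs_def]
  using transition_measurable transition_prob sigma_finite_states
  by (intro measurable_density_prob_algebra) (auto simp: split_beta')

lemma action_kernel_measurable:
  assumes "\<pi> \<in> policies M"
  shows "(\<lambda>s. \<pi> s \<bind> (\<lambda>a. return SA (s, a))) \<in> S \<rightarrow>\<^sub>M prob_algebra SA"
  using assms unfolding policies_def
  by (intro measurable_bind_prob_space2[where N = "action_space M"]) auto

lemma with_action_prob:
  assumes "\<pi> \<in> policies M" "\<nu> \<in> space (prob_algebra S)"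
  shows "with_action M \<pi> \<nu> \<in> space (prob_algebra SA)"
  unfolding with_action_def
  by (rule bind_in_prob_algebra[OF assms(2) action_kernel_measurable[OF assms(1)]])

lemma with_action_measurable:
  assumes "\<pi> \<in> policies M" "K \<in> N \<rightarrow>\<^sub>M prob_algebra S"
  shows "(\<lambda>x. with_action M \<pi> (K x)) \<in> N \<rightarrow>\<^sub>M prob_algebra SA"
  unfolding with_action_def
  by (rule measurable_bind_prob_space[OF assms(2) action_kernel_measurable[OF assms(1)]])

lemma policy_prob: "\<pi> \<in> policies M \<Longrightarrow> s \<in> space S \<Longrightarrow> \<pi> s \<in> space (prob_algebra (action_space M))"
  unfolding policies_def by (rule measurable_space)

lemma step_measurable:
  assumes "\<pi> \<in> policies M"
  shows "(\<lambda>x. with_action M \<pi> (transition_kernel M x)) \<in> SA \<rightarrow>\<^sub>M prob_algebra SA"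
  by (rule with_action_measurable[OF assms transition_kernel_measurable])

lemma integral_action_kernel:
  fixes f :: "'s \<times> 'a \<Rightarrow> real"
  assumes \<pi>: "\<pi> \<in> policies M" and s: "s \<in> space S" and f: "f \<in> borel_measurable SA"
    and B: "\<And>x. x \<in> space SA \<Longrightarrow> \<bar>f x\<bar> \<le> B"
  shows "integral\<^sup>L (\<pi> s \<bind> (\<lambda>a. return SA (s, a))) f = (\<integral>a. f (s, a) \<partial>\<pi> s)"
proof -
  have "(\<lambda>a. return SA (s, a)) \<in> action_space M \<rightarrow>\<^sub>M prob_algebra SA"
    using s by measurable
  from integral_bind_prob[OF policy_prob[OF \<pi> s] this f B]
  show ?thesis
    using s f B by (auto intro!: Bochner_Integration.integral_cong simp: prob_algebraD[OF policy_prob[OF \<pi> s]]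
        integral_return space_pair_measure)
qed

lemma integral_with_action:
  fixes f :: "'s \<times> 'a \<Rightarrow> real"
  assumes \<pi>: "\<pi> \<in> policies M" and \<nu>: "\<nu> \<in> space (prob_algebra S)" and f: "f \<in> borel_measurable SA"
    and B: "\<And>x. x \<in> space SA \<Longrightarrow> \<bar>f x\<bar> \<le> B"
  shows "integral\<^sup>L (with_action M \<pi> \<nu>) f = (\<integral>s. (\<integral>a. f (s, a) \<partial>\<pi> s) \<partial>\<nu>)"
  unfolding with_action_def
  by (subst integral_bind_prob[OF \<nu> action_kernel_measurable[OF \<pi>] f B])
    (auto intro!: Bochner_Integration.integral_cong integral_action_kernel[OF \<pi> _ f B]
      simp: prob_algebraD[OF \<nu>])

lemma policy_integral_measurable:
  fixes f :: "'s \<times> 'a \<Rightarrow> real"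
  assumes \<pi>: "\<pi> \<in> policies M" and f: "f \<in> borel_measurable SA"
    and B: "\<And>x. x \<in> space SA \<Longrightarrow> \<bar>f x\<bar> \<le> B"
  shows "(\<lambda>s. \<integral>a. f (s, a) \<partial>\<pi> s) \<in> borel_measurable S"
proof -
  have "(\<lambda>s. integral\<^sup>L (\<pi> s \<bind> (\<lambda>a. return SA (s, a))) f) \<in> borel_measurable S"
    by (rule measurable_integral_kernel[OF action_kernel_measurable[OF \<pi>] f])
  then show ?thesis
    by (rule measurable_cong[THEN iffD1, rotated]) (simp add: integral_action_kernel[OF \<pi> _ f B])
qed

lemma policy_integral_bounded:
  fixes f :: "'s \<times> 'a \<Rightarrow> real"
  assumes \<pi>: "\<pi> \<in> policies M" and f: "f \<in> borel_measurable SA"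
    and B: "\<And>x. x \<in> space SA \<Longrightarrow> \<bar>f x\<bar> \<le> B" and s: "s \<in> space S"
  shows "\<bar>\<integral>a. f (s, a) \<partial>\<pi> s\<bar> \<le> B"
  using norm_integral_bounded_prob[OF policy_prob[OF \<pi> s], of "\<lambda>a. f (s, a)" B] B f s
  by (simp add: space_pair_measure measurable_compose[OF measurable_Pair1' f])

lemma chain_law_prob:
  assumes "\<pi> \<in> policies M" "\<mu> \<in> space (prob_algebra SA)"
  shows "chain_law M \<pi> \<mu> t \<in> space (prob_algebra SA)"
  using assms by (induction t) (auto intro: bind_in_prob_algebra[OF _ step_measurable])

text \<open>\<open>IT.C 0 n\<close> is the joint law of the first \<open>n\<close> pairs. At a
  positive time \<open>chain_kernel\<close> reads only the preceding pair, so the law of the last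
  pair depends on the history through one coordinate and obeys the recursion of
  \<open>chain_law\<close>.\<close>

lemma trajectory_marginal:
  assumes \<pi>: "\<pi> \<in> policies M" and \<mu>: "\<mu> \<in> space (prob_algebra SA)"
  shows "sets (trajectory M \<pi> \<mu>) = sets (PiM UNIV (\<lambda>_. SA))"
    and "prob_space (trajectory M \<pi> \<mu>)"
    and "distr (trajectory M \<pi> \<mu>) SA (\<lambda>\<omega>. \<omega> t) = chain_law M \<pi> \<mu> t"
proof -
  have P: "chain_kernel M \<pi> \<mu> i \<in> PiM {0..<i} (\<lambda>_. SA) \<rightarrow>\<^sub>M prob_algebra SA" for i
  proof (cases i)
    case 0
    then show ?thesis using \<mu> by (simp add: chain_kernel_def[abs_def])
  next
    case (Suc k)
    have "(\<lambda>\<omega>. with_action M \<pi> (transition_kernel M (\<omega> k))) \<in> PiM {0..<i} (\<lambda>_. SA) \<rightarrow>\<^sub>M prob_algebra SA"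
      by (rule measurable_compose[OF _ step_measurable[OF \<pi>]])
        (auto simp: Suc intro!: measurable_component_singleton)
    then show ?thesis by (simp add: chain_kernel_def[abs_def] Suc)
  qed
  interpret IT: Ionescu_Tulcea "chain_kernel M \<pi> \<mu>" "\<lambda>_. SA"
    by (rule Ionescu_Tulcea.intro[OF measurable_prob_algebraD[OF P] prob_algebraD(3)[OF kernel_space[OF P]]])
  have traj: "trajectory M \<pi> \<mu> = IT.PF.lim"
    by (simp add: trajectory_def)
  show s: "sets (trajectory M \<pi> \<mu>) = sets (PiM UNIV (\<lambda>_. SA))"
    by (simp add: traj)
  \<comment> \<open>The empty history: the only point of a product over no indices.\<close>
  let ?u = "\<lambda>_. undefined"
  have u: "?u \<in> space (PiM {0..<0::nat} (\<lambda>_. SA))"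
    by simp
  \<comment> \<open>\<open>IT.CI J\<close> restricts the joint law up to the first bound of
    \<open>J\<close>; for an initial segment that bound is \<open>n\<close> itself, so the
    restriction discards no coordinate.\<close>
  have upto: "IT.up_to {0..<n} = n" for n
    using IT.up_to[of "{0..<n}"] by (intro antisym) (auto simp: IT.up_to_iff_Ico)
  have C_prob: "prob_space (IT.C 0 n ?u)" and C_sets: "sets (IT.C 0 n ?u) = sets (PiM {0..<n} (\<lambda>_. SA))"
    and C_space: "space (IT.C 0 n ?u) = space (PiM {0..<n} (\<lambda>_. SA))" for n
    using IT.prob_space_C[OF u, of n] IT.sets_C[OF u, of n] IT.space_C[OF u, of n] by simp_all
  have lim: "distr IT.PF.lim (PiM {0..<n} (\<lambda>_. SA)) (\<lambda>\<omega>. restrict \<omega> {0..<n}) = IT.C 0 n ?u" for n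
  proof -
    have "distr IT.PF.lim (PiM {0..<n} (\<lambda>_. SA)) (\<lambda>\<omega>. restrict \<omega> {0..<n}) = IT.CI {0..<n}"
      by (rule IT.distr_lim) simp
    also have "\<dots> = distr (IT.C 0 n ?u) (PiM {0..<n} (\<lambda>_. SA)) (\<lambda>\<omega>. \<omega>)"
      unfolding IT.CI_def upto
      by (rule distr_cong) (auto simp: C_space space_PiM PiE_restrict)
    also have "\<dots> = IT.C 0 n ?u"
      by (rule distr_id2) (simp add: C_sets)
    finally show ?thesis .
  qed
  have meas: "(\<lambda>\<omega>. restrict \<omega> {0..<n}) \<in> IT.PF.lim \<rightarrow>\<^sub>M PiM {0..<n} (\<lambda>_. SA)" for n
    by (auto intro!: measurable_restrict simp: measurable_cong_sets[OF IT.PF.sets_lim refl])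
  \<comment> \<open>A measure with an image of total mass one has total mass one itself; the image
    on the empty index set suffices.\<close>
  have "prob_space (distr IT.PF.lim (PiM {0..<0} (\<lambda>_. SA)) (\<lambda>\<omega>. restrict \<omega> {0..<0::nat}))"
    unfolding lim by (rule C_prob)
  from prob_space_distrD[OF meas this] show pr: "prob_space (trajectory M \<pi> \<mu>)"
    by (simp add: traj)
  have C_last: "distr (IT.C 0 (Suc n) ?u) SA (\<lambda>\<omega>. \<omega> n) = IT.C 0 n ?u \<bind> chain_kernel M \<pi> \<mu> n" for n
  proof -
    have comp: "(\<lambda>\<omega>. \<omega> n) \<in> PiM {0..<Suc n} (\<lambda>_. SA) \<rightarrow>\<^sub>M SA"
      by (rule measurable_component_singleton) simp
    have "distr (IT.C 0 (Suc n) ?u) SA (\<lambda>\<omega>. \<omega> n) = IT.C 0 n ?u \<bind> (\<lambda>\<omega>. distr (IT.eP n \<omega>) SA (\<lambda>\<omega>. \<omega> n))"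
      using comp IT.measurable_eP[of n]
      by (simp, subst distr_bind[where K = "PiM {0..<Suc n} (\<lambda>_. SA)"])
        (auto simp: measurable_cong_sets[OF C_sets refl] prob_space.not_empty[OF C_prob])
    also have "\<dots> = IT.C 0 n ?u \<bind> chain_kernel M \<pi> \<mu> n"
    proof (rule bind_cong[OF refl])
      fix \<omega> assume "\<omega> \<in> space (IT.C 0 n ?u)"
      then have w: "\<omega> \<in> space (PiM {0..<n} (\<lambda>_. SA))" by (simp add: C_space)
      have fu: "fun_upd \<omega> n \<in> chain_kernel M \<pi> \<mu> n \<omega> \<rightarrow>\<^sub>M PiM {0..<Suc n} (\<lambda>_. SA)"
        using w by (intro measurable_fun_upd[where J = "{0..<n}"])
          (auto simp: IT.sets_P measurable_cong_sets[OF IT.sets_P[OF w] refl])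
      show "distr (IT.eP n \<omega>) SA (\<lambda>\<omega>. \<omega> n) = chain_kernel M \<pi> \<mu> n \<omega>"
        unfolding IT.eP_def
        by (subst distr_distr[OF comp fu]) (simp add: comp_def distr_id2 IT.sets_P[OF w])
    qed
    finally show ?thesis .
  qed
  have C_chain: "distr (IT.C 0 (Suc n) ?u) SA (\<lambda>\<omega>. \<omega> n) = chain_law M \<pi> \<mu> n" for n
  proof (induction n)
    case 0
    have "return (PiM {0..<0} (\<lambda>_. SA)) ?u \<bind> chain_kernel M \<pi> \<mu> 0 = chain_kernel M \<pi> \<mu> 0 ?u"
      by (rule bind_return[OF IT.P u])
    then show ?case
      unfolding C_last by (simp add: chain_kernel_def)
  next
    case (Suc n)
    have "IT.C 0 (Suc n) ?u \<bind> chain_kernel M \<pi> \<mu> (Suc n)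
      = IT.C 0 (Suc n) ?u \<bind> (\<lambda>\<omega>. with_action M \<pi> (transition_kernel M (\<omega> n)))"
      by (simp add: chain_kernel_def[abs_def])
    also have "\<dots> = distr (IT.C 0 (Suc n) ?u) SA (\<lambda>\<omega>. \<omega> n) \<bind> (\<lambda>x. with_action M \<pi> (transition_kernel M x))"
      by (rule bind_distr[symmetric, OF _ measurable_prob_algebraD[OF step_measurable[OF \<pi>]]])
        (auto simp: measurable_cong_sets[OF C_sets refl] prob_space.not_empty[OF C_prob]
          simp del: IT.C.simps)
    finally show ?case
      by (simp only: C_last[of "Suc n"] Suc.IH chain_law.simps)
  qed
  have "distr (trajectory M \<pi> \<mu>) SA (\<lambda>\<omega>. \<omega> t)
    = distr (distr IT.PF.lim (PiM {0..<Suc t} (\<lambda>_. SA)) (\<lambda>\<omega>. restrict \<omega> {0..<Suc t})) SA (\<lambda>\<omega>. \<omega> t)"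
    by (subst distr_distr[OF _ meas]) (auto simp: traj comp_def)
  then show "distr (trajectory M \<pi> \<mu>) SA (\<lambda>\<omega>. \<omega> t) = chain_law M \<pi> \<mu> t"
    unfolding lim C_chain .
qed

end

section \<open>Discounted values and the performance difference lemma\<close>

text \<open>The reward \<open>f\<close> is a parameter because, besides \<open>reward M\<close>,
  advantages and the linear terms of an expansion in \<theta> are inserted for it.\<close>

definition disc_value ::
  "('s, 'a) mdp_data \<Rightarrow> ('s \<Rightarrow> 'a measure) \<Rightarrow> ('s \<times> 'a) measure \<Rightarrow> ('s \<times> 'a \<Rightarrow> real) \<Rightarrow> real" where
  "disc_value M \<pi> \<mu> f = (\<Sum>t. discount M ^ t * integral\<^sup>L (chain_law M \<pi> \<mu> t) f)"

definition disc_Q ::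
  "('s, 'a) mdp_data \<Rightarrow> ('s \<Rightarrow> 'a measure) \<Rightarrow> ('s \<times> 'a \<Rightarrow> real) \<Rightarrow> 's \<times> 'a \<Rightarrow> real" where
  "disc_Q M \<pi> f x = disc_value M \<pi> (return (sa_space M) x) f"

definition disc_V ::
  "('s, 'a) mdp_data \<Rightarrow> ('s \<Rightarrow> 'a measure) \<Rightarrow> ('s \<times> 'a \<Rightarrow> real) \<Rightarrow> 's \<Rightarrow> real" where
  "disc_V M \<pi> f s = (\<integral>a. disc_Q M \<pi> f (s, a) \<partial>\<pi> s)"

section \<open>Bounds and linearity of discounted values\<close>

context mdp
begin

lemma discounted_sums:
  assumes "\<And>t. \<bar>c t\<bar> \<le> (B :: real)"
  shows "summable (\<lambda>t. discount M ^ t * c t)" and "\<bar>\<Sum>t. discount M ^ t * c t\<bar> \<le> B / (1 - discount M)"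
proof -
  have s: "summable (\<lambda>t. discount M ^ t * B)"
    using discount by (intro summable_mult2 summable_geometric) auto
  have le: "norm (discount M ^ t * c t) \<le> discount M ^ t * B" for t
    using assms[of t] discount by (auto simp: abs_mult intro!: mult_left_mono)
  show "summable (\<lambda>t. discount M ^ t * c t)"
    by (rule summable_comparison_test'[OF s le])
  have "\<bar>\<Sum>t. discount M ^ t * c t\<bar> \<le> (\<Sum>t. discount M ^ t * B)"
    using norm_suminf_le[OF le s] by simp
  also have "\<dots> = B / (1 - discount M)"
    using discount by (subst suminf_mult2[symmetric]) (auto simp: suminf_geometric summable_geometric)
  finally show "\<bar>\<Sum>t. discount M ^ t * c t\<bar> \<le> B / (1 - discount M)" .
qed

lemma chain_integral_bound:
  fixes f :: "'s \<times> 'a \<Rightarrow> real"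
  assumes "\<pi> \<in> policies M" "\<mu> \<in> space (prob_algebra SA)" "f \<in> borel_measurable SA"
    and B: "\<And>x. x \<in> space SA \<Longrightarrow> \<bar>f x\<bar> \<le> B"
  shows "\<bar>integral\<^sup>L (chain_law M \<pi> \<mu> t) f\<bar> \<le> B"
  using norm_integral_bounded_prob[OF chain_law_prob[OF assms(1,2)] assms(3), of B] B by simp

lemma disc_value_bound:
  fixes f :: "'s \<times> 'a \<Rightarrow> real"
  assumes "\<pi> \<in> policies M" "\<mu> \<in> space (prob_algebra SA)" "f \<in> borel_measurable SA"
    and "\<And>x. x \<in> space SA \<Longrightarrow> \<bar>f x\<bar> \<le> B"
  shows "summable (\<lambda>t. discount M ^ t * integral\<^sup>L (chain_law M \<pi> \<mu> t) f)"
    and "\<bar>disc_value M \<pi> \<mu> f\<bar> \<le> B / (1 - discount M)"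
proof -
  note b = chain_integral_bound[OF assms]
  show "summable (\<lambda>t. discount M ^ t * integral\<^sup>L (chain_law M \<pi> \<mu> t) f)"
    by (rule discounted_sums(1)[OF b])
  show "\<bar>disc_value M \<pi> \<mu> f\<bar> \<le> B / (1 - discount M)"
    unfolding disc_value_def by (rule discounted_sums(2)[OF b])
qed

lemma disc_value_add:
  fixes f g :: "'s \<times> 'a \<Rightarrow> real"
  assumes \<pi>: "\<pi> \<in> policies M" "\<mu> \<in> space (prob_algebra SA)"
    and f: "f \<in> borel_measurable SA" "\<And>x. x \<in> space SA \<Longrightarrow> \<bar>f x\<bar> \<le> B"
    and g: "g \<in> borel_measurable SA" "\<And>x. x \<in> space SA \<Longrightarrow> \<bar>g x\<bar> \<le> C"
  shows "disc_value M \<pi> \<mu> (\<lambda>x. f x + g x) = disc_value M \<pi> \<mu> f + disc_value M \<pi> \<mu> g"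
proof -
  have "integral\<^sup>L (chain_law M \<pi> \<mu> t) (\<lambda>x. f x + g x)
    = integral\<^sup>L (chain_law M \<pi> \<mu> t) f + integral\<^sup>L (chain_law M \<pi> \<mu> t) g" for t
    using f g by (intro Bochner_Integration.integral_add integrable_bounded_prob[OF chain_law_prob[OF \<pi>]]) auto
  then show ?thesis
    unfolding disc_value_def using disc_value_bound(1)[OF \<pi> f] disc_value_bound(1)[OF \<pi> g]
    by (simp add: distrib_left suminf_add)
qed

lemma disc_value_cmult:
  fixes f :: "'s \<times> 'a \<Rightarrow> real"
  assumes \<pi>: "\<pi> \<in> policies M" "\<mu> \<in> space (prob_algebra SA)"
    and f: "f \<in> borel_measurable SA" "\<And>x. x \<in> space SA \<Longrightarrow> \<bar>f x\<bar> \<le> B"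
  shows "disc_value M \<pi> \<mu> (\<lambda>x. c * f x) = c * disc_value M \<pi> \<mu> f"
  unfolding disc_value_def using disc_value_bound(1)[OF \<pi> f]
  by (simp add: suminf_mult[symmetric] mult.left_commute)

lemma disc_value_cong:
  assumes "\<pi> \<in> policies M" "\<mu> \<in> space (prob_algebra SA)" "\<And>x. x \<in> space SA \<Longrightarrow> f x = g x"
  shows "disc_value M \<pi> \<mu> f = disc_value M \<pi> \<mu> g"
proof -
  have "integral\<^sup>L (chain_law M \<pi> \<mu> t) f = integral\<^sup>L (chain_law M \<pi> \<mu> t) g" for t
    using assms(3) by (intro Bochner_Integration.integral_cong) (auto simp: prob_algebraD[OF chain_law_prob[OF assms(1,2)]])
  then show ?thesis by (simp add: disc_value_def)
qed

section \<open>Dependence on the starting law and the Bellman equation\<close>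

lemma chain_law_kernel:
  assumes "\<pi> \<in> policies M"
  shows "(\<lambda>x. chain_law M \<pi> (return SA x) t) \<in> SA \<rightarrow>\<^sub>M prob_algebra SA"
  by (induction t) (auto intro: measurable_bind_prob_space[OF _ step_measurable[OF assms]])

text \<open>Disintegration over the starting pair, by associativity of \<open>bind\<close>. It
  reduces every starting law to the point masses that define \<open>disc_Q\<close>.\<close>

lemma chain_law_bind:
  assumes \<pi>: "\<pi> \<in> policies M" and \<mu>: "\<mu> \<in> space (prob_algebra SA)"
  shows "chain_law M \<pi> \<mu> t = \<mu> \<bind> (\<lambda>x. chain_law M \<pi> (return SA x) t)"
proof (induction t)
  case 0
  then show ?case using prob_algebraD(1)[OF \<mu>] by (simp add: bind_return'')
next
  case (Suc t)
  then show ?case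
    using bind_assoc_prob[OF \<mu> chain_law_kernel[OF \<pi>] step_measurable[OF \<pi>]] by simp
qed

text \<open>The recursion of \<open>chain_law\<close> peels off the last step; the Bellman equation
  needs the first one peeled off instead.\<close>

lemma chain_law_Suc_shift:
  "chain_law M \<pi> \<mu> (Suc t) = chain_law M \<pi> (\<mu> \<bind> (\<lambda>x. with_action M \<pi> (transition_kernel M x))) t"
  by (induction t) simp_all

lemma disc_Q_measurable:
  assumes \<pi>: "\<pi> \<in> policies M" and f: "f \<in> borel_measurable SA"
  shows "disc_Q M \<pi> f \<in> borel_measurable SA"
  unfolding disc_Q_def[abs_def] disc_value_def
  using measurable_integral_kernel[OF chain_law_kernel[OF \<pi>] f]
  by (intro borel_measurable_suminf borel_measurable_times) auto

lemma disc_Q_bound: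
  assumes "\<pi> \<in> policies M" "f \<in> borel_measurable SA" "\<And>x. x \<in> space SA \<Longrightarrow> \<bar>f x\<bar> \<le> B" "x \<in> space SA"
  shows "\<bar>disc_Q M \<pi> f x\<bar> \<le> B / (1 - discount M)"
  unfolding disc_Q_def by (rule disc_value_bound(2)[OF assms(1) return_prob[OF assms(4)] assms(2,3)])

text \<open>Sum over time and integral over the starting pair are exchanged; the geometric series
  with terms \<open>discount M ^ t * B\<close> dominates both.\<close>

lemma disc_value_eq_integral_Q:
  assumes \<pi>: "\<pi> \<in> policies M" and \<mu>: "\<mu> \<in> space (prob_algebra SA)"
    and f: "f \<in> borel_measurable SA" "\<And>x. x \<in> space SA \<Longrightarrow> \<bar>f x\<bar> \<le> B"
  shows "disc_value M \<pi> \<mu> f = integral\<^sup>L \<mu> (disc_Q M \<pi> f)"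
proof -
  define h where "h t x = discount M ^ t * integral\<^sup>L (chain_law M \<pi> (return SA x) t) f" for t x
  have h[measurable]: "h t \<in> borel_measurable SA" for t
    unfolding h_def[abs_def] using measurable_integral_kernel[OF chain_law_kernel[OF \<pi>] f(1)] by measurable
  have hB: "\<bar>h t x\<bar> \<le> discount M ^ t * B" if "x \<in> space SA" for t x
    using chain_integral_bound[OF \<pi> return_prob[OF that] f, of t] discount
    by (auto simp: h_def abs_mult intro!: mult_left_mono)
  note p = prob_algebraD[OF \<mu>]
  have sB: "summable (\<lambda>t. discount M ^ t * B)"
    using discount by (intro summable_mult2 summable_geometric) auto
  have hi: "integrable \<mu> (h t)" for t
    using hB by (intro integrable_bounded_prob[OF \<mu>]) auto
  have "(\<integral>x. (\<Sum>t. h t x) \<partial>\<mu>) = (\<Sum>t. integral\<^sup>L \<mu> (h t))"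
  proof (rule integral_suminf[OF hi])
    show "AE x in \<mu>. summable (\<lambda>i. norm (h i x))"
      using hB by (intro AE_I2 summable_comparison_test'[OF sB]) (auto simp: p)
    have "norm (\<integral>x. norm (h t x) \<partial>\<mu>) \<le> discount M ^ t * B" for t
      using hB by (intro norm_integral_bounded_prob[OF \<mu>]) auto
    then show "summable (\<lambda>i. \<integral>x. norm (h i x) \<partial>\<mu>)"
      by (intro summable_comparison_test'[OF sB])
  qed
  moreover have "integral\<^sup>L \<mu> (h t) = discount M ^ t * integral\<^sup>L (chain_law M \<pi> \<mu> t) f" for t
    unfolding h_def chain_law_bind[OF \<pi> \<mu>, of t]
    by (simp add: integral_bind_prob[OF \<mu> chain_law_kernel[OF \<pi>] f])
  moreover have "disc_Q M \<pi> f x = (\<Sum>t. h t x)" for x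
    by (simp add: disc_Q_def disc_value_def h_def)
  ultimately show ?thesis
    by (simp add: disc_value_def cong: Bochner_Integration.integral_cong)
qed

lemma disc_V_measurable:
  assumes "\<pi> \<in> policies M" "f \<in> borel_measurable SA" "\<And>x. x \<in> space SA \<Longrightarrow> \<bar>f x\<bar> \<le> B"
  shows "disc_V M \<pi> f \<in> borel_measurable S"
  unfolding disc_V_def[abs_def]
  by (rule policy_integral_measurable[OF assms(1) disc_Q_measurable[OF assms(1,2)] disc_Q_bound[OF assms]])

lemma disc_V_bound:
  assumes "\<pi> \<in> policies M" "f \<in> borel_measurable SA" "\<And>x. x \<in> space SA \<Longrightarrow> \<bar>f x\<bar> \<le> B" "s \<in> space S"
  shows "\<bar>disc_V M \<pi> f s\<bar> \<le> B / (1 - discount M)"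
  unfolding disc_V_def
  by (rule policy_integral_bounded[OF assms(1) disc_Q_measurable[OF assms(1,2)] disc_Q_bound[OF assms(1-3)] assms(4)])

lemma disc_value_with_action:
  assumes \<pi>: "\<pi> \<in> policies M" and \<nu>: "\<nu> \<in> space (prob_algebra S)"
    and f: "f \<in> borel_measurable SA" "\<And>x. x \<in> space SA \<Longrightarrow> \<bar>f x\<bar> \<le> B"
  shows "disc_value M \<pi> (with_action M \<pi> \<nu>) f = integral\<^sup>L \<nu> (disc_V M \<pi> f)"
proof -
  have "disc_value M \<pi> (with_action M \<pi> \<nu>) f = integral\<^sup>L (with_action M \<pi> \<nu>) (disc_Q M \<pi> f)"
    by (rule disc_value_eq_integral_Q[OF \<pi> with_action_prob[OF \<pi> \<nu>] f])
  also have "\<dots> = integral\<^sup>L \<nu> (disc_V M \<pi> f)"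
    unfolding disc_V_def
    by (rule integral_with_action[OF \<pi> \<nu> disc_Q_measurable[OF \<pi> f(1)] disc_Q_bound[OF \<pi> f]])
  finally show ?thesis .
qed

text \<open>The term at time zero is \<open>f x\<close>; the remaining terms form the series of the
  chain restarted from the second pair, with one factor \<open>discount M\<close> taken out.\<close>

lemma bellman_equation:
  assumes \<pi>: "\<pi> \<in> policies M" and f: "f \<in> borel_measurable SA" "\<And>x. x \<in> space SA \<Longrightarrow> \<bar>f x\<bar> \<le> B"
    and x: "x \<in> space SA"
  shows "disc_Q M \<pi> f x = f x + discount M * integral\<^sup>L (transition_kernel M x) (disc_V M \<pi> f)"
proof -
  let ?K = "\<lambda>x. with_action M \<pi> (transition_kernel M x)"
  have K: "return SA x \<bind> ?K = ?K x"
    by (rule bind_return[OF measurable_prob_algebraD[OF step_measurable[OF \<pi>]] x])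
  have sx: "summable (\<lambda>t. discount M ^ t * integral\<^sup>L (chain_law M \<pi> (return SA x) t) f)"
    by (rule disc_value_bound(1)[OF \<pi> return_prob[OF x] f])
  have sK: "summable (\<lambda>t. discount M ^ t * integral\<^sup>L (chain_law M \<pi> (?K x) t) f)"
    by (rule disc_value_bound(1)[OF \<pi> kernel_space[OF step_measurable[OF \<pi>] x] f])
  have "disc_Q M \<pi> f x = discount M ^ 0 * integral\<^sup>L (chain_law M \<pi> (return SA x) 0) f
    + (\<Sum>t. discount M ^ Suc t * integral\<^sup>L (chain_law M \<pi> (return SA x) (Suc t)) f)"
    unfolding disc_Q_def disc_value_def using suminf_split_head[OF sx] by linarith
  also have "\<dots> = f x + (\<Sum>t. discount M * (discount M ^ t * integral\<^sup>L (chain_law M \<pi> (?K x) t) f))"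
    unfolding chain_law_Suc_shift K using x f by (simp add: integral_return mult.assoc)
  also have "\<dots> = f x + discount M * disc_value M \<pi> (?K x) f"
    unfolding disc_value_def suminf_mult[OF sK] ..
  finally show ?thesis
    by (simp add: disc_value_with_action[OF \<pi> kernel_space[OF transition_kernel_measurable x] f])
qed

section \<open>State marginals, telescoping and the performance difference\<close>

lemma distr_with_action_fst:
  assumes \<pi>: "\<pi> \<in> policies M" and \<nu>: "\<nu> \<in> space (prob_algebra S)"
  shows "distr (with_action M \<pi> \<nu>) S fst = \<nu>"
proof -
  note p = prob_algebraD[OF \<nu>]
  have "distr (with_action M \<pi> \<nu>) S fst = \<nu> \<bind> (\<lambda>s. distr (\<pi> s \<bind> (\<lambda>a. return SA (s, a))) S fst)"
    unfolding with_action_def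
    using measurable_prob_algebraD[OF action_kernel_measurable[OF \<pi>]]
    by (intro distr_bind[where K = SA])
      (auto simp: p prob_space.not_empty[OF p(3), unfolded p] cong: measurable_cong_sets)
  also have "\<dots> = \<nu> \<bind> return S"
  proof (rule bind_cong[OF refl])
    fix s assume "s \<in> space \<nu>"
    then have s: "s \<in> space S" by (simp add: p)
    note q = prob_algebraD[OF policy_prob[OF \<pi> s]]
    have "distr (\<pi> s \<bind> (\<lambda>a. return SA (s, a))) S fst = \<pi> s \<bind> (\<lambda>a. distr (return SA (s, a)) S fst)"
      using s by (intro distr_bind[where K = SA]) (auto simp: q prob_space.not_empty[OF q(3), unfolded q] cong: measurable_cong_sets)
    also have "\<dots> = \<pi> s \<bind> (\<lambda>a. return S s)"
      using s by (intro bind_cong[OF refl]) (auto simp: q distr_return space_pair_measure)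
    also have "\<dots> = return S s"
      using s q by (intro bind_const' prob_space_imp_subprob_space prob_space_return)
    finally show "distr (\<pi> s \<bind> (\<lambda>a. return SA (s, a))) S fst = return S s" .
  qed
  also have "\<dots> = \<nu>"
    by (rule bind_return'') (simp add: p)
  finally show ?thesis .
qed

lemma integral_with_action_fst:
  fixes V :: "'s \<Rightarrow> real"
  assumes \<pi>: "\<pi> \<in> policies M" and \<nu>: "\<nu> \<in> space (prob_algebra S)" and V: "V \<in> borel_measurable S"
  shows "(\<integral>x. V (fst x) \<partial>with_action M \<pi> \<nu>) = integral\<^sup>L \<nu> V"
  using integral_distr[of fst "with_action M \<pi> \<nu>" S V] V
  by (simp add: distr_with_action_fst[OF \<pi> \<nu>] prob_algebraD[OF with_action_prob[OF \<pi> \<nu>]] cong: measurable_cong_sets)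

text \<open>With \<open>a t\<close> the mean of \<open>V\<close> over the state at time
  \<open>t\<close>, the term of the series at \<open>t\<close> is
  \<open>discount M ^ Suc t * a (Suc t) - discount M ^ t * a t\<close>. Boundedness of
  \<open>V\<close> sends the far end to zero, so only the contribution of time zero
  survives.\<close>

lemma disc_value_telescope:
  fixes V :: "'s \<Rightarrow> real"
  assumes \<pi>: "\<pi> \<in> policies M" and \<nu>: "\<nu> \<in> space (prob_algebra S)"
    and V: "V \<in> borel_measurable S" "\<And>s. s \<in> space S \<Longrightarrow> \<bar>V s\<bar> \<le> B"
  shows "disc_value M \<pi> (with_action M \<pi> \<nu>)
      (\<lambda>x. discount M * integral\<^sup>L (transition_kernel M x) V - V (fst x)) = - integral\<^sup>L \<nu> V"
proof -
  let ?c = "chain_law M \<pi> (with_action M \<pi> \<nu>)"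
  note \<mu> = with_action_prob[OF \<pi> \<nu>]
  define a where "a t = (\<integral>x. V (fst x) \<partial>?c t)" for t
  have Vf: "(\<lambda>x. V (fst x)) \<in> borel_measurable SA"
    using V by measurable
  have VfB: "\<bar>V (fst x)\<bar> \<le> B" if "x \<in> space SA" for x
    using that V by (auto simp: space_pair_measure)
  have PV: "(\<lambda>x. integral\<^sup>L (transition_kernel M x) V) \<in> borel_measurable SA"
    by (rule measurable_integral_kernel[OF transition_kernel_measurable V(1)])
  have PVB: "\<bar>integral\<^sup>L (transition_kernel M x) V\<bar> \<le> B" if "x \<in> space SA" for x
    using norm_integral_bounded_prob[OF kernel_space[OF transition_kernel_measurable that] V(1), of B] V by simp
  have a_Suc: "a (Suc t) = (\<integral>x. integral\<^sup>L (transition_kernel M x) V \<partial>?c t)" for t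
  proof -
    have "a (Suc t) = (\<integral>x. (\<integral>y. V (fst y) \<partial>with_action M \<pi> (transition_kernel M x)) \<partial>?c t)"
      unfolding a_def chain_law.simps
      by (rule integral_bind_prob[OF chain_law_prob[OF \<pi> \<mu>] step_measurable[OF \<pi>] Vf VfB])
    also have "\<dots> = (\<integral>x. integral\<^sup>L (transition_kernel M x) V \<partial>?c t)"
      using integral_with_action_fst[OF \<pi> kernel_space[OF transition_kernel_measurable] V(1)]
      by (intro Bochner_Integration.integral_cong) (auto simp: prob_algebraD[OF chain_law_prob[OF \<pi> \<mu>]])
    finally show ?thesis .
  qed
  have a0: "a 0 = integral\<^sup>L \<nu> V"
    unfolding a_def by (simp add: integral_with_action_fst[OF \<pi> \<nu> V(1)])
  have aB: "\<bar>a t\<bar> \<le> B" for t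
    unfolding a_def by (rule chain_integral_bound[OF \<pi> \<mu> Vf VfB])
  have "integral\<^sup>L (?c t) (\<lambda>x. discount M * integral\<^sup>L (transition_kernel M x) V - V (fst x))
    = discount M * a (Suc t) - a t" for t
    using Vf VfB PV PVB unfolding a_Suc
    by (subst Bochner_Integration.integral_diff)
      (auto simp: a_def intro!: integrable_mult_right integrable_bounded_prob[OF chain_law_prob[OF \<pi> \<mu>]])
  then have *: "disc_value M \<pi> (with_action M \<pi> \<nu>)
      (\<lambda>x. discount M * integral\<^sup>L (transition_kernel M x) V - V (fst x))
      = (\<Sum>t. discount M ^ Suc t * a (Suc t) - discount M ^ t * a t)"
    by (simp only: disc_value_def) (simp add: algebra_simps)
  have "(\<lambda>t. discount M ^ t * a t) \<longlonglongrightarrow> 0"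
    by (rule summable_LIMSEQ_zero[OF discounted_sums(1)[OF aB]])
  from telescope_sums[OF this] show ?thesis
    unfolding * a0[symmetric] by (simp add: sums_iff)
qed

text \<open>By the Bellman equation the advantage of \<pi> equals \<open>f x + ?g x\<close>, where
  \<open>?g\<close> is the discounted one-step increment of the value function of \<pi>. Along the
  chain of the other policy the series of \<open>?g\<close> telescopes to minus the value of
  \<pi>.\<close>

lemma performance_difference:
  assumes \<pi>: "\<pi> \<in> policies M" and \<pi>': "\<pi>' \<in> policies M" and \<nu>: "\<nu> \<in> space (prob_algebra S)"
    and f: "f \<in> borel_measurable SA" "\<And>x. x \<in> space SA \<Longrightarrow> \<bar>f x\<bar> \<le> B"
  shows "disc_value M \<pi>' (with_action M \<pi>' \<nu>) (\<lambda>x. disc_Q M \<pi> f x - disc_V M \<pi> f (fst x))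
    = disc_value M \<pi>' (with_action M \<pi>' \<nu>) f - disc_value M \<pi> (with_action M \<pi> \<nu>) f"
proof -
  let ?g = "\<lambda>x. discount M * integral\<^sup>L (transition_kernel M x) (disc_V M \<pi> f) - disc_V M \<pi> f (fst x)"
  let ?C = "B / (1 - discount M)"
  note V = disc_V_measurable[OF \<pi> f] disc_V_bound[OF \<pi> f]
  note \<mu> = with_action_prob[OF \<pi>' \<nu>]
  have g: "?g \<in> borel_measurable SA"
    using V(1) measurable_integral_kernel[OF transition_kernel_measurable V(1)] by measurable
  have gB: "\<bar>?g x\<bar> \<le> discount M * ?C + ?C" if x: "x \<in> space SA" for x
  proof -
    have "\<bar>integral\<^sup>L (transition_kernel M x) (disc_V M \<pi> f)\<bar> \<le> ?C"
      using norm_integral_bounded_prob[OF kernel_space[OF transition_kernel_measurable x] V(1), of ?C] V(2) by simp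
    then have "\<bar>discount M * integral\<^sup>L (transition_kernel M x) (disc_V M \<pi> f)\<bar> \<le> discount M * ?C"
      using discount unfolding abs_mult by (intro mult_mono) auto
    moreover have "\<bar>disc_V M \<pi> f (fst x)\<bar> \<le> ?C"
      using x by (intro V(2)) (auto simp: space_pair_measure)
    ultimately show ?thesis by linarith
  qed
  have "disc_value M \<pi>' (with_action M \<pi>' \<nu>) (\<lambda>x. disc_Q M \<pi> f x - disc_V M \<pi> f (fst x))
    = disc_value M \<pi>' (with_action M \<pi>' \<nu>) (\<lambda>x. f x + ?g x)"
    by (rule disc_value_cong[OF \<pi>' \<mu>]) (simp add: bellman_equation[OF \<pi> f])
  also have "\<dots> = disc_value M \<pi>' (with_action M \<pi>' \<nu>) f + disc_value M \<pi>' (with_action M \<pi>' \<nu>) ?g"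
    by (rule disc_value_add[OF \<pi>' \<mu> f g gB])
  also have "\<dots> = disc_value M \<pi>' (with_action M \<pi>' \<nu>) f - disc_value M \<pi> (with_action M \<pi> \<nu>) f"
    using disc_value_telescope[OF \<pi>' \<nu> V] disc_value_with_action[OF \<pi> \<nu> f] by simp
  finally show ?thesis .
qed

text \<open>The starting law is left arbitrary, so that one exchange of sum and integral serves both
  \<open>expected_return\<close> and \<open>Q_fun\<close>.\<close>

lemma trajectory_integral_discounted_return:
  assumes \<pi>: "\<pi> \<in> policies M" and \<mu>: "\<mu> \<in> space (prob_algebra SA)"
  shows "integral\<^sup>L (trajectory M \<pi> \<mu>) (discounted_return M) = disc_value M \<pi> \<mu> (reward M)"
proof -
  let ?P = "trajectory M \<pi> \<mu>"
  note T = trajectory_marginal[OF \<pi> \<mu>]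
  have P: "?P \<in> space (prob_algebra (PiM UNIV (\<lambda>_. SA)))"
    by (simp add: space_prob_algebra T)
  have rB: "\<bar>reward M x\<bar> \<le> r_max" if "x \<in> space SA" for x
    using reward_bounded[OF that] by auto
  have r: "(\<lambda>\<omega>. reward M (\<omega> t)) \<in> borel_measurable (PiM UNIV (\<lambda>_. SA))" for t
    using reward_measurable by measurable
  have rt: "integral\<^sup>L ?P (\<lambda>\<omega>. reward M (\<omega> t)) = integral\<^sup>L (chain_law M \<pi> \<mu> t) (reward M)" for t
    unfolding T(3)[symmetric] using reward_measurable
    by (subst integral_distr) (auto simp: measurable_cong_sets[OF T(1) refl])
  define h where "h t \<omega> = discount M ^ t * reward M (\<omega> t)" for t \<omega>
  have h: "h t \<in> borel_measurable (PiM UNIV (\<lambda>_. SA))" for t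
    unfolding h_def[abs_def] using r[of t] by measurable
  have hB: "\<bar>h t \<omega>\<bar> \<le> discount M ^ t * r_max" if "\<omega> \<in> space (PiM UNIV (\<lambda>_. SA))" for t \<omega>
    using that discount rB[of "\<omega> t"] by (auto simp: h_def abs_mult space_PiM intro!: mult_left_mono)
  have sB: "summable (\<lambda>t. discount M ^ t * r_max)"
    using discount by (intro summable_mult2 summable_geometric) auto
  have "(\<integral>\<omega>. (\<Sum>t. h t \<omega>) \<partial>?P) = (\<Sum>t. integral\<^sup>L ?P (h t))"
  proof (rule integral_suminf)
    show "integrable ?P (h t)" for t
      using hB h by (intro integrable_bounded_prob[OF P]) auto
    show "AE x in ?P. summable (\<lambda>i. norm (h i x))"
      using hB by (intro AE_I2 summable_comparison_test'[OF sB]) (auto simp: prob_algebraD[OF P])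
    have "norm (\<integral>x. norm (h t x) \<partial>?P) \<le> discount M ^ t * r_max" for t
      using hB h by (intro norm_integral_bounded_prob[OF P]) auto
    then show "summable (\<lambda>i. \<integral>x. norm (h i x) \<partial>?P)"
      by (intro summable_comparison_test'[OF sB])
  qed
  then show ?thesis
    by (simp add: discounted_return_def[abs_def] h_def[abs_def] disc_value_def rt)
qed

lemma expected_return_eq:
  "\<pi> \<in> policies M \<Longrightarrow> expected_return M \<pi> = disc_value M \<pi> (with_action M \<pi> (init_dist M)) (reward M)"
  unfolding expected_return_def
  by (rule trajectory_integral_discounted_return[OF _ with_action_prob[OF _ init_dist_prob]])

lemma Q_fun_eq: "\<pi> \<in> policies M \<Longrightarrow> x \<in> space SA \<Longrightarrow> Q_fun M \<pi> x = disc_Q M \<pi> (reward M) x"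
  unfolding Q_fun_def disc_Q_def
  by (rule trajectory_integral_discounted_return[OF _ return_prob])

lemma V_fun_eq: "\<pi> \<in> policies M \<Longrightarrow> s \<in> space S \<Longrightarrow> V_fun M \<pi> s = disc_V M \<pi> (reward M) s"
  unfolding V_fun_def disc_V_def
  by (intro Bochner_Integration.integral_cong refl Q_fun_eq)
    (auto simp: prob_algebraD[OF policy_prob] space_pair_measure)

section \<open>The visitation measure as a geometric mixture\<close>

primrec state_law :: "('s \<Rightarrow> 'a measure) \<Rightarrow> nat \<Rightarrow> 's measure" where
  "state_law \<pi> 0 = init_dist M"
| "state_law \<pi> (Suc t) = chain_law M \<pi> (with_action M \<pi> (init_dist M)) t \<bind> transition_kernel M"

lemma state_law_prob:
  assumes \<pi>: "\<pi> \<in> policies M"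
  shows "state_law \<pi> t \<in> space (prob_algebra S)"
  by (cases t) (auto intro: init_dist_prob bind_in_prob_algebra[OF chain_law_prob transition_kernel_measurable]
      with_action_prob \<pi>)

text \<open>At every time the action is drawn from \<pi> given the state. This factorization links
  laws of pairs to \<open>visitation\<close>, a measure on states, and permits averaging over the
  action at a fixed state.\<close>

lemma chain_law_state_law:
  assumes \<pi>: "\<pi> \<in> policies M"
  shows "chain_law M \<pi> (with_action M \<pi> (init_dist M)) t = with_action M \<pi> (state_law \<pi> t)"
proof (cases t)
  case (Suc n)
  then show ?thesis
    unfolding with_action_def[of M \<pi> "state_law \<pi> t"]
    by (simp add: bind_assoc_prob[OF chain_law_prob[OF \<pi> with_action_prob[OF \<pi> init_dist_prob]]
          transition_kernel_measurable action_kernel_measurable[OF \<pi>]] with_action_def[of M \<pi> "transition_kernel M _"])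
qed simp

text \<open>The weights \<open>(1 - discount M) * discount M ^ t\<close> form a geometric
  distribution, so \<open>visitation\<close> is the law of the state at an independent geometric
  time. As a \<open>bind\<close> it is visibly a probability measure, whereas the defining
  \<open>measure_of\<close> first needs its set function to be recognized as countably
  additive.\<close>

lemma visitation_eq:
  assumes \<pi>: "\<pi> \<in> policies M"
  shows "visitation M \<pi> = measure_pmf (geometric_pmf (1 - discount M)) \<bind> state_law \<pi>"
proof -
  let ?G = "measure_pmf (geometric_pmf (1 - discount M))"
  let ?P = "trajectory M \<pi> (with_action M \<pi> (init_dist M))"
  note \<mu> = with_action_prob[OF \<pi> init_dist_prob]
  note T = trajectory_marginal[OF \<pi> \<mu>]
  have G: "?G \<in> space (prob_algebra (count_space UNIV))"
    by (simp add: space_prob_algebra measure_pmf.prob_space_axioms)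
  have k: "state_law \<pi> \<in> count_space UNIV \<rightarrow>\<^sub>M prob_algebra S"
    using state_law_prob[OF \<pi>] by auto
  note mix = bind_in_prob_algebra[OF G k]
  have "measure_of (space S) (sets S)
     (\<lambda>B. let P = ?P in ennreal ((1 - discount M) *
          (\<Sum>t. discount M ^ t * measure P {\<omega> \<in> space P. fst (\<omega> t) \<in> B})))
    = measure_of (space S) (sets S) (emeasure (?G \<bind> state_law \<pi>))"
  proof (rule measure_of_eq[OF sets.space_closed])
    fix B assume "B \<in> sigma_sets (space S) (sets S)"
    then have B: "B \<in> sets S" by (simp add: sets.sigma_sets_eq)
    have m: "measure ?P {\<omega> \<in> space ?P. fst (\<omega> t) \<in> B} = measure (state_law \<pi> t) B" for t
    proof -
      have "state_law \<pi> t = distr (distr ?P SA (\<lambda>\<omega>. \<omega> t)) S fst"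
        unfolding T(3) chain_law_state_law[OF \<pi>] by (rule distr_with_action_fst[OF \<pi> state_law_prob[OF \<pi>], symmetric])
      also have "\<dots> = distr ?P S (\<lambda>\<omega>. fst (\<omega> t))"
        by (subst distr_distr) (auto simp: measurable_cong_sets[OF T(1) refl] comp_def)
      finally have "measure (state_law \<pi> t) B = measure (distr ?P S (\<lambda>\<omega>. fst (\<omega> t))) B"
        by simp
      also have "\<dots> = measure ?P ((\<lambda>\<omega>. fst (\<omega> t)) -` B \<inter> space ?P)"
        using B by (intro measure_distr) (auto simp: measurable_cong_sets[OF T(1) refl])
      finally show ?thesis
        by (simp add: vimage_def Int_def conj_commute)
    qed
    have le1: "\<bar>measure (state_law \<pi> t) B\<bar> \<le> 1" for t
      using prob_algebraD(3)[OF state_law_prob[OF \<pi>]] by (simp add: prob_space.prob_le_1)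
    have "emeasure (?G \<bind> state_law \<pi>) B = (\<integral>\<^sup>+t. emeasure (state_law \<pi> t) B \<partial>?G)"
      by (rule emeasure_bind_prob_algebra[OF G k B])
    also have "\<dots> = (\<Sum>t. ennreal (pmf (geometric_pmf (1 - discount M)) t) * emeasure (state_law \<pi> t) B)"
      unfolding nn_integral_measure_pmf nn_integral_count_space_nat ..
    also have "\<dots> = (\<Sum>t. ennreal ((1 - discount M) * (discount M ^ t * measure (state_law \<pi> t) B)))"
      using discount prob_algebraD(3)[OF state_law_prob[OF \<pi>]]
      by (simp add: finite_measure.emeasure_eq_measure[OF prob_space.finite_measure] ennreal_mult[symmetric] mult_ac)
    also have "\<dots> = ennreal (\<Sum>t. (1 - discount M) * (discount M ^ t * measure (state_law \<pi> t) B))"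
      using discount by (intro suminf_ennreal2 summable_mult discounted_sums[OF le1]) auto
    also have "\<dots> = ennreal ((1 - discount M) * (\<Sum>t. discount M ^ t * measure (state_law \<pi> t) B))"
      by (subst suminf_mult[OF discounted_sums(1)[OF le1]]) simp
    finally show "(let P = ?P in ennreal ((1 - discount M) *
          (\<Sum>t. discount M ^ t * measure P {\<omega> \<in> space P. fst (\<omega> t) \<in> B}))) = emeasure (?G \<bind> state_law \<pi>) B"
      by (simp add: m Let_def)
  qed
  also have "\<dots> = ?G \<bind> state_law \<pi>"
    using measure_of_of_measure[of "?G \<bind> state_law \<pi>"] prob_algebraD[OF mix] by simp
  finally show ?thesis by (simp add: visitation_def)
qed

lemma visitation_prob: "\<pi> \<in> policies M \<Longrightarrow> visitation M \<pi> \<in> space (prob_algebra S)"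
  unfolding visitation_eq using state_law_prob
  by (intro bind_in_prob_algebra[where N = "count_space UNIV"])
    (auto simp: space_prob_algebra[of "count_space UNIV"] measure_pmf.prob_space_axioms)

text \<open>Translates the expectation in \<open>transfer_error\<close> into the series to which the
  performance difference applies. The integrand is first averaged over actions, since the mixture is
  one of state laws.\<close>

lemma integral_visitation:
  fixes f :: "'s \<times> 'a \<Rightarrow> real"
  assumes \<pi>: "\<pi> \<in> policies M" and f: "f \<in> borel_measurable SA" "\<And>x. x \<in> space SA \<Longrightarrow> \<bar>f x\<bar> \<le> B"
  shows "integral\<^sup>L (with_action M \<pi> (visitation M \<pi>)) f
    = (1 - discount M) * disc_value M \<pi> (with_action M \<pi> (init_dist M)) f"
proof -
  let ?G = "measure_pmf (geometric_pmf (1 - discount M))"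
  let ?\<mu> = "with_action M \<pi> (init_dist M)"
  let ?V = "\<lambda>s. \<integral>a. f (s, a) \<partial>\<pi> s"
  note \<mu> = with_action_prob[OF \<pi> init_dist_prob]
  have G: "?G \<in> space (prob_algebra (count_space UNIV))"
    by (simp add: space_prob_algebra measure_pmf.prob_space_axioms)
  have k: "state_law \<pi> \<in> count_space UNIV \<rightarrow>\<^sub>M prob_algebra S"
    using state_law_prob[OF \<pi>] by auto
  have "integral\<^sup>L (with_action M \<pi> (visitation M \<pi>)) f = integral\<^sup>L (?G \<bind> state_law \<pi>) ?V"
    using integral_with_action[OF \<pi> visitation_prob[OF \<pi>] f] by (simp add: visitation_eq[OF \<pi>])
  also have "\<dots> = (\<integral>t. integral\<^sup>L (state_law \<pi> t) ?V \<partial>?G)"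
    by (rule integral_bind_prob[OF G k policy_integral_measurable[OF \<pi> f] policy_integral_bounded[OF \<pi> f]])
  also have "\<dots> = (\<integral>t. integral\<^sup>L (chain_law M \<pi> ?\<mu> t) f \<partial>?G)"
    using integral_with_action[OF \<pi> state_law_prob[OF \<pi>] f] by (simp add: chain_law_state_law[OF \<pi>])
  also have "\<dots> = (\<integral>t. (discount M ^ t * (1 - discount M)) * integral\<^sup>L (chain_law M \<pi> ?\<mu> t) f \<partial>count_space UNIV)"
    unfolding measure_pmf_eq_density using discount by (subst integral_density) auto
  also have "\<dots> = (\<Sum>t. (discount M ^ t * (1 - discount M)) * integral\<^sup>L (chain_law M \<pi> ?\<mu> t) f)"
  proof (rule integral_count_space_nat)
    have "\<bar>\<bar>integral\<^sup>L (chain_law M \<pi> ?\<mu> t) f\<bar>\<bar> \<le> B" for t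
      using chain_integral_bound[OF \<pi> \<mu> f] by simp
    from summable_mult[OF discounted_sums(1)[OF this], of "1 - discount M"]
    show "integrable (count_space UNIV) (\<lambda>t. (discount M ^ t * (1 - discount M)) * integral\<^sup>L (chain_law M \<pi> ?\<mu> t) f)"
      using discount by (simp add: integrable_count_space_nat_iff abs_mult mult_ac)
  qed
  also have "\<dots> = (\<Sum>t. (1 - discount M) * (discount M ^ t * integral\<^sup>L (chain_law M \<pi> ?\<mu> t) f))"
    by (simp add: mult_ac)
  also have "\<dots> = (1 - discount M) * disc_value M \<pi> ?\<mu> f"
    unfolding disc_value_def by (rule suminf_mult[OF disc_value_bound(1)[OF \<pi> \<mu> f]])
  finally show ?thesis .
qed

end

section \<open>Gradients, their measurability, and smooth policies\<close>

lemma grad_unique: "GDERIV f x :> D \<Longrightarrow> grad f x = D"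
proof -
  assume D: "GDERIV f x :> D"
  have "D' = D" if D': "GDERIV f x :> D'" for D'
  proof -
    have "(\<lambda>h. h \<bullet> D') = (\<lambda>h. h \<bullet> D)"
      using D D' unfolding gderiv_def by (rule has_derivative_unique[rotated])
    then show "D' = D"
      by (metis inner_commute vector_eq_rdot)
  qed
  with D show ?thesis
    unfolding grad_def by (intro the_equality)
qed

text \<open>Riesz representation in coordinates: the gradient has the values of the derivative on
  the basis as its components.\<close>

lemma differentiable_GDERIV:
  fixes f :: "real^'n \<Rightarrow> real"
  assumes "f differentiable (at x)"
  shows "GDERIV f x :> grad f x"
proof -
  from assms obtain f' where f': "(f has_derivative f') (at x)"
    by (auto simp: differentiable_def)
  then have lin: "linear f'"
    by (rule has_derivative_linear)
  have "f' h = h \<bullet> (\<Sum>b\<in>Basis. f' b *\<^sub>R b)" for h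
  proof -
    have "f' h = f' (\<Sum>b\<in>Basis. (h \<bullet> b) *\<^sub>R b)"
      by (simp add: euclidean_representation)
    also have "\<dots> = (\<Sum>b\<in>Basis. (h \<bullet> b) * f' b)"
      using lin by (simp add: linear_sum linear_cmul)
    finally show ?thesis
      by (simp add: inner_sum_right mult.commute)
  qed
  then have "f' = (\<lambda>h. h \<bullet> (\<Sum>b\<in>Basis. f' b *\<^sub>R b))"
    by (rule ext)
  with f' have "GDERIV f x :> (\<Sum>b\<in>Basis. f' b *\<^sub>R b)"
    by (simp add: gderiv_def)
  with grad_unique[OF this] show ?thesis by simp
qed

text \<open>Presents a derivative as the limit of one explicit sequence, a form in which
  measurability survives the passage to the limit.\<close>

lemma has_derivative_sequential_limit:
  fixes f :: "'a::real_normed_vector \<Rightarrow> 'b::real_normed_vector"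
  assumes f': "(f has_derivative f') (at x)"
  shows "(\<lambda>n. real (Suc n) *\<^sub>R (f (x + inverse (real (Suc n)) *\<^sub>R h) - f x)) \<longlonglongrightarrow> f' h"
proof (cases "h = 0")
  case True
  then show ?thesis
    using has_derivative_linear[OF f'] by (simp add: linear_0)
next
  case False
  have l: "linear f'"
    using f' by (rule has_derivative_linear)
  \<comment> \<open>The limit defining the derivative is punctured; these increments tend to zero
    without reaching it because \<open>h\<close> is nonzero.\<close>
  define y where "y n = inverse (real (Suc n)) *\<^sub>R h" for n
  have "y \<longlonglongrightarrow> 0 *\<^sub>R h"
    unfolding y_def[abs_def] by (intro tendsto_scaleR LIMSEQ_inverse_real_of_nat tendsto_const)
  then have "filterlim y (at 0) sequentially"
    using False by (auto simp: filterlim_at y_def simp del: of_nat_Suc)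
  then have "(\<lambda>n. norm (f (x + y n) - f x - f' (y n)) / norm (y n)) \<longlonglongrightarrow> 0"
    using f' unfolding has_derivative_at by (intro filterlim_compose[of _ "nhds 0" "at 0" y]) auto
  from tendsto_mult_left[OF this, of "norm h"]
  have lim: "(\<lambda>n. norm h * (norm (f (x + y n) - f x - f' (y n)) / norm (y n))) \<longlonglongrightarrow> 0"
    by simp
  have eq: "norm (real (Suc n) *\<^sub>R (f (x + y n) - f x) - f' h)
    = norm h * (norm (f (x + y n) - f x - f' (y n)) / norm (y n))" for n
  proof -
    have "h = real (Suc n) *\<^sub>R y n" by (simp add: y_def)
    then have "f' h = real (Suc n) *\<^sub>R f' (y n)"
      using linear_cmul[OF l] by metis
    then have "norm (real (Suc n) *\<^sub>R (f (x + y n) - f x) - f' h)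
      = real (Suc n) * norm (f (x + y n) - f x - f' (y n))"
      by (simp add: scaleR_diff_right[symmetric] del: of_nat_Suc)
    also have "\<dots> = norm h * (norm (f (x + y n) - f x - f' (y n)) / norm (y n))"
      using False by (simp add: y_def field_simps del: of_nat_Suc)
    finally show ?thesis .
  qed
  have "(\<lambda>n. real (Suc n) *\<^sub>R (f (x + y n) - f x) - f' h) \<longlonglongrightarrow> 0"
    using lim unfolding eq[symmetric] by (rule tendsto_norm_zero_cancel)
  then show ?thesis
    unfolding y_def by (rule LIM_zero_cancel)
qed

text \<open>Rounding \<theta> down to the grid of mesh \<open>1 / real (Suc n)\<close> leaves
  countably many parameter values, for which joint measurability is immediate. Continuity in
  \<theta> makes the rounded functions converge pointwise. Here \<open>z\<close> is the index of a
  grid point and \<open>r\<close> the point itself.\<close>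

lemma caratheodory_measurable:
  fixes f :: "real^'n \<Rightarrow> 'b \<Rightarrow> 'c::metric_space"
  assumes f[measurable]: "\<And>\<theta>. f \<theta> \<in> borel_measurable N"
    and cont: "\<And>y. y \<in> space N \<Longrightarrow> continuous_on UNIV (\<lambda>\<theta>. f \<theta> y)"
  shows "(\<lambda>(\<theta>, y). f \<theta> y) \<in> borel_measurable (borel \<Otimes>\<^sub>M N)"
proof (rule borel_measurable_LIMSEQ_metric)
  define z :: "nat \<Rightarrow> real^'n \<Rightarrow> int^'n" where "z n \<theta> = (\<chi> i. \<lfloor>real (Suc n) * \<theta> $ i\<rfloor>)" for n \<theta>
  define r :: "nat \<Rightarrow> int^'n \<Rightarrow> real^'n" where "r n k = (\<chi> i. real_of_int (k $ i) / real (Suc n))" for n k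
  show "(\<lambda>w. f (r n (z n (fst w))) (snd w)) \<in> borel_measurable (borel \<Otimes>\<^sub>M N)" for n
  proof (rule measurable_compose_countable[where g = "\<lambda>w. z n (fst w)"])
    show "(\<lambda>w. z n (fst w)) \<in> borel \<Otimes>\<^sub>M N \<rightarrow>\<^sub>M count_space UNIV"
    proof (rule measurable_compose[OF measurable_fst])
      have "z n -` {a} \<inter> space borel \<in> sets borel" for a
      proof -
        have "z n -` {a} \<inter> space borel = (\<Inter>i. {\<theta>. \<lfloor>real (Suc n) * \<theta> $ i\<rfloor> = a $ i})"
          by (auto simp: z_def vec_eq_iff)
        also have "\<dots> \<in> sets borel"
        proof (intro sets.finite_INT)
          fix i
          have [measurable]: "(\<lambda>\<theta>::real^'n. real (Suc n) * \<theta> $ i) \<in> borel_measurable borel"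
            by (intro borel_measurable_continuous_onI continuous_intros)
          have "{\<theta>::real^'n. \<lfloor>real (Suc n) * \<theta> $ i\<rfloor> = a $ i}
            = {\<theta> \<in> space borel. real_of_int (a $ i) \<le> real (Suc n) * \<theta> $ i \<and> real (Suc n) * \<theta> $ i < real_of_int (a $ i) + 1}"
            by (auto simp: floor_eq_iff)
          also have "\<dots> \<in> sets borel"
            by measurable
          finally show "{\<theta>::real^'n. \<lfloor>real (Suc n) * \<theta> $ i\<rfloor> = a $ i} \<in> sets borel" .
        qed simp_all
        finally show ?thesis .
      qed
      then show "z n \<in> borel \<rightarrow>\<^sub>M count_space UNIV"
        by (subst measurable_count_space_eq2_countable) auto
    qed
  qed simp
  fix w :: "(real^'n) \<times> 'b" assume w: "w \<in> space (borel \<Otimes>\<^sub>M N)"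
  obtain \<theta> y where wy: "w = (\<theta>, y)" and y: "y \<in> space N"
    using w by (cases w) (auto simp: space_pair_measure)
  have "(\<lambda>n. r n (z n \<theta>)) \<longlonglongrightarrow> \<theta>"
  proof (rule vec_tendstoI)
    fix i
    have *: "norm (r n (z n \<theta>) $ i - \<theta> $ i) \<le> inverse (real (Suc n))" for n
    proof -
      have "\<bar>real_of_int \<lfloor>real (Suc n) * \<theta> $ i\<rfloor> - real (Suc n) * \<theta> $ i\<bar> \<le> 1"
        by linarith
      then have "\<bar>(real_of_int \<lfloor>real (Suc n) * \<theta> $ i\<rfloor> - real (Suc n) * \<theta> $ i) / real (Suc n)\<bar> \<le> 1 / real (Suc n)"
        unfolding abs_divide by (intro divide_mono) auto
      then show ?thesis
        by (simp add: r_def z_def diff_divide_distrib inverse_eq_divide del: of_nat_Suc)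
    qed
    show "(\<lambda>n. r n (z n \<theta>) $ i) \<longlonglongrightarrow> \<theta> $ i"
      by (rule LIM_zero_cancel, rule Lim_null_comparison[OF _ LIMSEQ_inverse_real_of_nat])
        (use * in auto)
  qed
  moreover have "isCont (\<lambda>\<theta>. f \<theta> y) \<theta>"
    using cont[OF y] by (simp add: continuous_on_eq_continuous_at)
  ultimately show "(\<lambda>n. f (r n (z n (fst w))) (snd w)) \<longlonglongrightarrow> (case w of (\<theta>, y) \<Rightarrow> f \<theta> y)"
    using isCont_tendsto_compose[of \<theta> "\<lambda>\<theta>. f \<theta> y"] by (simp add: wy)
qed

lemma caratheodory_measurable_differentiable:
  fixes f :: "real^'n \<Rightarrow> 'b \<Rightarrow> real"
  assumes f: "\<And>\<theta>. f \<theta> \<in> borel_measurable N"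
    and d: "\<And>\<theta> y. y \<in> space N \<Longrightarrow> (\<lambda>\<theta>. f \<theta> y) differentiable (at \<theta>)"
  shows "(\<lambda>(\<theta>, y). f \<theta> y) \<in> borel_measurable (borel \<Otimes>\<^sub>M N)"
  using d by (intro caratheodory_measurable f)
    (auto intro!: continuous_at_imp_continuous_on differentiable_imp_continuous_within)

text \<open>Each component is a pointwise limit of difference quotients, and these are jointly
  measurable because differentiability in \<theta> includes continuity.\<close>

lemma grad_measurable:
  fixes f :: "real^'n \<Rightarrow> 'b \<Rightarrow> real"
  assumes f: "\<And>\<theta>. f \<theta> \<in> borel_measurable N"
    and d: "\<And>\<theta> y. y \<in> space N \<Longrightarrow> (\<lambda>\<theta>. f \<theta> y) differentiable (at \<theta>)"
  shows "(\<lambda>(\<theta>, y). grad (\<lambda>\<theta>. f \<theta> y) \<theta>) \<in> borel_measurable (borel \<Otimes>\<^sub>M N)"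
proof (subst borel_measurable_euclidean_space, intro ballI)
  fix b :: "real^'n" assume "b \<in> Basis"
  note [measurable] = caratheodory_measurable_differentiable[of f N, OF f d, simplified split_beta']
  have F: "(\<lambda>w. real (Suc n) * (f (fst w + inverse (real (Suc n)) *\<^sub>R b) (snd w) - f (fst w) (snd w)))
      \<in> borel_measurable (borel \<Otimes>\<^sub>M N)" for n
  proof -
    have "(\<lambda>w. (fst w + inverse (real (Suc n)) *\<^sub>R b, snd w)) \<in> borel \<Otimes>\<^sub>M N \<rightarrow>\<^sub>M borel \<Otimes>\<^sub>M N"
      by measurable
    from measurable_compose[OF this caratheodory_measurable_differentiable[of f N, OF f d]]
    have [measurable]: "(\<lambda>w. f (fst w + inverse (real (Suc n)) *\<^sub>R b) (snd w)) \<in> borel_measurable (borel \<Otimes>\<^sub>M N)"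
      by simp
    show ?thesis by measurable
  qed
  show "(\<lambda>w. (case w of (\<theta>, y) \<Rightarrow> grad (\<lambda>\<theta>. f \<theta> y) \<theta>) \<bullet> b) \<in> borel_measurable (borel \<Otimes>\<^sub>M N)"
  proof (rule borel_measurable_LIMSEQ_metric[OF F])
    fix w :: "(real^'n) \<times> 'b" assume "w \<in> space (borel \<Otimes>\<^sub>M N)"
    then obtain \<theta> y where wy: "w = (\<theta>, y)" and y: "y \<in> space N"
      by (cases w) (auto simp: space_pair_measure)
    from differentiable_GDERIV[OF d[OF y]]
    have "((\<lambda>\<theta>. f \<theta> y) has_derivative (\<lambda>h. h \<bullet> grad (\<lambda>\<theta>. f \<theta> y) \<theta>)) (at \<theta>)"
      by (simp add: gderiv_def)
    from has_derivative_sequential_limit[OF this, of b]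
    show "(\<lambda>n. real (Suc n) * (f (fst w + inverse (real (Suc n)) *\<^sub>R b) (snd w) - f (fst w) (snd w)))
        \<longlonglongrightarrow> (case w of (\<theta>, y) \<Rightarrow> grad (\<lambda>\<theta>. f \<theta> y) \<theta>) \<bullet> b"
      by (simp add: wy inner_commute)
  qed
qed

text \<open>A Hessian applied to a vector is a directional derivative of the gradient, so the
  difference quotients of \<open>grad\<close> apply. Parameter, direction and data are functions of
  a common variable because all three are random in the update of the algorithm.\<close>

lemma hessian_mult_measurable:
  fixes f :: "real^'n \<Rightarrow> 'b \<Rightarrow> real"
  assumes f: "\<And>\<theta>. f \<theta> \<in> borel_measurable N"
    and d: "\<And>\<theta> y. y \<in> space N \<Longrightarrow> (\<lambda>\<theta>. f \<theta> y) differentiable (at \<theta>)"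
    and d2: "\<And>\<theta> y. y \<in> space N \<Longrightarrow> grad (\<lambda>\<theta>. f \<theta> y) differentiable (at \<theta>)"
    and \<theta>[measurable]: "\<theta> \<in> borel_measurable L" and h[measurable]: "h \<in> borel_measurable L"
    and y[measurable]: "y \<in> L \<rightarrow>\<^sub>M N"
  shows "(\<lambda>w. hessian (\<lambda>\<theta>. f \<theta> (y w)) (\<theta> w) *v h w) \<in> borel_measurable L"
proof (rule borel_measurable_LIMSEQ_metric)
  let ?g = "\<lambda>\<theta> y. grad (\<lambda>\<theta>. f \<theta> y) \<theta>"
  have g: "(\<lambda>w. ?g (\<phi> w) (y w)) \<in> borel_measurable L" if "\<phi> \<in> borel_measurable L" for \<phi>
  proof -
    have "(\<lambda>w. (\<phi> w, y w)) \<in> L \<rightarrow>\<^sub>M borel \<Otimes>\<^sub>M N"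
      using that by measurable
    from measurable_compose[OF this grad_measurable[of f N, OF f d]] show ?thesis by simp
  qed
  show "(\<lambda>w. real (Suc n) *\<^sub>R (?g (\<theta> w + inverse (real (Suc n)) *\<^sub>R h w) (y w) - ?g (\<theta> w) (y w)))
      \<in> borel_measurable L" for n
    by (intro borel_measurable_scaleR borel_measurable_diff g) measurable
  fix w assume "w \<in> space L"
  then have "y w \<in> space N" by (rule measurable_space[OF y])
  from d2[OF this, of "\<theta> w"]
  have "(grad (\<lambda>\<theta>. f \<theta> (y w)) has_derivative (\<lambda>h. hessian (\<lambda>\<theta>. f \<theta> (y w)) (\<theta> w) *v h)) (at (\<theta> w))"
    by (simp add: jacobian_works hessian_def)
  from has_derivative_sequential_limit[OF this, of "h w"]
  show "(\<lambda>n. real (Suc n) *\<^sub>R (?g (\<theta> w + inverse (real (Suc n)) *\<^sub>R h w) (y w) - ?g (\<theta> w) (y w)))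
      \<longlonglongrightarrow> hessian (\<lambda>\<theta>. f \<theta> (y w)) (\<theta> w) *v h w" .
qed

lemma exp_quadratic_remainder:
  fixes u :: real
  assumes "\<bar>u\<bar> \<le> 1"
  shows "\<bar>exp u - 1 - u\<bar> \<le> u\<^sup>2"
proof -
  have "exp u \<le> 1 + u + u\<^sup>2"
  proof (cases "0 \<le> u")
    case True
    then show ?thesis using exp_bound[of u] assms by simp
  next
    case False
    have "0 < 1 - u" using False by simp
    moreover have "1 - u \<le> exp (- u)" using exp_ge_add_one_self[of "- u"] by simp
    ultimately have "inverse (exp (- u)) \<le> inverse (1 - u)"
      by (intro le_imp_inverse_le)
    \<comment> \<open>The product is \<open>1 - u ^ 3\<close>, and \<open>u\<close> is negative
      here.\<close>
    moreover have "1 \<le> (1 + u + u\<^sup>2) * (1 - u)"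
    proof -
      have "(1 + u + u\<^sup>2) * (1 - u) = 1 + (- u) * u\<^sup>2"
        by (simp add: algebra_simps power2_eq_square)
      moreover have "0 \<le> (- u) * u\<^sup>2" using False by (intro mult_nonneg_nonneg) auto
      ultimately show ?thesis by linarith
    qed
    then have "inverse (1 - u) \<le> 1 + u + u\<^sup>2"
      using \<open>0 < 1 - u\<close> by (simp add: inverse_eq_divide divide_le_eq)
    ultimately show ?thesis by (simp add: exp_minus)
  qed
  with exp_ge_add_one_self[of u] show ?thesis by linarith
qed

section \<open>Smooth policies and the expansion of their densities\<close>

locale smooth_mdp = mdp M r_max + policy_family M pol
  for M :: "('s, 'a) mdp_data" and r_max :: real and pol :: "real^'n \<Rightarrow> 's \<Rightarrow> 'a \<Rightarrow> real" +
  fixes M\<^sub>g M\<^sub>h :: real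
  assumes pol_pos: "\<And>\<theta> s a. s \<in> space (state_space M) \<Longrightarrow> a \<in> space (action_space M) \<Longrightarrow> 0 < pol \<theta> s a"
    and pol_C2: "\<And>s a. s \<in> space (state_space M) \<Longrightarrow> a \<in> space (action_space M) \<Longrightarrow>
        twice_cont_diff (\<lambda>\<theta>. pol \<theta> s a)"
    and M_pos: "0 < M\<^sub>g" "0 < M\<^sub>h"
    and score_bound: "\<And>\<theta> x. x \<in> space (sa_space M) \<Longrightarrow> norm (score pol \<theta> x) \<le> M\<^sub>g"
    and score_hessian_bound:
      "\<And>\<theta> x. x \<in> space (sa_space M) \<Longrightarrow> op_norm (score_hessian pol \<theta> x) \<le> M\<^sub>h"
begin

abbreviation "p \<theta> x \<equiv> pol \<theta> (fst x) (snd x)"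

lemma p_pos: "x \<in> space SA \<Longrightarrow> 0 < p \<theta> x"
  using pol_pos by (auto simp: space_pair_measure)

lemma p_measurable: "p \<theta> \<in> borel_measurable SA"
  using pol_measurable[of \<theta>] by (simp add: split_beta')

lemma ln_p_measurable: "(\<lambda>x. ln (p \<theta> x)) \<in> borel_measurable SA"
  using p_measurable by measurable

lemma ln_p_GDERIV:
  assumes x: "x \<in> space SA"
  shows "GDERIV (\<lambda>\<theta>. ln (p \<theta> x)) \<theta> :> inverse (p \<theta> x) *\<^sub>R grad (\<lambda>\<theta>. p \<theta> x) \<theta>"
proof -
  have "twice_cont_diff (\<lambda>\<theta>. p \<theta> x)"
    using x by (intro pol_C2) (auto simp: space_pair_measure)
  then have "GDERIV (\<lambda>\<theta>. p \<theta> x) \<theta> :> grad (\<lambda>\<theta>. p \<theta> x) \<theta>"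
    by (intro differentiable_GDERIV) (auto simp: twice_cont_diff_def)
  moreover have "DERIV ln (p \<theta> x) :> inverse (p \<theta> x)"
    by (rule DERIV_ln[OF p_pos[OF x]])
  ultimately show ?thesis
    by (rule GDERIV_DERIV_compose)
qed

lemma ln_p_differentiable:
  assumes "x \<in> space SA"
  shows "(\<lambda>\<theta>. ln (p \<theta> x)) differentiable (at \<theta>)"
  using ln_p_GDERIV[OF assms, of \<theta>] by (auto simp: gderiv_def differentiable_def)

lemma grad_ln_p_differentiable:
  assumes x: "x \<in> space SA"
  shows "grad (\<lambda>\<theta>. ln (p \<theta> x)) differentiable (at \<theta>)"
proof -
  have eq: "grad (\<lambda>\<theta>. ln (p \<theta> x)) = (\<lambda>\<theta>. inverse (p \<theta> x) *\<^sub>R grad (\<lambda>\<theta>. p \<theta> x) \<theta>)"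
    by (intro ext grad_unique ln_p_GDERIV x)
  have "twice_cont_diff (\<lambda>\<theta>. p \<theta> x)"
    using x by (intro pol_C2) (auto simp: space_pair_measure)
  then show ?thesis
    using p_pos[OF x, of \<theta>] unfolding eq twice_cont_diff_def
    by (intro differentiable_scaleR differentiable_inverse) auto
qed

lemma score_derivative:
  assumes "x \<in> space SA"
  shows "((\<lambda>\<theta>. ln (p \<theta> x)) has_derivative (\<lambda>h. h \<bullet> score pol \<theta> x)) (at \<theta>)"
  using differentiable_GDERIV[OF ln_p_differentiable[OF assms]]
  by (simp add: gderiv_def score_def)

lemma score_measurable: "score pol \<theta> \<in> borel_measurable SA"
proof -
  have "(\<lambda>x. (\<theta>, x)) \<in> SA \<rightarrow>\<^sub>M borel \<Otimes>\<^sub>M SA" by simp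
  from measurable_compose[OF this grad_measurable[of "\<lambda>\<theta> x. ln (p \<theta> x)" SA, OF ln_p_measurable ln_p_differentiable]]
  show ?thesis by (simp add: score_def[abs_def])
qed

lemma score_lipschitz:
  assumes x: "x \<in> space SA"
  shows "norm (score pol \<theta>' x - score pol \<theta> x) \<le> M\<^sub>h * norm (\<theta>' - \<theta>)"
proof (rule differentiable_bound[where S = UNIV])
  show "((\<lambda>\<theta>. score pol \<theta> x) has_derivative (\<lambda>h. score_hessian pol \<theta> x *v h)) (at \<theta> within UNIV)" for \<theta>
    using grad_ln_p_differentiable[OF x, of \<theta>]
    by (simp add: jacobian_works score_def[abs_def] score_hessian_def hessian_def)
  show "onorm (\<lambda>h. score_hessian pol \<theta> x *v h) \<le> M\<^sub>h" for \<theta>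
    using score_hessian_bound[OF x, of \<theta>] by (simp add: op_norm_def)
qed auto

lemma ln_p_lipschitz:
  assumes x: "x \<in> space SA"
  shows "\<bar>ln (p \<theta>' x) - ln (p \<theta> x)\<bar> \<le> M\<^sub>g * norm (\<theta>' - \<theta>)"
proof -
  have "norm (ln (p \<theta>' x) - ln (p \<theta> x)) \<le> M\<^sub>g * norm (\<theta>' - \<theta>)"
  proof (rule differentiable_bound[where S = UNIV])
    show "((\<lambda>\<theta>. ln (p \<theta> x)) has_derivative (\<lambda>h. h \<bullet> score pol \<theta> x)) (at \<theta> within UNIV)" for \<theta>
      using score_derivative[OF x] by simp
    show "onorm (\<lambda>h. h \<bullet> score pol \<theta> x) \<le> M\<^sub>g" for \<theta>
    proof (rule onorm_bound)
      show "norm (h \<bullet> score pol \<theta> x) \<le> M\<^sub>g * norm h" for h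
        using Cauchy_Schwarz_ineq2[of h "score pol \<theta> x"] mult_left_mono[OF score_bound[OF x, of \<theta>], of "norm h"]
        by (simp add: mult.commute)
    qed (use M_pos in simp)
  qed auto
  then show ?thesis by simp
qed

text \<open>The mean value inequality for the logarithm minus its linear part: on the ball of radius
  \<open>norm h\<close> the score varies by at most \<open>M\<^sub>h * norm h\<close>. This route
  gives the constant without the Taylor factor one half.\<close>

lemma ln_p_linearization:
  assumes x: "x \<in> space SA"
  shows "\<bar>ln (p (\<theta> + h) x) - ln (p \<theta> x) - h \<bullet> score pol \<theta> x\<bar> \<le> M\<^sub>h * (norm h)\<^sup>2"
proof -
  have "norm (ln (p (\<theta> + h) x) - ln (p \<theta> x) - (\<theta> + h - \<theta>) \<bullet> score pol \<theta> x) \<le> norm (\<theta> + h - \<theta>) * (M\<^sub>h * norm h)"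
  proof (rule differentiable_bound_linearization[where S = "cball \<theta> (norm h)" and f' = "\<lambda>\<theta> h. h \<bullet> score pol \<theta> x"])
    show "\<theta> + t *\<^sub>R (\<theta> + h - \<theta>) \<in> cball \<theta> (norm h)" if "t \<in> {0..1}" for t
      using that by (simp add: dist_norm mult_left_le_one_le)
    show "((\<lambda>\<theta>. ln (p \<theta> x)) has_derivative (\<lambda>h. h \<bullet> score pol \<phi> x)) (at \<phi> within cball \<theta> (norm h))" for \<phi>
      by (rule has_derivative_at_withinI[OF score_derivative[OF x]])
    show "onorm ((\<lambda>h. h \<bullet> score pol \<phi> x) - (\<lambda>h. h \<bullet> score pol \<theta> x)) \<le> M\<^sub>h * norm h" if "\<phi> \<in> cball \<theta> (norm h)" for \<phi>
    proof (rule onorm_bound)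
      fix k :: "real^'n"
      have "norm (score pol \<phi> x - score pol \<theta> x) \<le> M\<^sub>h * norm (\<phi> - \<theta>)"
        by (rule score_lipschitz[OF x])
      also have "\<dots> \<le> M\<^sub>h * norm h"
        using that M_pos by (intro mult_left_mono) (auto simp: dist_norm norm_minus_commute)
      finally have "norm k * norm (score pol \<phi> x - score pol \<theta> x) \<le> norm k * (M\<^sub>h * norm h)"
        by (intro mult_left_mono) auto
      then show "norm (((\<lambda>h. h \<bullet> score pol \<phi> x) - (\<lambda>h. h \<bullet> score pol \<theta> x)) k) \<le> M\<^sub>h * norm h * norm k"
        using Cauchy_Schwarz_ineq2[of k "score pol \<phi> x - score pol \<theta> x"]
        by (simp add: inner_diff_right mult.commute)
    qed (use M_pos in simp)
  qed auto
  then show ?thesis by (simp add: power2_eq_square mult_ac)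
qed

text \<open>Writing the new density as \<open>p \<theta> x * exp u\<close>, with \<open>u\<close>
  the increment of the logarithm, makes all errors relative to \<open>p \<theta> x\<close>, so they
  can be integrated over actions. The bound on \<open>norm h\<close> ensures
  \<open>\<bar>u\<bar> \<le> 1\<close>. Then \<open>u\<^sup>2\<close> yields
  \<open>M\<^sub>g\<^sup>2\<close>, the linearization of the logarithm yields
  \<open>M\<^sub>h\<close>, and the factor 2 comes from
  \<open>\<bar>u\<bar> + u\<^sup>2 \<le> 2 * \<bar>u\<bar>\<close>.\<close>

lemma p_perturbation:
  assumes x: "x \<in> space SA" and h: "M\<^sub>g * norm h \<le> 1"
  shows "\<bar>p (\<theta> + h) x - p \<theta> x - p \<theta> x * (h \<bullet> score pol \<theta> x)\<bar> \<le> ((M\<^sub>g\<^sup>2 + M\<^sub>h) * (norm h)\<^sup>2) * p \<theta> x"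
    and "\<bar>p (\<theta> + h) x - p \<theta> x\<bar> \<le> (2 * M\<^sub>g * norm h) * p \<theta> x"
proof -
  define u where "u = ln (p (\<theta> + h) x) - ln (p \<theta> x)"
  note pos = p_pos[OF x, of \<theta>] p_pos[OF x, of "\<theta> + h"]
  have e: "p (\<theta> + h) x = p \<theta> x * exp u"
    using pos by (simp add: u_def exp_diff)
  have u: "\<bar>u\<bar> \<le> M\<^sub>g * norm h"
    using ln_p_lipschitz[OF x, of "\<theta> + h" \<theta>] by (simp add: u_def)
  have u2: "u\<^sup>2 \<le> M\<^sub>g\<^sup>2 * (norm h)\<^sup>2"
    using power_mono[OF u, of 2] by (simp add: power_mult_distrib)
  have ex: "\<bar>exp u - 1 - u\<bar> \<le> u\<^sup>2"
    using u h by (intro exp_quadratic_remainder) simp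
  have "\<bar>u - h \<bullet> score pol \<theta> x\<bar> \<le> M\<^sub>h * (norm h)\<^sup>2"
    using ln_p_linearization[OF x, of \<theta> h] by (simp add: u_def)
  with ex u2 have "\<bar>exp u - 1 - h \<bullet> score pol \<theta> x\<bar> \<le> (M\<^sub>g\<^sup>2 + M\<^sub>h) * (norm h)\<^sup>2"
    by (simp add: distrib_right)
  from mult_left_mono[OF this, of "p \<theta> x"] pos
  have "p \<theta> x * \<bar>exp u - 1 - h \<bullet> score pol \<theta> x\<bar> \<le> ((M\<^sub>g\<^sup>2 + M\<^sub>h) * (norm h)\<^sup>2) * p \<theta> x"
    by (simp add: mult.commute)
  moreover have "\<bar>p (\<theta> + h) x - p \<theta> x - p \<theta> x * (h \<bullet> score pol \<theta> x)\<bar> = p \<theta> x * \<bar>exp u - 1 - h \<bullet> score pol \<theta> x\<bar>"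
  proof -
    have "p (\<theta> + h) x - p \<theta> x - p \<theta> x * (h \<bullet> score pol \<theta> x) = p \<theta> x * (exp u - 1 - h \<bullet> score pol \<theta> x)"
      by (simp add: e algebra_simps)
    then show ?thesis using pos(1) by (simp add: abs_mult)
  qed
  ultimately show "\<bar>p (\<theta> + h) x - p \<theta> x - p \<theta> x * (h \<bullet> score pol \<theta> x)\<bar> \<le> ((M\<^sub>g\<^sup>2 + M\<^sub>h) * (norm h)\<^sup>2) * p \<theta> x"
    by simp
  have "u\<^sup>2 = \<bar>u\<bar> * \<bar>u\<bar>" by (simp add: power2_eq_square)
  also have "\<dots> \<le> \<bar>u\<bar> * 1" using u h by (intro mult_left_mono) auto
  finally have "\<bar>exp u - 1\<bar> \<le> 2 * M\<^sub>g * norm h"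
    using ex u by linarith
  from mult_left_mono[OF this, of "p \<theta> x"] pos
  have "p \<theta> x * \<bar>exp u - 1\<bar> \<le> (2 * M\<^sub>g * norm h) * p \<theta> x"
    by (simp add: mult.commute)
  moreover have "\<bar>p (\<theta> + h) x - p \<theta> x\<bar> = p \<theta> x * \<bar>exp u - 1\<bar>"
  proof -
    have "p (\<theta> + h) x - p \<theta> x = p \<theta> x * (exp u - 1)"
      by (simp add: e algebra_simps)
    then show ?thesis using pos(1) by (simp add: abs_mult)
  qed
  ultimately show "\<bar>p (\<theta> + h) x - p \<theta> x\<bar> \<le> (2 * M\<^sub>g * norm h) * p \<theta> x"
    by simp
qed

end

section \<open>Differentiability of the expected return\<close>

context mdp
begin

text \<open>Conditional expectation given the state: at each time the action is distributed by
  \<pi>, so \<open>f\<close> may be replaced by its action average, a function of the state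
  alone.\<close>

lemma disc_value_average:
  assumes \<pi>: "\<pi> \<in> policies M" and f: "f \<in> borel_measurable SA" "\<And>x. x \<in> space SA \<Longrightarrow> \<bar>f x\<bar> \<le> B"
  shows "disc_value M \<pi> (with_action M \<pi> (init_dist M)) f
    = disc_value M \<pi> (with_action M \<pi> (init_dist M)) (\<lambda>x. \<integral>a. f (fst x, a) \<partial>\<pi> (fst x))"
proof -
  have "integral\<^sup>L (chain_law M \<pi> (with_action M \<pi> (init_dist M)) t) f
    = (\<integral>x. (\<integral>a. f (fst x, a) \<partial>\<pi> (fst x)) \<partial>chain_law M \<pi> (with_action M \<pi> (init_dist M)) t)" for t
    unfolding chain_law_state_law[OF \<pi>]
    using integral_with_action[OF \<pi> state_law_prob[OF \<pi>] f, of t]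
      integral_with_action_fst[OF \<pi> state_law_prob[OF \<pi>] policy_integral_measurable[OF \<pi> f], of t]
    by simp
  then show ?thesis by (simp add: disc_value_def)
qed

lemma disc_value_diff_bound:
  fixes f g :: "'s \<times> 'a \<Rightarrow> real"
  assumes \<pi>: "\<pi> \<in> policies M" "\<mu> \<in> space (prob_algebra SA)"
    and f: "f \<in> borel_measurable SA" "\<And>x. x \<in> space SA \<Longrightarrow> \<bar>f x\<bar> \<le> B"
    and g: "g \<in> borel_measurable SA" "\<And>x. x \<in> space SA \<Longrightarrow> \<bar>g x\<bar> \<le> C"
    and fg: "\<And>x. x \<in> space SA \<Longrightarrow> \<bar>f x - g x\<bar> \<le> D"
  shows "\<bar>disc_value M \<pi> \<mu> f - disc_value M \<pi> \<mu> g\<bar> \<le> D / (1 - discount M)"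
proof -
  have fg': "(\<lambda>x. f x - g x) \<in> borel_measurable SA" using f(1) g(1) by measurable
  have "disc_value M \<pi> \<mu> (\<lambda>x. (f x - g x) + g x) = disc_value M \<pi> \<mu> (\<lambda>x. f x - g x) + disc_value M \<pi> \<mu> g"
    by (rule disc_value_add[OF \<pi> fg' fg g])
  then have "disc_value M \<pi> \<mu> f - disc_value M \<pi> \<mu> g = disc_value M \<pi> \<mu> (\<lambda>x. f x - g x)"
    by simp
  also have "\<bar>\<dots>\<bar> \<le> D / (1 - discount M)"
    by (rule disc_value_bound(2)[OF \<pi> fg' fg])
  finally show ?thesis .
qed

end

section \<open>Expansion of the return in the parameter\<close>

context smooth_mdp
begin

abbreviation "\<kappa> \<theta> \<equiv> policy_of M pol \<theta>"
abbreviation "\<mu>\<^sub>0 \<theta> \<equiv> with_action M (policy_of M pol \<theta>) (init_dist M)"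

lemma policy_of_policies: "\<kappa> \<theta> \<in> policies M"
  unfolding policies_def policy_of_def[abs_def]
  using pol_measurable[of \<theta>] pol_prob sigma_finite_actions
  by (intro measurable_density_prob_algebra) (auto simp: split_beta')

lemma \<mu>\<^sub>0_prob: "\<mu>\<^sub>0 \<theta> \<in> space (prob_algebra SA)"
  by (rule with_action_prob[OF policy_of_policies init_dist_prob])

lemma pol_measurable_action: "s \<in> space S \<Longrightarrow> pol \<theta> s \<in> borel_measurable (action_space M)"
  using measurable_compose[OF measurable_Pair1' pol_measurable[of \<theta>], of s] by simp

lemma policy_of_integral:
  fixes k :: "'a \<Rightarrow> real"
  assumes s: "s \<in> space S" and k: "k \<in> borel_measurable (action_space M)"
  shows "integral\<^sup>L (\<kappa> \<theta> s) k = (\<integral>a. pol \<theta> s a * k a \<partial>action_space M)"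
  unfolding policy_of_def using k pol_measurable_action[OF s] pol_nonneg[OF s]
  by (subst integral_density) auto

text \<open>The reference measure on actions may be infinite, so a bound by a constant would not
  give integrability; a multiple of a policy density does, and it integrates to the factor
  \<open>c\<close>.\<close>

lemma integral_dominated_by_density:
  fixes k :: "'a \<Rightarrow> real"
  assumes s: "s \<in> space S" and k: "k \<in> borel_measurable (action_space M)"
    and le: "\<And>a. a \<in> space (action_space M) \<Longrightarrow> \<bar>k a\<bar> \<le> c * pol \<theta> s a"
  shows "integrable (action_space M) k" and "\<bar>integral\<^sup>L (action_space M) k\<bar> \<le> c"
proof -
  have one: "integrable (action_space M) (pol \<theta> s) \<and> integral\<^sup>L (action_space M) (pol \<theta> s) = 1"
    using pol_prob[OF s, of \<theta>] pol_nonneg[OF s] pol_measurable_action[OF s]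
    by (subst nn_integral_eq_integrable[symmetric]) auto
  then have i: "integrable (action_space M) (\<lambda>a. c * pol \<theta> s a)"
    by simp
  show k': "integrable (action_space M) k"
  proof (rule Bochner_Integration.integrable_bound[OF i k])
    show "AE a in action_space M. norm (k a) \<le> norm (c * pol \<theta> s a)"
    proof (rule AE_I2)
      fix a assume "a \<in> space (action_space M)"
      from le[OF this] show "norm (k a) \<le> norm (c * pol \<theta> s a)"
        unfolding real_norm_def by linarith
    qed
  qed
  have "\<bar>integral\<^sup>L (action_space M) k\<bar> \<le> (\<integral>a. \<bar>k a\<bar> \<partial>action_space M)"
    by simp
  also have "\<dots> \<le> (\<integral>a. c * pol \<theta> s a \<partial>action_space M)"
    using k' i le by (intro integral_mono) auto
  finally show "\<bar>integral\<^sup>L (action_space M) k\<bar> \<le> c"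
    using one by simp
qed

text \<open>Both policies are rewritten as densities against the common reference measure, where the
  relative pointwise errors of \<open>p_perturbation\<close> can be integrated.\<close>

lemma policy_integral_difference:
  fixes q :: "'s \<times> 'a \<Rightarrow> real"
  assumes s: "s \<in> space S" and q: "q \<in> borel_measurable SA"
    and B: "\<And>x. x \<in> space SA \<Longrightarrow> \<bar>q x\<bar> \<le> B" and h: "M\<^sub>g * norm h \<le> 1"
  shows "\<bar>(\<integral>a. q (s, a) \<partial>\<kappa> (\<theta> + h) s) - (\<integral>a. q (s, a) \<partial>\<kappa> \<theta> s)\<bar> \<le> 2 * M\<^sub>g * norm h * B"
    and "\<bar>(\<integral>a. q (s, a) \<partial>\<kappa> (\<theta> + h) s) - (\<integral>a. q (s, a) \<partial>\<kappa> \<theta> s)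
        - (\<integral>a. q (s, a) * (h \<bullet> score pol \<theta> (s, a)) \<partial>\<kappa> \<theta> s)\<bar> \<le> (M\<^sub>g\<^sup>2 + M\<^sub>h) * (norm h)\<^sup>2 * B"
proof -
  let ?A = "action_space M"
  have sa: "(s, a) \<in> space SA" if "a \<in> space ?A" for a
    using s that by (simp add: space_pair_measure)
  have qm[measurable]: "(\<lambda>a. q (s, a)) \<in> borel_measurable ?A"
    using measurable_compose[OF measurable_Pair1'[OF s] q] by simp
  have pm[measurable]: "(\<lambda>a. pol \<theta> s a) \<in> borel_measurable ?A" for \<theta>
    using pol_measurable_action[OF s] .
  have sm[measurable]: "(\<lambda>a. score pol \<theta> (s, a)) \<in> borel_measurable ?A"
    using measurable_compose[OF measurable_Pair1'[OF s] score_measurable] by simp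
  have qB: "\<bar>q (s, a)\<bar> \<le> B" if "a \<in> space ?A" for a
    using B[OF sa[OF that]] .
  have i: "integrable ?A (\<lambda>a. pol \<theta> s a * q (s, a))" for \<theta>
  proof (rule integral_dominated_by_density(1)[OF s])
    show "\<bar>pol \<theta> s a * q (s, a)\<bar> \<le> B * pol \<theta> s a" if "a \<in> space ?A" for a
      using mult_left_mono[OF qB[OF that] pol_nonneg[OF s that, of \<theta>]] pol_nonneg[OF s that, of \<theta>]
      by (simp add: abs_mult mult.commute)
  qed measurable
  let ?h = "\<lambda>a. h \<bullet> score pol \<theta> (s, a)"
  have hB: "\<bar>?h a\<bar> \<le> norm h * M\<^sub>g" if "a \<in> space ?A" for a
    using Cauchy_Schwarz_ineq2[of h "score pol \<theta> (s, a)"] mult_left_mono[OF score_bound[OF sa[OF that], of \<theta>], of "norm h"]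
    by simp
  have i2: "integrable ?A (\<lambda>a. pol \<theta> s a * (q (s, a) * ?h a))"
  proof (rule integral_dominated_by_density(1)[OF s])
    show "\<bar>pol \<theta> s a * (q (s, a) * ?h a)\<bar> \<le> (B * (norm h * M\<^sub>g)) * pol \<theta> s a" if a: "a \<in> space ?A" for a
    proof -
      have "\<bar>q (s, a)\<bar> * \<bar>?h a\<bar> \<le> B * (norm h * M\<^sub>g)"
        using qB[OF a] hB[OF a] by (intro mult_mono) auto
      from mult_left_mono[OF this pol_nonneg[OF s a, of \<theta>]] show ?thesis
        using pol_nonneg[OF s a, of \<theta>] by (simp add: abs_mult mult.commute)
    qed
  qed measurable
  have e1: "(\<integral>a. q (s, a) \<partial>\<kappa> \<theta> s) = (\<integral>a. pol \<theta> s a * q (s, a) \<partial>?A)" for \<theta>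
    by (rule policy_of_integral[OF s qm])
  have e2: "(\<integral>a. q (s, a) * ?h a \<partial>\<kappa> \<theta> s) = (\<integral>a. pol \<theta> s a * (q (s, a) * ?h a) \<partial>?A)"
    by (rule policy_of_integral[OF s]) measurable
  have "\<bar>(\<integral>a. pol (\<theta> + h) s a * q (s, a) - pol \<theta> s a * q (s, a) \<partial>?A)\<bar> \<le> 2 * M\<^sub>g * norm h * B"
  proof (rule integral_dominated_by_density(2)[OF s])
    fix a assume a: "a \<in> space ?A"
    have "\<bar>q (s, a)\<bar> * \<bar>pol (\<theta> + h) s a - pol \<theta> s a\<bar> \<le> B * (2 * M\<^sub>g * norm h * pol \<theta> s a)"
      using p_perturbation(2)[OF sa[OF a] h, of \<theta>] qB[OF a] by (intro mult_mono) auto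
    moreover have "pol (\<theta> + h) s a * q (s, a) - pol \<theta> s a * q (s, a) = q (s, a) * (pol (\<theta> + h) s a - pol \<theta> s a)"
      by (simp add: algebra_simps)
    ultimately show "\<bar>pol (\<theta> + h) s a * q (s, a) - pol \<theta> s a * q (s, a)\<bar> \<le> (2 * M\<^sub>g * norm h * B) * pol \<theta> s a"
      by (simp add: abs_mult mult_ac)
  qed measurable
  then show "\<bar>(\<integral>a. q (s, a) \<partial>\<kappa> (\<theta> + h) s) - (\<integral>a. q (s, a) \<partial>\<kappa> \<theta> s)\<bar> \<le> 2 * M\<^sub>g * norm h * B"
    unfolding e1 using i by simp
  have "\<bar>(\<integral>a. pol (\<theta> + h) s a * q (s, a) - pol \<theta> s a * q (s, a) - pol \<theta> s a * (q (s, a) * ?h a) \<partial>?A)\<bar>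
      \<le> (M\<^sub>g\<^sup>2 + M\<^sub>h) * (norm h)\<^sup>2 * B"
  proof (rule integral_dominated_by_density(2)[OF s])
    fix a assume a: "a \<in> space ?A"
    have "\<bar>q (s, a)\<bar> * \<bar>pol (\<theta> + h) s a - pol \<theta> s a - pol \<theta> s a * ?h a\<bar>
        \<le> B * (((M\<^sub>g\<^sup>2 + M\<^sub>h) * (norm h)\<^sup>2) * pol \<theta> s a)"
      using p_perturbation(1)[OF sa[OF a] h, of \<theta>] qB[OF a] by (intro mult_mono) auto
    moreover have "pol (\<theta> + h) s a * q (s, a) - pol \<theta> s a * q (s, a) - pol \<theta> s a * (q (s, a) * ?h a)
        = q (s, a) * (pol (\<theta> + h) s a - pol \<theta> s a - pol \<theta> s a * ?h a)"
      by (simp add: algebra_simps)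
    ultimately show "\<bar>pol (\<theta> + h) s a * q (s, a) - pol \<theta> s a * q (s, a) - pol \<theta> s a * (q (s, a) * ?h a)\<bar>
        \<le> ((M\<^sub>g\<^sup>2 + M\<^sub>h) * (norm h)\<^sup>2 * B) * pol \<theta> s a"
      by (simp add: abs_mult mult_ac)
  qed measurable
  then show "\<bar>(\<integral>a. q (s, a) \<partial>\<kappa> (\<theta> + h) s) - (\<integral>a. q (s, a) \<partial>\<kappa> \<theta> s)
        - (\<integral>a. q (s, a) * ?h a \<partial>\<kappa> \<theta> s)\<bar> \<le> (M\<^sub>g\<^sup>2 + M\<^sub>h) * (norm h)\<^sup>2 * B"
    unfolding e1 e2 using i i2 by simp
qed

definition J_of :: "('s \<times> 'a \<Rightarrow> real) \<Rightarrow> real^'n \<Rightarrow> real" where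
  "J_of f \<theta> = disc_value M (\<kappa> \<theta>) (\<mu>\<^sub>0 \<theta>) f"

lemma J_par_eq: "J_par M pol = J_of (reward M)"
  by (rule ext) (simp add: J_par_def J_of_def expected_return_eq policy_of_policies)

text \<open>The value function of \<theta> is the action average of \<open>disc_Q\<close> under
  \<theta>. Averaging the advantage over the actions of the new policy therefore leaves two averages
  of the same function, the form that \<open>policy_integral_difference\<close> estimates.\<close>

lemma J_of_difference:
  assumes f: "f \<in> borel_measurable SA" "\<And>x. x \<in> space SA \<Longrightarrow> \<bar>f x\<bar> \<le> B"
  shows "J_of f \<theta>' - J_of f \<theta> = disc_value M (\<kappa> \<theta>') (\<mu>\<^sub>0 \<theta>')
    (\<lambda>x. (\<integral>a. disc_Q M (\<kappa> \<theta>) f (fst x, a) \<partial>\<kappa> \<theta>' (fst x)) - (\<integral>a. disc_Q M (\<kappa> \<theta>) f (fst x, a) \<partial>\<kappa> \<theta> (fst x)))"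
proof -
  let ?Q = "disc_Q M (\<kappa> \<theta>) f" and ?V = "disc_V M (\<kappa> \<theta>) f" and ?C = "B / (1 - discount M)"
  note \<pi> = policy_of_policies
  note Q = disc_Q_measurable[OF \<pi> f(1), of \<theta>]
  have QB: "\<bar>?Q x\<bar> \<le> B / (1 - discount M)" if "x \<in> space SA" for x
    by (rule disc_Q_bound[OF \<pi> f that])
  have V[measurable]: "?V \<in> borel_measurable S"
    by (rule disc_V_measurable[OF \<pi> f])
  have VB: "\<bar>?V s\<bar> \<le> ?C" if "s \<in> space S" for s
    by (rule disc_V_bound[OF \<pi> f that])
  have F: "(\<lambda>x. ?Q x - ?V (fst x)) \<in> borel_measurable SA"
    using Q by measurable
  have FB: "\<bar>?Q x - ?V (fst x)\<bar> \<le> ?C + ?C" if x: "x \<in> space SA" for x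
  proof -
    have "fst x \<in> space S" using x by (auto simp: space_pair_measure)
    from QB[OF x] VB[OF this] show ?thesis by linarith
  qed
  have avg: "(\<integral>a. ?Q (s, a) - ?V (fst (s, a)) \<partial>\<kappa> \<theta>' s) = (\<integral>a. ?Q (s, a) \<partial>\<kappa> \<theta>' s) - ?V s"
    if s: "s \<in> space S" for s
  proof -
    note P = policy_prob[OF \<pi> s, of \<theta>']
    interpret P: prob_space "\<kappa> \<theta>' s" using prob_algebraD(3)[OF P] .
    have "integrable (\<kappa> \<theta>' s) (\<lambda>a. ?Q (s, a))"
    proof (rule integrable_bounded_prob[OF P])
      show "(\<lambda>a. ?Q (s, a)) \<in> borel_measurable (action_space M)"
        using measurable_compose[OF measurable_Pair1'[OF s] Q] by simp
      show "norm (?Q (s, a)) \<le> ?C" if "a \<in> space (action_space M)" for a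
        using QB[of "(s, a)"] s that by (simp add: space_pair_measure)
    qed
    then show ?thesis by (simp add: P.prob_space)
  qed
  have "J_of f \<theta>' - J_of f \<theta> = disc_value M (\<kappa> \<theta>') (\<mu>\<^sub>0 \<theta>') (\<lambda>x. ?Q x - ?V (fst x))"
    using performance_difference[OF \<pi> \<pi> init_dist_prob f] by (simp add: J_of_def)
  also have "\<dots> = disc_value M (\<kappa> \<theta>') (\<mu>\<^sub>0 \<theta>') (\<lambda>x. \<integral>a. ?Q (fst x, a) - ?V (fst (fst x, a)) \<partial>\<kappa> \<theta>' (fst x))"
    by (rule disc_value_average[OF \<pi> F FB])
  also have "\<dots> = disc_value M (\<kappa> \<theta>') (\<mu>\<^sub>0 \<theta>') (\<lambda>x. (\<integral>a. ?Q (fst x, a) \<partial>\<kappa> \<theta>' (fst x)) - ?V (fst x))"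
    by (rule disc_value_cong[OF \<pi> \<mu>\<^sub>0_prob], rule avg) (auto simp: space_pair_measure)
  finally show ?thesis by (simp add: disc_V_def)
qed

lemma policy_integral_fst_measurable:
  fixes q :: "'s \<times> 'a \<Rightarrow> real"
  assumes "q \<in> borel_measurable SA" "\<And>x. x \<in> space SA \<Longrightarrow> \<bar>q x\<bar> \<le> B"
  shows "(\<lambda>x. \<integral>a. q (fst x, a) \<partial>\<kappa> \<theta> (fst x)) \<in> borel_measurable SA"
  by (rule measurable_compose[OF measurable_fst policy_integral_measurable[OF policy_of_policies assms]])

text \<open>One factor \<open>1 - discount M\<close> in the denominator comes from the bound on
  \<open>disc_Q\<close>, the other from the sum over time.\<close>

lemma J_of_lipschitz:
  assumes f: "f \<in> borel_measurable SA" "\<And>x. x \<in> space SA \<Longrightarrow> \<bar>f x\<bar> \<le> B" and h: "M\<^sub>g * norm h \<le> 1"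
  shows "\<bar>J_of f (\<theta> + h) - J_of f \<theta>\<bar> \<le> 2 * M\<^sub>g * norm h * B / (1 - discount M)\<^sup>2"
proof -
  let ?Q = "disc_Q M (\<kappa> \<theta>) f"
  note \<pi> = policy_of_policies
  note Q = disc_Q_measurable[OF \<pi> f(1), of \<theta>]
  have QB: "\<bar>?Q x\<bar> \<le> B / (1 - discount M)" if "x \<in> space SA" for x
    by (rule disc_Q_bound[OF \<pi> f that])
  have m: "(\<lambda>x. \<integral>a. ?Q (fst x, a) \<partial>\<kappa> \<theta>' (fst x)) \<in> borel_measurable SA" for \<theta>'
    by (rule policy_integral_fst_measurable[OF Q QB])
  note diff = J_of_difference[where \<theta>' = "\<theta> + h" and \<theta> = \<theta>, OF f, simplified]
  have "\<bar>J_of f (\<theta> + h) - J_of f \<theta>\<bar> \<le> (2 * M\<^sub>g * norm h * (B / (1 - discount M))) / (1 - discount M)"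
    unfolding diff
  proof (rule disc_value_bound(2)[OF \<pi> \<mu>\<^sub>0_prob])
    fix x assume "x \<in> space SA"
    then have "fst x \<in> space S" by (auto simp: space_pair_measure)
    from policy_integral_difference(1)[OF this Q QB h]
    show "\<bar>(\<integral>a. ?Q (fst x, a) \<partial>\<kappa> (\<theta> + h) (fst x)) - (\<integral>a. ?Q (fst x, a) \<partial>\<kappa> \<theta> (fst x))\<bar>
      \<le> 2 * M\<^sub>g * norm h * (B / (1 - discount M))" .
  qed (use m in measurable)
  then show ?thesis by (simp add: power2_eq_square)
qed

lemma J_of_differentiable:
  assumes f: "f \<in> borel_measurable SA" "\<And>x. x \<in> space SA \<Longrightarrow> \<bar>f x\<bar> \<le> B"
  shows "J_of f differentiable (at \<theta>)"
proof -
  let ?Q = "disc_Q M (\<kappa> \<theta>) f" and ?C = "B / (1 - discount M)"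
  note \<pi> = policy_of_policies
  note Q[measurable] = disc_Q_measurable[OF \<pi> f(1), of \<theta>]
  have QB: "\<bar>?Q x\<bar> \<le> ?C" if "x \<in> space SA" for x
    by (rule disc_Q_bound[OF \<pi> f that])
  note [measurable] = score_measurable
  \<comment> \<open>The linear term of the policy expansion at a single pair; \<theta> stays fixed
    in it, so it can serve as a reward.\<close>
  define F where "F h x = ?Q x * (h \<bullet> score pol \<theta> x)" for h x
  have F[measurable]: "F h \<in> borel_measurable SA" for h
    unfolding F_def[abs_def] by measurable
  have FB: "\<bar>F h x\<bar> \<le> ?C * M\<^sub>g * norm h" if x: "x \<in> space SA" for h x
  proof -
    have "\<bar>h \<bullet> score pol \<theta> x\<bar> \<le> norm h * M\<^sub>g"
      using Cauchy_Schwarz_ineq2[of h "score pol \<theta> x"] mult_left_mono[OF score_bound[OF x, of \<theta>], of "norm h"]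
      by simp
    then have "\<bar>?Q x\<bar> * \<bar>h \<bullet> score pol \<theta> x\<bar> \<le> ?C * (norm h * M\<^sub>g)"
      using QB[OF x] by (intro mult_mono) auto
    then show ?thesis by (simp add: F_def abs_mult mult_ac)
  qed
  \<comment> \<open>The policy gradient formula, with the sum over time hidden in
    \<open>J_of\<close>.\<close>
  define D where "D h = J_of (F h) \<theta>" for h
  have lin: "linear D"
  proof (rule linearI)
    have F_add: "F (h + k) = (\<lambda>x. F h x + F k x)" for h k
      by (rule ext) (simp add: F_def inner_add_left distrib_left)
    show "D (h + k) = D h + D k" for h k
      unfolding D_def J_of_def F_add by (rule disc_value_add[OF \<pi> \<mu>\<^sub>0_prob F FB F FB])
    have F_scale: "F (c *\<^sub>R h) = (\<lambda>x. c * F h x)" for c h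
      by (rule ext) (simp add: F_def mult_ac)
    show "D (c *\<^sub>R h) = c *\<^sub>R D h" for c h
      unfolding D_def J_of_def F_scale real_scaleR_def by (rule disc_value_cmult[OF \<pi> \<mu>\<^sub>0_prob F FB])
  qed
  \<comment> \<open>The first summand is the second-order error of the action averages, the second
    the cost of exchanging the state distribution: \<open>J_of_lipschitz\<close> for a reward of
    size \<open>?C * M\<^sub>g * norm h\<close>.\<close>
  define K where "K = (M\<^sub>g\<^sup>2 + M\<^sub>h) * ?C / (1 - discount M) + 2 * M\<^sub>g * (?C * M\<^sub>g) / (1 - discount M)\<^sup>2"
  have quad: "\<bar>J_of f (\<theta> + h) - J_of f \<theta> - D h\<bar> \<le> K * (norm h)\<^sup>2" if h: "M\<^sub>g * norm h \<le> 1" for h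
  proof -
    let ?I = "\<lambda>q \<theta> x. \<integral>a. q (fst x, a) \<partial>\<kappa> \<theta> (fst x)"
    have m: "?I ?Q \<theta>' \<in> borel_measurable SA" for \<theta>'
      by (rule policy_integral_fst_measurable[OF Q QB])
    have mF: "?I (F h) \<theta> \<in> borel_measurable SA"
      by (rule policy_integral_fst_measurable[OF F FB])
    have mFB: "\<bar>?I (F h) \<theta> x\<bar> \<le> ?C * M\<^sub>g * norm h" if "x \<in> space SA" for x
      using that by (intro policy_integral_bounded[OF \<pi> F FB]) (auto simp: space_pair_measure)
    have xS: "x \<in> space SA \<Longrightarrow> fst x \<in> space S" for x by (auto simp: space_pair_measure)
    have avg: "disc_value M (\<kappa> (\<theta> + h)) (\<mu>\<^sub>0 (\<theta> + h)) (?I (F h) \<theta>) = J_of (?I (F h) \<theta>) (\<theta> + h)"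
      by (simp add: J_of_def)
    \<comment> \<open>Under \<open>\<theta> + h\<close> the chain would average \<open>F h\<close>
      over the wrong actions. The average under \<theta> depends on the state only and has the same
      value at \<theta>, so it can be compared between the two parameters.\<close>
    have D: "D h = J_of (?I (F h) \<theta>) \<theta>"
      unfolding D_def J_of_def by (rule disc_value_average[OF \<pi> F FB])
    have "\<bar>disc_value M (\<kappa> (\<theta> + h)) (\<mu>\<^sub>0 (\<theta> + h)) (\<lambda>x. ?I ?Q (\<theta> + h) x - ?I ?Q \<theta> x)
        - disc_value M (\<kappa> (\<theta> + h)) (\<mu>\<^sub>0 (\<theta> + h)) (?I (F h) \<theta>)\<bar>
        \<le> ((M\<^sub>g\<^sup>2 + M\<^sub>h) * (norm h)\<^sup>2 * ?C) / (1 - discount M)"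
    proof (rule disc_value_diff_bound[OF \<pi> \<mu>\<^sub>0_prob _ _ mF mFB])
      show "(\<lambda>x. ?I ?Q (\<theta> + h) x - ?I ?Q \<theta> x) \<in> borel_measurable SA"
        using m by measurable
      show "\<bar>?I ?Q (\<theta> + h) x - ?I ?Q \<theta> x\<bar> \<le> 2 * M\<^sub>g * norm h * ?C" if "x \<in> space SA" for x
        by (rule policy_integral_difference(1)[OF xS[OF that] Q QB h])
      show "\<bar>?I ?Q (\<theta> + h) x - ?I ?Q \<theta> x - ?I (F h) \<theta> x\<bar> \<le> (M\<^sub>g\<^sup>2 + M\<^sub>h) * (norm h)\<^sup>2 * ?C" if "x \<in> space SA" for x
        using policy_integral_difference(2)[OF xS[OF that] Q QB h] by (simp add: F_def)
    qed
    moreover have "\<bar>J_of (?I (F h) \<theta>) (\<theta> + h) - J_of (?I (F h) \<theta>) \<theta>\<bar>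
        \<le> 2 * M\<^sub>g * norm h * (?C * M\<^sub>g * norm h) / (1 - discount M)\<^sup>2"
      by (rule J_of_lipschitz[OF mF mFB h])
    ultimately have "\<bar>J_of f (\<theta> + h) - J_of f \<theta> - D h\<bar>
      \<le> ((M\<^sub>g\<^sup>2 + M\<^sub>h) * (norm h)\<^sup>2 * ?C) / (1 - discount M) + 2 * M\<^sub>g * norm h * (?C * M\<^sub>g * norm h) / (1 - discount M)\<^sup>2"
      using J_of_difference[where \<theta>' = "\<theta> + h" and \<theta> = \<theta>, OF f] D avg by linarith
    also have "\<dots> = K * (norm h)\<^sup>2"
      by (simp add: K_def power2_eq_square algebra_simps add_divide_distrib)
    finally show ?thesis .
  qed
  have "(J_of f has_derivative D) (at \<theta>)"
    unfolding has_derivative_at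
  proof (intro conjI)
    show "bounded_linear D"
      using lin by (simp add: linear_conv_bounded_linear)
    have "((\<lambda>h :: real^'n. norm h) \<longlongrightarrow> norm (0 :: real^'n)) (at 0)"
      by (rule tendsto_norm[OF tendsto_ident_at])
    from tendsto_mult_left[OF this, of K]
    have t: "((\<lambda>h :: real^'n. K * norm h) \<longlongrightarrow> 0) (at 0)"
      by simp
    have "eventually (\<lambda>h :: real^'n. norm h < 1 / M\<^sub>g) (at 0)"
      using M_pos by (auto simp: eventually_at intro!: exI[of _ "1 / M\<^sub>g"])
    \<comment> \<open>The punctured ball contributes \<open>0 < norm h\<close>, which is needed to
      divide.\<close>
    then have "eventually (\<lambda>h. norm (norm (J_of f (\<theta> + h) - J_of f \<theta> - D h) / norm h) \<le> K * norm h) (at 0)"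
      using eventually_at_ball'[of 1 "0 :: real^'n" UNIV, simplified]
    proof eventually_elim
      case (elim h)
      then have "M\<^sub>g * norm h \<le> 1" "0 < norm h"
        using M_pos by (auto simp: field_simps)
      with quad[of h] show ?case
        by (simp add: divide_le_eq power2_eq_square mult_ac)
    qed
    then show "(\<lambda>h. norm (J_of f (\<theta> + h) - J_of f \<theta> - D h) / norm h) \<midarrow>0\<rightarrow> 0"
      by (rule Lim_null_comparison[OF _ t])
  qed
  then show ?thesis by (auto simp: differentiable_def)
qed

lemma reward_abs: "x \<in> space SA \<Longrightarrow> \<bar>reward M x\<bar> \<le> r_max"
  using reward_bounded[of x] by auto

lemma J_par_differentiable: "J_par M pol differentiable (at \<theta>)"
  unfolding J_par_eq by (rule J_of_differentiable[OF reward_measurable reward_abs])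

lemma J_par_bounded: "\<bar>J_par M pol \<theta>\<bar> \<le> r_max / (1 - discount M)"
  unfolding J_par_eq J_of_def
  by (rule disc_value_bound(2)[OF policy_of_policies \<mu>\<^sub>0_prob reward_measurable reward_abs])

end

section \<open>Gradient domination\<close>

lemma mat_mult_vec: "mat k *v (x :: real^'n) = k *\<^sub>R x"
  by (simp add: vec_eq_iff matrix_vector_mult_def mat_def if_distrib[of "\<lambda>u. u * _"] cong: if_cong)

text \<open>The lower bound makes \<open>F\<close> injective, hence invertible, and the Penrose
  equations then have the inverse as their only solution. Pairing \<open>F *v w = g\<close> with
  \<open>w\<close> gives \<open>\<mu> * (norm w)\<^sup>2 \<le> w \<bullet> g\<close>, and
  Cauchy-Schwarz finishes.\<close>

lemma pseudo_inverse_norm_bound: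
  fixes F :: "real^'n^'n"
  assumes \<mu>: "0 < \<mu>" and F: "loewner_le (mat \<mu>) F"
  shows "norm (pseudo_inverse F *v g) \<le> norm g / \<mu>"
proof -
  have pos: "\<mu> * (x \<bullet> x) \<le> x \<bullet> (F *v x)" for x
    using F by (simp add: loewner_le_def psd_def matrix_vector_mult_diff_rdistrib mat_mult_vec inner_diff_right)
  have "x = 0" if "F *v x = 0" for x
  proof -
    have "\<mu> * (x \<bullet> x) \<le> 0" using pos[of x] that by simp
    then have "x \<bullet> x \<le> 0" using \<mu> by (simp add: mult_le_0_iff)
    with inner_ge_zero[of x] have "x \<bullet> x = 0" by linarith
    then show ?thesis by simp
  qed
  then obtain B where BF: "B ** F = mat 1"
    using matrix_left_invertible_ker[of F] by blast
  then have FB: "F ** B = mat 1"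
    by (simp add: matrix_left_right_inverse)
  have G: "pseudo_inverse F = B"
    unfolding pseudo_inverse_def
  proof (rule the_equality)
    show "F ** B ** F = F \<and> B ** F ** B = B \<and> transpose (F ** B) = F ** B \<and> transpose (B ** F) = B ** F"
      by (simp add: BF FB transpose_mat)
    \<comment> \<open>Multiplying \<open>F ** G ** F = F\<close> by the inverse on both sides leaves
      \<open>G = B\<close>.\<close>
    fix G assume "F ** G ** F = F \<and> G ** F ** G = G \<and> transpose (F ** G) = F ** G \<and> transpose (G ** F) = G ** F"
    then have "B ** (F ** G ** F) ** B = B ** F ** B" by simp
    moreover have "B ** (F ** G ** F) ** B = (B ** F) ** G ** (F ** B)"
      by (simp add: matrix_mul_assoc)
    ultimately show "G = B" by (simp add: BF FB)
  qed
  define w where "w = B *v g"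
  have "F *v w = g"
    by (simp add: w_def matrix_vector_mul_assoc FB)
  then have "\<mu> * (norm w)\<^sup>2 \<le> w \<bullet> g"
    using pos[of w] by (simp add: power2_norm_eq_inner)
  also have "\<dots> \<le> norm w * norm g"
    by (rule norm_cauchy_schwarz)
  finally have "norm w * (\<mu> * norm w) \<le> norm w * norm g"
    by (simp add: power2_eq_square mult_ac)
  then have "\<mu> * norm w \<le> norm g"
    by (cases "norm w = 0") (auto simp: mult_le_cancel_left)
  then show ?thesis
    using \<mu> by (simp add: G w_def pos_le_divide_eq mult.commute)
qed

text \<open>Points of arbitrarily small gradient below the level of \<open>\<theta>\<^sub>1\<close> are found by minimising
  \<open>J \<theta> + \<delta> * (norm (\<theta> - \<theta>\<^sub>1))\<^sup>2\<close> for small \<open>\<delta>\<close>.\<close>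

lemma gradient_domination_bounded:
  fixes J :: "real^'n \<Rightarrow> real"
  assumes d: "\<And>\<theta>. J differentiable (at \<theta>)" and C: "\<And>\<theta>. \<bar>J \<theta>\<bar> \<le> C" and K: "0 \<le> K"
    and dom: "\<And>\<theta>. a - J \<theta> \<le> b + K * norm (grad J \<theta>)"
  shows "a - J \<theta>\<^sub>1 \<le> b"
proof (rule field_le_epsilon)
  fix e :: real assume e: "0 < e"
  have C0: "0 \<le> C" using C[of 0] by linarith
  \<comment> \<open>At the minimizer the squared gradient norm is \<open>4 * \<delta>\<close> times
    the penalty, and the penalty is at most \<open>2 * C\<close>. This \<delta> makes the product at
    most \<open>(e / (K + 1))\<^sup>2\<close>; adding 1 to \<open>C\<close> and \<open>K\<close>
    keeps the divisors positive.\<close>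
  define \<delta> where "\<delta> = (e / (K + 1))\<^sup>2 / (8 * (C + 1))"
  have \<delta>: "0 < \<delta>" using e K C0 by (simp add: \<delta>_def)
  define f where "f \<theta> = J \<theta> + \<delta> * ((\<theta> - \<theta>\<^sub>1) \<bullet> (\<theta> - \<theta>\<^sub>1))" for \<theta>
  have fd: "(f has_derivative (\<lambda>h. h \<bullet> grad J \<theta> + \<delta> * (2 * (h \<bullet> (\<theta> - \<theta>\<^sub>1))))) (at \<theta>)" for \<theta>
    unfolding f_def[abs_def]
    by (rule derivative_eq_intros refl differentiable_GDERIV[OF d, unfolded gderiv_def])+
      (simp add: inner_commute)
  have cont: "continuous_on S f" for S
    using fd by (auto intro!: continuous_at_imp_continuous_on has_derivative_continuous)
  \<comment> \<open>Outside this ball the penalty is at least \<open>2 * C\<close>, the largest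
    possible oscillation of \<open>J\<close>, so the minimum over the compact ball is a global
    one.\<close>
  define R where "R = sqrt (2 * C / \<delta>) + 1"
  have R: "1 \<le> R" using \<delta> C0 by (simp add: R_def)
  obtain \<theta> where "\<theta> \<in> cball \<theta>\<^sub>1 R" and min: "\<And>\<phi>. \<phi> \<in> cball \<theta>\<^sub>1 R \<Longrightarrow> f \<theta> \<le> f \<phi>"
    using continuous_attains_inf[OF compact_cball _ cont, of \<theta>\<^sub>1 R] R by auto
  have f1: "f \<theta> \<le> J \<theta>\<^sub>1"
    using min[of \<theta>\<^sub>1] R by (simp add: f_def)
  have glob: "f \<theta> \<le> f \<phi>" for \<phi>
  proof (cases "\<phi> \<in> cball \<theta>\<^sub>1 R")
    case False
    then have "R\<^sup>2 \<le> (norm (\<phi> - \<theta>\<^sub>1))\<^sup>2"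
      using R by (intro power_mono) (auto simp: dist_norm norm_minus_commute)
    moreover have "2 * C / \<delta> \<le> R\<^sup>2"
    proof -
      have "(sqrt (2 * C / \<delta>))\<^sup>2 \<le> R\<^sup>2"
        using \<delta> C0 by (intro power_mono) (auto simp: R_def)
      then show ?thesis using \<delta> C0 by simp
    qed
    ultimately have "\<delta> * (2 * C / \<delta>) \<le> \<delta> * (norm (\<phi> - \<theta>\<^sub>1))\<^sup>2"
      using \<delta> by (intro mult_left_mono) auto
    then have "2 * C \<le> \<delta> * (norm (\<phi> - \<theta>\<^sub>1))\<^sup>2"
      using \<delta> by simp
    then show ?thesis
      using f1 C[of \<theta>\<^sub>1] C[of \<phi>] by (simp add: f_def power2_norm_eq_inner)
  qed (rule min)
  \<comment> \<open>Global minimality gives the first-order condition even for a minimizer on the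
    boundary of the ball.\<close>
  have "(\<lambda>h. h \<bullet> grad J \<theta> + \<delta> * (2 * (h \<bullet> (\<theta> - \<theta>\<^sub>1)))) = (\<lambda>h. 0)"
    by (rule has_derivative_local_min[OF fd]) (simp add: glob)
  then have "h \<bullet> (grad J \<theta> + (2 * \<delta>) *\<^sub>R (\<theta> - \<theta>\<^sub>1)) = 0" for h
    by (simp add: fun_eq_iff inner_add_right mult_ac)
  then have "grad J \<theta> + (2 * \<delta>) *\<^sub>R (\<theta> - \<theta>\<^sub>1) = 0"
    by (metis inner_eq_zero_iff)
  then have g: "grad J \<theta> = - ((2 * \<delta>) *\<^sub>R (\<theta> - \<theta>\<^sub>1))"
    by (simp add: eq_neg_iff_add_eq_0)
  have "\<delta> * (norm (\<theta> - \<theta>\<^sub>1))\<^sup>2 \<le> 2 * C"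
    using f1 C[of \<theta>\<^sub>1] C[of \<theta>] by (simp add: f_def power2_norm_eq_inner)
  then have "(4 * \<delta>) * (\<delta> * (norm (\<theta> - \<theta>\<^sub>1))\<^sup>2) \<le> (4 * \<delta>) * (2 * (C + 1))"
    using \<delta> by (intro mult_left_mono) auto
  moreover have "(4 * \<delta>) * (2 * (C + 1)) = (e / (K + 1))\<^sup>2"
  proof -
    have "(4 * (q / (8 * (C + 1)))) * (2 * (C + 1)) = q" for q
      using C0 by (simp add: field_simps)
    then show ?thesis unfolding \<delta>_def by blast
  qed
  moreover have "(norm (grad J \<theta>))\<^sup>2 = (4 * \<delta>) * (\<delta> * (norm (\<theta> - \<theta>\<^sub>1))\<^sup>2)"
    using \<delta> by (simp add: g power_mult_distrib power2_eq_square)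
  ultimately have "(norm (grad J \<theta>))\<^sup>2 \<le> (e / (K + 1))\<^sup>2"
    by linarith
  then have "norm (grad J \<theta>) \<le> e / (K + 1)"
    by (rule power2_le_imp_le) (use e K in simp)
  then have "K * norm (grad J \<theta>) \<le> K * (e / (K + 1))"
    using K by (rule mult_left_mono)
  also have "\<dots> \<le> e"
    using K e by (simp add: divide_le_eq)
  finally have "a - J \<theta> \<le> b + e"
    using dom[of \<theta>] by linarith
  moreover have "J \<theta> \<le> J \<theta>\<^sub>1"
  proof -
    have "0 \<le> \<delta> * ((\<theta> - \<theta>\<^sub>1) \<bullet> (\<theta> - \<theta>\<^sub>1))" using \<delta> by simp
    then show ?thesis using f1 by (simp add: f_def)
  qed
  ultimately show "a - J \<theta>\<^sub>1 \<le> b + e" by linarith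
qed

lemma optimal_return_eq: "optimal_policy M \<pi> \<Longrightarrow> optimal_return M = expected_return M \<pi>"
  unfolding optimal_return_def optimal_policy_def by (intro cSup_eq_maximum) auto

section \<open>From the transfer error to an inequality for the gradient\<close>

context smooth_mdp
begin

text \<open>Under the visitation law of the optimal policy the advantage \<open>A\<close> has mean
  \<open>1 - discount M\<close> times the optimality gap. Jensen's inequality bounds the mean of
  \<open>A - k\<close> by the root of the transfer error, and the mean of the score part
  \<open>k\<close> is at most \<open>(1 - discount M) * (norm w * M\<^sub>g)\<close>. Dividing by
  \<open>1 - discount M\<close> leaves the bias term with that denominator and frees the gradient
  term of it.\<close>

lemma gradient_domination:
  assumes opt: "optimal_policy M \<pi>'" and \<mu>: "0 < \<mu>\<^sub>F"
    and fisher: "loewner_le (mat \<mu>\<^sub>F) (fisher M pol \<theta>)"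
    and bias: "transfer_error M pol \<pi>' \<theta> \<le> \<epsilon>"
  shows "optimal_return M - J_par M pol \<theta>
    \<le> sqrt \<epsilon> / (1 - discount M) + M\<^sub>g / \<mu>\<^sub>F * norm (grad (J_par M pol) \<theta>)"
proof -
  let ?\<gamma> = "discount M" and ?\<pi> = "\<kappa> \<theta>"
  define E where "E = with_action M \<pi>' (visitation M \<pi>')"
  define w where "w = w_star M pol \<theta>"
  define A where "A x = disc_Q M ?\<pi> (reward M) x - disc_V M ?\<pi> (reward M) (fst x)" for x
  define k where "k x = (1 - ?\<gamma>) * (w \<bullet> score pol \<theta> x)" for x
  define C where "C = r_max / (1 - ?\<gamma>)"
  have \<pi>': "\<pi>' \<in> policies M" using opt by (simp add: optimal_policy_def)
  note \<pi> = policy_of_policies and r = reward_measurable reward_abs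
  have E: "E \<in> space (prob_algebra SA)"
    unfolding E_def by (rule with_action_prob[OF \<pi>' visitation_prob[OF \<pi>']])
  interpret E: prob_space E using prob_algebraD(3)[OF E] .
  have spE: "space E = space SA" using prob_algebraD(2)[OF E] .
  have xS: "fst x \<in> space S" if "x \<in> space SA" for x
    using that by (auto simp: space_pair_measure)
  have QB: "\<bar>disc_Q M ?\<pi> (reward M) x\<bar> \<le> C" if "x \<in> space SA" for x
    unfolding C_def by (rule disc_Q_bound[OF \<pi> r that])
  have VB: "\<bar>disc_V M ?\<pi> (reward M) s\<bar> \<le> C" if "s \<in> space S" for s
    unfolding C_def by (rule disc_V_bound[OF \<pi> r that])
  have Am[measurable]: "A \<in> borel_measurable SA"
  proof -
    have [measurable]: "disc_V M ?\<pi> (reward M) \<in> borel_measurable S" by (rule disc_V_measurable[OF \<pi> r])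
    have [measurable]: "disc_Q M ?\<pi> (reward M) \<in> borel_measurable SA" by (rule disc_Q_measurable[OF \<pi> r(1)])
    show ?thesis unfolding A_def[abs_def] by measurable
  qed
  have AB: "\<bar>A x\<bar> \<le> C + C" if "x \<in> space SA" for x
    using QB[OF that] VB[OF xS[OF that]] by (simp add: A_def)
  have km[measurable]: "k \<in> borel_measurable SA"
    unfolding k_def[abs_def] using score_measurable by measurable
  have kB: "\<bar>k x\<bar> \<le> (1 - ?\<gamma>) * (norm w * M\<^sub>g)" if "x \<in> space SA" for x
  proof -
    have "\<bar>w \<bullet> score pol \<theta> x\<bar> \<le> norm w * M\<^sub>g"
      using Cauchy_Schwarz_ineq2[of w "score pol \<theta> x"] mult_left_mono[OF score_bound[OF that, of \<theta>], of "norm w"]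
      by simp
    then show ?thesis using discount by (simp add: k_def abs_mult)
  qed
  have adv: "advantage M ?\<pi> x = A x" if "x \<in> space SA" for x
    using that xS[OF that] by (simp add: advantage_def A_def Q_fun_eq[OF \<pi>] V_fun_eq[OF \<pi>])
  have Ai: "integrable E A" and ki: "integrable E k"
    using AB kB by (auto intro!: integrable_bounded_prob[OF E])
  have "integrable E (\<lambda>x. (A x - k x)\<^sup>2)"
  proof (rule integrable_bounded_prob[OF E])
    show "norm ((A x - k x)\<^sup>2) \<le> (C + C + (1 - ?\<gamma>) * (norm w * M\<^sub>g))\<^sup>2" if "x \<in> space SA" for x
      using AB[OF that] kB[OF that] by (simp add: abs_le_square_iff[symmetric])
  qed measurable
  \<comment> \<open>Jensen's inequality, in the form that the variance is nonnegative.\<close>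
  then have "(\<integral>x. A x - k x \<partial>E)\<^sup>2 \<le> (\<integral>x. (A x - k x)\<^sup>2 \<partial>E)"
    using E.variance_eq[of "\<lambda>x. A x - k x"] E.variance_positive[of "\<lambda>x. A x - k x"] Ai ki by simp
  also have "\<dots> = transfer_error M pol \<pi>' \<theta>"
    unfolding transfer_error_def E_def[symmetric] w_def[symmetric]
    by (intro Bochner_Integration.integral_cong) (auto simp: spE adv k_def)
  also note bias
  finally have "(\<integral>x. A x - k x \<partial>E) \<le> sqrt \<epsilon>"
    by (rule real_le_rsqrt)
  moreover have "(\<integral>x. A x - k x \<partial>E) = integral\<^sup>L E A - integral\<^sup>L E k"
    using Ai ki by simp
  moreover have "integral\<^sup>L E k \<le> (1 - ?\<gamma>) * (norm w * M\<^sub>g)"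
    using norm_integral_bounded_prob[OF E km, of "(1 - ?\<gamma>) * (norm w * M\<^sub>g)"] kB by simp
  moreover have "integral\<^sup>L E A = (1 - ?\<gamma>) * (optimal_return M - J_par M pol \<theta>)"
  proof -
    have "integral\<^sup>L E A = (1 - ?\<gamma>) * disc_value M \<pi>' (with_action M \<pi>' (init_dist M)) A"
      unfolding E_def by (rule integral_visitation[OF \<pi>' Am AB])
    also have "disc_value M \<pi>' (with_action M \<pi>' (init_dist M)) A = optimal_return M - J_par M pol \<theta>"
      using performance_difference[OF \<pi> \<pi>' init_dist_prob r, of \<theta>]
      by (simp add: A_def[abs_def] optimal_return_eq[OF opt] expected_return_eq[OF \<pi>'] J_par_def expected_return_eq[OF \<pi>])
    finally show ?thesis .
  qed
  ultimately have "(1 - ?\<gamma>) * (optimal_return M - J_par M pol \<theta>) \<le> sqrt \<epsilon> + (1 - ?\<gamma>) * (norm w * M\<^sub>g)"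
    by linarith
  then have "optimal_return M - J_par M pol \<theta> \<le> sqrt \<epsilon> / (1 - ?\<gamma>) + norm w * M\<^sub>g"
    using discount by (simp add: field_simps)
  moreover have "norm w * M\<^sub>g \<le> (norm (grad (J_par M pol) \<theta>) / \<mu>\<^sub>F) * M\<^sub>g"
    using pseudo_inverse_norm_bound[OF \<mu> fisher] M_pos
    unfolding w_def w_star_def by (intro mult_right_mono) auto
  ultimately show ?thesis by (simp add: mult.commute)
qed

lemma optimality_gap:
  assumes "optimal_policy M \<pi>'" "0 < \<mu>\<^sub>F"
    and "\<And>\<theta>. loewner_le (mat \<mu>\<^sub>F) (fisher M pol \<theta>)" "\<And>\<theta>. transfer_error M pol \<pi>' \<theta> \<le> \<epsilon>"
  shows "optimal_return M - J_par M pol \<theta> \<le> sqrt \<epsilon> / (1 - discount M)"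
  using M_pos assms(2)
  by (intro gradient_domination_bounded[OF J_par_differentiable J_par_bounded _ gradient_domination[OF assms]]) simp

end

section \<open>The law of the algorithm\<close>

text \<open>Reduces the rank-one part of \<open>B_est\<close>, applied to a vector, to an inner
  product of gradients, whose measurability is available.\<close>

lemma outer_mult_vec: "outer u v *v x = (v \<bullet> x) *\<^sub>R (u :: real^'n)"
  by (simp add: vec_eq_iff outer_def matrix_vector_mult_def inner_vec_def sum_distrib_left sum_distrib_right mult_ac)

context smooth_mdp
begin

lemma p_joint_measurable: "(\<lambda>(\<theta>, x). p \<theta> x) \<in> borel_measurable (borel \<Otimes>\<^sub>M SA)"
proof (rule caratheodory_measurable_differentiable[OF p_measurable])
  fix \<theta> x assume "x \<in> space SA"
  then have "twice_cont_diff (\<lambda>\<theta>. p \<theta> x)"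
    by (intro pol_C2) (auto simp: space_pair_measure)
  then show "(\<lambda>\<theta>. p \<theta> x) differentiable (at \<theta>)"
    by (simp add: twice_cont_diff_def)
qed

section \<open>Densities of finite trajectories\<close>

abbreviation "paths (H :: nat) \<equiv> PiM {..<H} (\<lambda>_. SA)"

lemma pathsD: "\<tau> \<in> space (paths H) \<Longrightarrow> t < H \<Longrightarrow> \<tau> t \<in> space SA"
  by (auto simp: space_PiM)

lemma sigma_finite_SA: "sigma_finite_measure SA"
proof -
  interpret pair_sigma_finite "state_space M" "action_space M"
    by (intro pair_sigma_finite.intro sigma_finite_states sigma_finite_actions)
  show ?thesis by unfold_locales
qed

lemma path_transition_measurable:
  assumes "0 < t" "t < H"
  shows "(\<lambda>\<tau>. transition M (\<tau> (t - 1)) (fst (\<tau> t))) \<in> borel_measurable (paths H)"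
proof -
  have [measurable]: "(\<lambda>\<tau>. \<tau> (t - 1)) \<in> paths H \<rightarrow>\<^sub>M SA" "(\<lambda>\<tau>. \<tau> t) \<in> paths H \<rightarrow>\<^sub>M SA"
    using assms by (auto intro!: measurable_component_singleton simp: less_imp_diff_less)
  have "(\<lambda>\<tau>. (\<tau> (t - 1), fst (\<tau> t))) \<in> paths H \<rightarrow>\<^sub>M SA \<Otimes>\<^sub>M S"
    by measurable
  from measurable_compose[OF this transition_measurable] show ?thesis by simp
qed

lemma path_pol_measurable:
  assumes "t < H"
  shows "(\<lambda>(\<theta>, \<tau>). p \<theta> (\<tau> t)) \<in> borel_measurable (borel \<Otimes>\<^sub>M paths H)"
proof -
  have [measurable]: "(\<lambda>\<tau>. \<tau> t) \<in> paths H \<rightarrow>\<^sub>M SA"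
    using assms by (auto intro!: measurable_component_singleton)
  have "(\<lambda>w. (fst w, snd w t)) \<in> borel \<Otimes>\<^sub>M paths H \<rightarrow>\<^sub>M borel \<Otimes>\<^sub>M SA"
    by measurable
  from measurable_compose[OF this p_joint_measurable] show ?thesis by (simp add: split_beta')
qed

lemma path_init_measurable:
  assumes "0 < H"
  shows "(\<lambda>\<tau>. init M (fst (\<tau> 0))) \<in> borel_measurable (paths H)"
proof -
  have [measurable]: "(\<lambda>\<tau>. \<tau> 0) \<in> paths H \<rightarrow>\<^sub>M SA"
    using assms by (auto intro!: measurable_component_singleton)
  note [measurable] = init_measurable
  show ?thesis by measurable
qed

lemma traj_density_joint_measurable:
  assumes H: "0 < H"
  shows "(\<lambda>(\<theta>, \<tau>). traj_density M pol H \<tau> \<theta>) \<in> borel_measurable (borel \<Otimes>\<^sub>M paths H)"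
proof -
  note [measurable] = measurable_compose[OF measurable_snd path_init_measurable[OF H]]
    path_pol_measurable[OF H, simplified split_beta']
  have "(\<lambda>w. transition M (snd w (t - 1)) (fst (snd w t))) \<in> borel_measurable (borel \<Otimes>\<^sub>M paths H)"
    if "t \<in> {1..<H}" for t
    by (rule measurable_compose[OF measurable_snd path_transition_measurable]) (use that in auto)
  then have [measurable]: "(\<lambda>w. \<Prod>t = 1..<H. transition M (snd w (t - 1)) (fst (snd w t)) * p (fst w) (snd w t))
      \<in> borel_measurable (borel \<Otimes>\<^sub>M paths H)"
    using path_pol_measurable by (intro borel_measurable_prod borel_measurable_times) (auto simp: split_beta')
  show ?thesis
    unfolding traj_density_def split_beta' by measurable
qed

lemma traj_density_nonneg:
  assumes H: "0 < H" and \<tau>: "\<tau> \<in> space (paths H)"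
  shows "0 \<le> traj_density M pol H \<tau> \<theta>"
proof -
  have sp: "fst (\<tau> t) \<in> space S" "snd (\<tau> t) \<in> space (action_space M)" if "t < H" for t
    using pathsD[OF \<tau> that] by (auto simp: space_pair_measure)
  have "0 \<le> (\<Prod>t = 1..<H. transition M (\<tau> (t - 1)) (fst (\<tau> t)) * p \<theta> (\<tau> t))"
    using pathsD[OF \<tau>] sp by (intro prod_nonneg ballI mult_nonneg_nonneg transition_nonneg pol_nonneg) auto
  then show ?thesis
    unfolding traj_density_def using H sp by (intro mult_nonneg_nonneg init_nonneg pol_nonneg) auto
qed

text \<open>One factor of the trajectory density: \<open>g\<close> is the initial density for the
  first pair and a transition density for each later one. The action integrates out first.\<close>

lemma nn_integral_state_pol:
  assumes [measurable]: "g \<in> borel_measurable S" and one: "(\<integral>\<^sup>+s. ennreal (g s) \<partial>S) = 1"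
    and nn: "\<And>s. s \<in> space S \<Longrightarrow> 0 \<le> g s"
  shows "(\<integral>\<^sup>+x. ennreal (g (fst x) * p \<theta> x) \<partial>SA) = 1"
proof -
  interpret A: sigma_finite_measure "action_space M" by (rule sigma_finite_actions)
  note [measurable] = p_measurable
  have "(\<integral>\<^sup>+x. ennreal (g (fst x) * p \<theta> x) \<partial>SA) = (\<integral>\<^sup>+s. \<integral>\<^sup>+a. ennreal (g s * pol \<theta> s a) \<partial>action_space M \<partial>S)"
    by (subst A.nn_integral_fst[symmetric]) auto
  also have "\<dots> = (\<integral>\<^sup>+s. ennreal (g s) \<partial>S)"
  proof (rule nn_integral_cong)
    fix s assume s: "s \<in> space S"
    have "(\<integral>\<^sup>+a. ennreal (g s * pol \<theta> s a) \<partial>action_space M) = (\<integral>\<^sup>+a. ennreal (g s) * ennreal (pol \<theta> s a) \<partial>action_space M)"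
      using nn[OF s] pol_nonneg[OF s] by (intro nn_integral_cong) (simp add: ennreal_mult)
    also have "\<dots> = ennreal (g s)"
      using pol_measurable_action[OF s] pol_prob[OF s] by (subst nn_integral_cmult) auto
    finally show "(\<integral>\<^sup>+a. ennreal (g s * pol \<theta> s a) \<partial>action_space M) = ennreal (g s)" .
  qed
  finally show ?thesis using one by simp
qed

lemma traj_density_measurable:
  assumes "0 < H"
  shows "(\<lambda>\<tau>. traj_density M pol H \<tau> \<theta>) \<in> borel_measurable (paths H)"
  using measurable_compose[OF _ traj_density_joint_measurable[OF assms], of "\<lambda>\<tau>. (\<theta>, \<tau>)"] by simp

lemma traj_density_Suc:
  assumes "0 < H"
  shows "traj_density M pol (Suc H) \<tau> \<theta>
    = traj_density M pol H \<tau> \<theta> * (transition M (\<tau> (H - 1)) (fst (\<tau> H)) * p \<theta> (\<tau> H))"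
  using assms by (simp add: traj_density_def prod.atLeastLessThan_Suc)

text \<open>Integrating out the last pair leaves the density of the trajectory shorter by one. The
  induction starts at length 1, the first length at which the initial pair is a coordinate.\<close>

lemma traj_density_total:
  assumes "0 < H"
  shows "(\<integral>\<^sup>+\<tau>. ennreal (traj_density M pol H \<tau> \<theta>) \<partial>paths H) = 1"
  using assms
proof (induction H rule: nat_induct_non_zero)
  case 1
  interpret product_sigma_finite "\<lambda>_ :: nat. SA"
    by (intro product_sigma_finite.intro sigma_finite_SA)
  have set: "{..<1} = insert (0::nat) {}" by auto
  have "(\<integral>\<^sup>+\<tau>. ennreal (traj_density M pol 1 \<tau> \<theta>) \<partial>paths 1)
    = (\<integral>\<^sup>+\<tau>. (\<integral>\<^sup>+x. ennreal (traj_density M pol 1 (\<tau>(0 := x)) \<theta>) \<partial>SA) \<partial>PiM ({} :: nat set) (\<lambda>_. SA))"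
    using traj_density_measurable[of 1 \<theta>] unfolding set by (subst product_nn_integral_insert) auto
  also have "\<dots> = (\<integral>\<^sup>+\<tau>. (\<integral>\<^sup>+x. ennreal (init M (fst x) * p \<theta> x) \<partial>SA) \<partial>PiM ({} :: nat set) (\<lambda>_. SA))"
    by (simp add: traj_density_def)
  also have "\<dots> = 1"
    by (simp add: nn_integral_state_pol[OF init_measurable init_prob init_nonneg] PiM_empty)
  finally show ?case .
next
  case (Suc n)
  interpret product_sigma_finite "\<lambda>_ :: nat. SA"
    by (intro product_sigma_finite.intro sigma_finite_SA)
  have set: "{..<Suc n} = insert n {..<n}" by auto
  have "(\<integral>\<^sup>+\<tau>. ennreal (traj_density M pol (Suc n) \<tau> \<theta>) \<partial>paths (Suc n))
    = (\<integral>\<^sup>+\<tau>. (\<integral>\<^sup>+x. ennreal (traj_density M pol (Suc n) (\<tau>(n := x)) \<theta>) \<partial>SA) \<partial>paths n)"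
    using traj_density_measurable[of "Suc n" \<theta>] unfolding set by (subst product_nn_integral_insert) auto
  also have "\<dots> = (\<integral>\<^sup>+\<tau>. ennreal (traj_density M pol n \<tau> \<theta>) \<partial>paths n)"
  proof (rule nn_integral_cong)
    fix \<tau> assume \<tau>: "\<tau> \<in> space (paths n)"
    have last: "\<tau> (n - 1) \<in> space SA" using \<tau> Suc.hyps by (intro pathsD) auto
    have tr: "transition M (\<tau> (n - 1)) \<in> borel_measurable S"
      using measurable_compose[OF measurable_Pair1'[OF last] transition_measurable] by simp
    have same: "traj_density M pol n (\<tau>(n := x)) \<theta> = traj_density M pol n \<tau> \<theta>" for x
      using Suc.hyps by (auto simp: traj_density_def intro!: prod.cong)
    \<comment> \<open>Relies on \<open>0 < n\<close>: for \<open>n = 0\<close> truncated subtraction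
      would make this the updated coordinate.\<close>
    have idx: "(\<tau>(n := x)) (n - 1) = \<tau> (n - 1)" for x
      using Suc.hyps by (cases n) auto
    have "(\<integral>\<^sup>+x. ennreal (traj_density M pol (Suc n) (\<tau>(n := x)) \<theta>) \<partial>SA)
      = (\<integral>\<^sup>+x. ennreal (traj_density M pol n \<tau> \<theta>) * ennreal (transition M (\<tau> (n - 1)) (fst x) * p \<theta> x) \<partial>SA)"
    proof (rule nn_integral_cong)
      fix x assume x: "x \<in> space SA"
      have "0 \<le> transition M (\<tau> (n - 1)) (fst x) * p \<theta> x"
        using x last by (intro mult_nonneg_nonneg transition_nonneg less_imp_le[OF p_pos]) (auto simp: space_pair_measure)
      then show "ennreal (traj_density M pol (Suc n) (\<tau>(n := x)) \<theta>)
        = ennreal (traj_density M pol n \<tau> \<theta>) * ennreal (transition M (\<tau> (n - 1)) (fst x) * p \<theta> x)"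
        using Suc.hyps traj_density_nonneg[OF Suc.hyps \<tau>, of \<theta>]
        unfolding traj_density_Suc[OF Suc.hyps] same idx by (simp flip: ennreal_mult)
    qed
    also have "\<dots> = ennreal (traj_density M pol n \<tau> \<theta>)"
      using nn_integral_state_pol[OF tr transition_prob[OF last] transition_nonneg[OF last]] tr p_measurable
      by (subst nn_integral_cmult) auto
    finally show "(\<integral>\<^sup>+x. ennreal (traj_density M pol (Suc n) (\<tau>(n := x)) \<theta>) \<partial>SA) = ennreal (traj_density M pol n \<tau> \<theta>)" .
  qed
  finally show ?case using Suc.IH by simp
qed

text \<open>The parameters at which the algorithm samples are themselves random, so the trajectory
  law is needed as a kernel in \<theta>.\<close>

lemma traj_dist_measurable:
  assumes H: "0 < H"
  shows "traj_dist M pol H \<in> borel \<rightarrow>\<^sub>M prob_algebra (paths H)"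
  unfolding traj_dist_def[abs_def]
proof (rule measurable_density_prob_algebra)
  interpret product_sigma_finite "\<lambda>_ :: nat. SA"
    by (intro product_sigma_finite.intro sigma_finite_SA)
  show "sigma_finite_measure (paths H)"
    by (rule sigma_finite) simp
qed (use traj_density_joint_measurable[OF H] traj_density_total[OF H] in \<open>auto simp: split_beta'\<close>)

section \<open>Regularity of the estimators along a trajectory\<close>

lemma Phi_measurable: "(\<lambda>\<tau>. Phi M pol H \<tau> \<theta>) \<in> borel_measurable (paths H)"
proof -
  have c: "(\<lambda>\<tau>. \<tau> t) \<in> paths H \<rightarrow>\<^sub>M SA" if "t < H" for t
    using that by (auto intro!: measurable_component_singleton)
  show ?thesis
    unfolding Phi_def
    by (intro borel_measurable_sum borel_measurable_times borel_measurable_const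
        measurable_compose[OF c reward_measurable] measurable_compose[OF c ln_p_measurable]) auto
qed

lemma Phi_GDERIV:
  assumes \<tau>: "\<tau> \<in> space (paths H)"
  shows "GDERIV (Phi M pol H \<tau>) \<theta> :> (\<Sum>t<H. (\<Sum>h = t..<H. discount M ^ h * reward M (\<tau> h)) *\<^sub>R score pol \<theta> (\<tau> t))"
proof -
  have "((\<lambda>\<theta>. \<Sum>t<H. (\<Sum>h = t..<H. discount M ^ h * reward M (\<tau> h)) * ln (p \<theta> (\<tau> t))) has_derivative
     (\<lambda>k. \<Sum>t<H. (\<Sum>h = t..<H. discount M ^ h * reward M (\<tau> h)) * (k \<bullet> score pol \<theta> (\<tau> t)))) (at \<theta>)"
    by (intro has_derivative_sum has_derivative_mult_right score_derivative pathsD[OF \<tau>]) simp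
  then show ?thesis
    by (simp add: gderiv_def Phi_def[abs_def] inner_sum_right)
qed

lemma Phi_differentiable: "\<tau> \<in> space (paths H) \<Longrightarrow> Phi M pol H \<tau> differentiable (at \<theta>)"
  using Phi_GDERIV[of \<tau> H \<theta>] by (auto simp: gderiv_def differentiable_def)

lemma grad_Phi_differentiable:
  assumes \<tau>: "\<tau> \<in> space (paths H)"
  shows "grad (Phi M pol H \<tau>) differentiable (at \<theta>)"
proof -
  have "grad (Phi M pol H \<tau>)
    = (\<lambda>\<theta>. \<Sum>t<H. (\<Sum>h = t..<H. discount M ^ h * reward M (\<tau> h)) *\<^sub>R score pol \<theta> (\<tau> t))"
    by (intro ext grad_unique Phi_GDERIV \<tau>)
  moreover have "(\<lambda>\<theta>. score pol \<theta> (\<tau> t)) differentiable (at \<theta>)" if "t < H" for t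
    using grad_ln_p_differentiable[OF pathsD[OF \<tau> that]] by (simp add: score_def)
  ultimately show ?thesis
    by (auto intro!: differentiable_sum differentiable_scaleR)
qed

lemma ln_traj_density_measurable:
  assumes "0 < H"
  shows "(\<lambda>\<tau>. ln (traj_density M pol H \<tau> \<theta>)) \<in> borel_measurable (paths H)"
proof -
  have [measurable]: "(\<lambda>\<tau>. traj_density M pol H \<tau> \<theta>) \<in> borel_measurable (paths H)"
    by (rule traj_density_measurable[OF assms])
  show ?thesis by measurable
qed

text \<open>If an initial or transition density vanishes along \<open>\<tau>\<close>, then the trajectory density is the
  constant \<open>0\<close> and so is its logarithm, by the convention \<open>ln 0 = 0\<close>.\<close>

lemma ln_traj_density_differentiable:
  assumes H: "0 < H" and \<tau>: "\<tau> \<in> space (paths H)"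
  shows "(\<lambda>\<theta>. ln (traj_density M pol H \<tau> \<theta>)) differentiable (at \<theta>)"
proof -
  define c where "c = init M (fst (\<tau> 0)) * (\<Prod>t = 1..<H. transition M (\<tau> (t - 1)) (fst (\<tau> t)))"
  have "{..<H} = insert 0 {1..<H}" using H by auto
  then have split: "(\<Prod>t<H. p \<theta> (\<tau> t)) = p \<theta> (\<tau> 0) * (\<Prod>t = 1..<H. p \<theta> (\<tau> t))" for \<theta>
    by simp
  have eq: "traj_density M pol H \<tau> \<theta> = c * (\<Prod>t<H. p \<theta> (\<tau> t))" for \<theta>
    unfolding traj_density_def c_def split by (simp add: prod.distrib mult_ac)
  have pos: "0 < (\<Prod>t<H. p \<theta> (\<tau> t))" for \<theta>
    by (intro prod_pos) (auto intro: p_pos pathsD[OF \<tau>])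
  show ?thesis
  proof (cases "c = 0")
    case True
    then show ?thesis by (simp add: eq)
  next
    case False
    moreover have "0 \<le> c"
      using traj_density_nonneg[OF H \<tau>, of \<theta>] pos[of \<theta>] unfolding eq by (simp add: zero_le_mult_iff)
    ultimately have c: "0 < c" by simp
    have "ln (traj_density M pol H \<tau> \<theta>) = ln c + (\<Sum>t<H. ln (p \<theta> (\<tau> t)))" for \<theta>
    proof -
      have ne: "p \<theta> (\<tau> t) \<noteq> 0" if "t < H" for t
        using p_pos[OF pathsD[OF \<tau> that], of \<theta>] by simp
      have "ln (\<Prod>t<H. p \<theta> (\<tau> t)) = (\<Sum>t<H. ln (p \<theta> (\<tau> t)))"
        using ne by (intro ln_prod) auto
      moreover have "(\<Prod>t<H. p \<theta> (\<tau> t)) \<noteq> 0"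
        using ne by simp
      ultimately show ?thesis
        unfolding eq using c by (subst ln_mult) auto
    qed
    then show ?thesis
      by (auto intro!: differentiable_add differentiable_sum ln_p_differentiable pathsD[OF \<tau>])
  qed
qed

text \<open>Measurability is propagated through the three nested draws from the innermost outwards
  (\<open>3\<close>, \<open>2\<close>, \<open>1\<close>), with the variables already drawn kept as
  components of a product space. The core is \<open>u\<close>, the update as a function of the
  state, the interpolation weight and both trajectories at once.\<close>

lemma nharpg_step_measurable:
  assumes H: "0 < H"
  shows "nharpg_step M pol H \<eta> \<alpha> \<in> borel \<rightarrow>\<^sub>M prob_algebra borel"
proof -
  let ?Z = "borel :: ((real^'n) \<times> (real^'n) \<times> (real^'n)) measure"
  have U: "uniform_measure lborel {0..1::real} \<in> space (prob_algebra borel)"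
    by (auto simp: space_prob_algebra intro!: prob_space_uniform_measure)
  have fp[measurable]: "fst \<in> borel_measurable ?Z"
    and f1[measurable]: "(\<lambda>z. fst (snd z)) \<in> borel_measurable ?Z"
    and f2[measurable]: "(\<lambda>z. snd (snd z)) \<in> borel_measurable ?Z"
    by (intro borel_measurable_continuous_onI continuous_intros)+
  note [measurable] = traj_dist_measurable[OF H]
  define \<theta>' where "\<theta>' z q = q *\<^sub>R fst (snd z) + (1 - q) *\<^sub>R fst z"
    for z :: "(real^'n) \<times> (real^'n) \<times> (real^'n)" and q
  have q[measurable]: "(\<lambda>w. \<theta>' (fst w) (snd w)) \<in> borel_measurable (?Z \<Otimes>\<^sub>M borel)"
    unfolding \<theta>'_def by measurable
  define u where "u z q \<tau> \<tau>' = nharpg_update M pol H \<eta> \<alpha> \<tau> \<tau>' (\<theta>' z q) z" for z q \<tau> \<tau>'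
  \<comment> \<open>Components from left to right: state of the algorithm, weight \<open>q\<close>,
    trajectory at the current parameter, trajectory at the interpolated one.\<close>
  let ?W = "((?Z \<Otimes>\<^sub>M borel) \<Otimes>\<^sub>M paths H) \<Otimes>\<^sub>M paths H"
  have u: "(\<lambda>w. u (fst (fst (fst w))) (snd (fst (fst w))) (snd (fst w)) (snd w)) \<in> borel_measurable ?W"
  proof -
    let ?z = "\<lambda>w. fst (fst (fst w))"
    let ?v = "\<lambda>w. fst (snd (?z w)) - fst (?z w)"
    let ?t = "\<lambda>w. \<theta>' (?z w) (snd (fst (fst w)))"
    have [measurable]: "?t \<in> borel_measurable ?W"
      by (rule measurable_compose[OF _ q, of "\<lambda>w. (fst (fst w))"]) measurable
    have [measurable]: "(\<lambda>w. fst (snd (?z w))) \<in> borel_measurable ?W" "(\<lambda>w. fst (?z w)) \<in> borel_measurable ?W"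
      "(\<lambda>w. snd (snd (?z w))) \<in> borel_measurable ?W"
      by measurable
    have g: "(\<lambda>w. grad (Phi M pol H (y w)) (\<phi> w)) \<in> borel_measurable ?W"
      if "\<phi> \<in> borel_measurable ?W" "y \<in> ?W \<rightarrow>\<^sub>M paths H" for \<phi> y
    proof -
      have "(\<lambda>w. (\<phi> w, y w)) \<in> ?W \<rightarrow>\<^sub>M borel \<Otimes>\<^sub>M paths H"
        using that by measurable
      from measurable_compose[OF this grad_measurable[of "\<lambda>\<theta> \<tau>. Phi M pol H \<tau> \<theta>", OF Phi_measurable Phi_differentiable]]
      show ?thesis by simp
    qed
    have [measurable]: "(\<lambda>w. grad (Phi M pol H (snd (fst w))) (fst (snd (?z w)))) \<in> borel_measurable ?W"
      "(\<lambda>w. grad (Phi M pol H (snd w)) (?t w)) \<in> borel_measurable ?W"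
      by (rule g; measurable)+
    have [measurable]: "(\<lambda>w. grad (\<lambda>\<theta>. ln (traj_density M pol H (snd w) \<theta>)) (?t w)) \<in> borel_measurable ?W"
    proof -
      have "(\<lambda>w. (?t w, snd w)) \<in> ?W \<rightarrow>\<^sub>M borel \<Otimes>\<^sub>M paths H"
        by measurable
      from measurable_compose[OF this grad_measurable[of "\<lambda>\<theta> \<tau>. ln (traj_density M pol H \<tau> \<theta>)",
          OF ln_traj_density_measurable[OF H] ln_traj_density_differentiable[OF H]]]
      show ?thesis by simp
    qed
    have [measurable]: "(\<lambda>w. hessian (Phi M pol H (snd w)) (?t w) *v ?v w) \<in> borel_measurable ?W"
      by (rule hessian_mult_measurable[of "\<lambda>\<theta> \<tau>. Phi M pol H \<tau> \<theta>",
          OF Phi_measurable Phi_differentiable grad_Phi_differentiable]) measurable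
    let ?B = "\<lambda>w. B_est M pol H (snd w) (?t w) *v ?v w"
    have [measurable]: "?B \<in> borel_measurable ?W"
      unfolding B_est_def matrix_vector_mult_add_rdistrib outer_mult_vec by measurable
    define d where "d w = (1 - \<eta>) *\<^sub>R (snd (snd (?z w)) + ?B w)
      + \<eta> *\<^sub>R g_est M pol H (snd (fst w)) (fst (snd (?z w)))" for w
    have [measurable]: "d \<in> borel_measurable ?W"
      unfolding d_def[abs_def] g_est_def by measurable
    have eq: "(\<lambda>w. u (fst (fst (fst w))) (snd (fst (fst w))) (snd (fst w)) (snd w))
      = (\<lambda>w. (fst (snd (?z w)), fst (snd (?z w)) + \<alpha> *\<^sub>R sgn (d w), d w))"
      unfolding u_def nharpg_update_def d_def by (simp add: split_beta' Let_def)
    \<comment> \<open>\<open>sgn\<close> jumps at zero, so continuity is of no use; written as a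
      quotient by the norm it is still measurable.\<close>
    have "(\<lambda>w. fst (snd (?z w)) + \<alpha> *\<^sub>R (d w /\<^sub>R norm (d w))) \<in> borel_measurable ?W"
      by measurable
    then show ?thesis
      unfolding eq sgn_div_norm by (intro borel_measurable_Pair) simp_all
  qed
  have 3: "(\<lambda>w. traj_dist M pol H (\<theta>' (fst (fst w)) (snd (fst w)))
        \<bind> (\<lambda>\<tau>'. return borel (u (fst (fst w)) (snd (fst w)) (snd w) \<tau>')))
      \<in> (?Z \<Otimes>\<^sub>M borel) \<Otimes>\<^sub>M paths H \<rightarrow>\<^sub>M prob_algebra borel"
  proof (rule measurable_bind_prob_space2)
    show "(\<lambda>w. traj_dist M pol H (\<theta>' (fst (fst w)) (snd (fst w)))) \<in> (?Z \<Otimes>\<^sub>M borel) \<Otimes>\<^sub>M paths H \<rightarrow>\<^sub>M prob_algebra (paths H)"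
      by (rule measurable_compose[OF measurable_compose[OF measurable_fst q] traj_dist_measurable[OF H]])
    show "(\<lambda>(w, \<tau>'). return borel (u (fst (fst w)) (snd (fst w)) (snd w) \<tau>')) \<in> ?W \<rightarrow>\<^sub>M prob_algebra borel"
      using measurable_compose[OF u measurable_return_prob_space] by (simp add: split_beta')
  qed
  have 2: "(\<lambda>w. traj_dist M pol H (fst (snd (fst w)))
        \<bind> (\<lambda>\<tau>. traj_dist M pol H (\<theta>' (fst w) (snd w)) \<bind> (\<lambda>\<tau>'. return borel (u (fst w) (snd w) \<tau> \<tau>'))))
      \<in> ?Z \<Otimes>\<^sub>M borel \<rightarrow>\<^sub>M prob_algebra borel"
  proof (rule measurable_bind_prob_space2)
    show "(\<lambda>w. traj_dist M pol H (fst (snd (fst w)))) \<in> ?Z \<Otimes>\<^sub>M borel \<rightarrow>\<^sub>M prob_algebra (paths H)"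
      by (rule measurable_compose[OF measurable_compose[OF measurable_fst f1] traj_dist_measurable[OF H]])
  qed (use 3 in \<open>simp add: split_beta'\<close>)
  have 1: "(\<lambda>z. uniform_measure lborel {0..1::real} \<bind> (\<lambda>q. traj_dist M pol H (fst (snd z))
        \<bind> (\<lambda>\<tau>. traj_dist M pol H (\<theta>' z q) \<bind> (\<lambda>\<tau>'. return borel (u z q \<tau> \<tau>')))))
      \<in> ?Z \<rightarrow>\<^sub>M prob_algebra borel"
  proof (rule measurable_bind_prob_space2)
    show "(\<lambda>z. uniform_measure lborel {0..1::real}) \<in> ?Z \<rightarrow>\<^sub>M prob_algebra borel"
      using U by simp
  qed (use 2 in \<open>simp add: split_beta'\<close>)
  then show ?thesis
    unfolding nharpg_step_def u_def \<theta>'_def by (simp add: split_beta' Let_def)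
qed

lemma nharpg_law_prob:
  assumes "0 < H"
  shows "nharpg_law M pol H \<eta> \<alpha> \<theta>\<^sub>0 \<theta>\<^sub>1 d\<^sub>0 k \<in> space (prob_algebra borel)"
  by (induction k) (auto intro: return_prob bind_in_prob_algebra[OF _ nharpg_step_measurable[OF assms]])

text \<open>Makes the integral over the output law an honest expectation, under which constants
  integrate to themselves.\<close>

lemma nharpg_output_prob:
  assumes "0 < H"
  shows "nharpg_output M pol H \<eta> \<alpha> \<theta>\<^sub>0 \<theta>\<^sub>1 d\<^sub>0 T \<in> space (prob_algebra borel)"
proof -
  have "(\<lambda>(\<theta>\<^sub>p, \<theta>, d\<^sub>p). \<theta>) \<in> borel_measurable (borel :: ((real^'n) \<times> (real^'n) \<times> (real^'n)) measure)"
    unfolding split_beta' by (intro borel_measurable_continuous_onI continuous_intros)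
  then show ?thesis
    unfolding nharpg_output_def
    by (rule measurable_space[OF measurable_distr_prob_space nharpg_law_prob[OF assms]])
qed

end

theorem theorem3:
  fixes M :: "('s, 'a) mdp_data"
    and pol :: "real^'n \<Rightarrow> 's \<Rightarrow> 'a \<Rightarrow> real"
    and \<pi>_opt :: "'s \<Rightarrow> 'a measure"
    and r_max M\<^sub>g M\<^sub>h \<mu>\<^sub>F \<epsilon>_bias :: real
    and \<theta>\<^sub>0 \<theta>\<^sub>1 d\<^sub>0 :: "real^'n"
    and \<eta> \<alpha> :: "nat \<Rightarrow> real"
    and T H :: nat
  assumes mdp: "mdp M r_max"
    and policies: "policy_family M pol"
    and optimal: "optimal_policy M \<pi>_opt"
    and pol_pos: "\<And>\<theta> s a. s \<in> space (state_space M) \<Longrightarrow> a \<in> space (action_space M) \<Longrightarrow>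
        0 < pol \<theta> s a"
    and pol_C2: "\<And>s a. s \<in> space (state_space M) \<Longrightarrow> a \<in> space (action_space M) \<Longrightarrow>
        twice_cont_diff (\<lambda>\<theta>. pol \<theta> s a)"
    and M_pos: "0 < M\<^sub>g" "0 < M\<^sub>h"
    and score_bound: "\<And>\<theta> x. x \<in> space (sa_space M) \<Longrightarrow> norm (score pol \<theta> x) \<le> M\<^sub>g"
    and score_hessian_bound:
      "\<And>\<theta> x. x \<in> space (sa_space M) \<Longrightarrow> op_norm (score_hessian pol \<theta> x) \<le> M\<^sub>h"
    and \<mu>_pos: "0 < \<mu>\<^sub>F"
    and fisher: "\<And>\<theta>. loewner_le (mat \<mu>\<^sub>F) (fisher M pol \<theta>)"
    and bias_nonneg: "0 \<le> \<epsilon>_bias"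
    and bias: "\<And>\<theta>. transfer_error M pol \<pi>_opt \<theta> \<le> \<epsilon>_bias"
    and step_size: "\<And>t. \<alpha> t = 6 * M\<^sub>g / (\<mu>\<^sub>F * (real t + 2))"
    and momentum: "\<And>t. \<eta> t = 2 / (real t + 2)"
    and T: "1 \<le> T"
    and H: "H = horizon (discount M) T"
  shows "optimal_return M
           - (\<integral>\<theta>. J_par M pol \<theta> \<partial>nharpg_output M pol H \<eta> \<alpha> \<theta>\<^sub>0 \<theta>\<^sub>1 d\<^sub>0 T)
         \<le> abs_const *
             ((sigma_g (discount M) r_max M\<^sub>g + L_g (discount M) r_max M\<^sub>g M\<^sub>h
                 + sigma_h (discount M) r_max M\<^sub>g M\<^sub>h H) / (real T + 1) powr (1 / 2))
           + sqrt \<epsilon>_bias / (1 - discount M)"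
proof -
  interpret smooth_mdp M r_max pol M\<^sub>g M\<^sub>h
    by (intro smooth_mdp.intro mdp policies smooth_mdp_axioms.intro pol_pos pol_C2 M_pos score_bound score_hessian_bound)
  have "0 < ln (real T + 1) / (1 - discount M)"
    using T discount by simp
  \<comment> \<open>The trajectory density contains the pair at time zero, so a positive length is
    what makes \<open>traj_dist\<close> a probability law.\<close>
  then have H0: "0 < H"
    unfolding H horizon_def by simp
  let ?N = "nharpg_output M pol H \<eta> \<alpha> \<theta>\<^sub>0 \<theta>\<^sub>1 d\<^sub>0 T"
  \<comment> \<open>A lower bound for \<open>J_par\<close> at every parameter, by
    \<open>optimality_gap\<close>, and hence for its mean under the output law.\<close>
  define c where "c = optimal_return M - sqrt \<epsilon>_bias / (1 - discount M)"
  note N = nharpg_output_prob[OF H0, of \<eta> \<alpha> \<theta>\<^sub>0 \<theta>\<^sub>1 d\<^sub>0 T]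
  interpret N: prob_space ?N using prob_algebraD(3)[OF N] .
  have "J_par M pol \<in> borel_measurable borel"
    by (intro borel_measurable_continuous_onI continuous_at_imp_continuous_on ballI
        differentiable_imp_continuous_within J_par_differentiable)
  then have int: "integrable ?N (J_par M pol)"
    using J_par_bounded by (intro integrable_bounded_prob[OF N]) auto
  have "c = (\<integral>\<theta>. c \<partial>?N)"
    by (simp add: N.prob_space)
  also have "\<dots> \<le> (\<integral>\<theta>. J_par M pol \<theta> \<partial>?N)"
    using int optimality_gap[OF optimal \<mu>_pos fisher bias]
    by (intro integral_mono) (auto simp: c_def algebra_simps)
  finally have "optimal_return M - (\<integral>\<theta>. J_par M pol \<theta> \<partial>?N) \<le> sqrt \<epsilon>_bias / (1 - discount M)"
    by (simp add: c_def)
  moreover have "0 \<le> abs_const * ((sigma_g (discount M) r_max M\<^sub>g + L_g (discount M) r_max M\<^sub>g M\<^sub>h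
      + sigma_h (discount M) r_max M\<^sub>g M\<^sub>h H) / (real T + 1) powr (1 / 2))"
    using r_max_pos M_pos discount by (simp add: abs_const_def sigma_g_def sigma_h_def L_g_def)
  ultimately show ?thesis by linarith
qed

end
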